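(* Let $G$ be a virtually free pro-$p$ group. Then $G$ is either virtually procyclic or randomly free.
   Context: A pro-$p$ group is virtually free pro-$p$ if it has an open subgroup which is a free pro-$p$ group. For a profinite group $G$ with normalised Haar measure, a non-trivial word $w\in F_r$ is a probabilistic identity on $G$ if the set of $(g_1,\ldots,g_r)\in G^r$ with $w(g_1,\ldots,g_r)=1$ has positive Haar measure in $G^r$; $G$ is randomly free if it has no probabilistic identity. *)

theory Defs
  imports "HOL-Analysis.Analysis" "HOL-Probability.Probability" "HOL-Algebra.Algebra"
begin

definition topological_group :: "('a, 'b) monoid_scheme \<Rightarrow> 'a topology \<Rightarrow> bool" where
  "topological_group G T \<longleftrightarrow> group G \<and> topspace T = carrier G \<and>
     continuous_map (prod_topology T T) T (\<lambda>(x, y). x \<otimes>\<^bsub>G\<^esub> y) \<and>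
     continuous_map T T (\<lambda>x. inv\<^bsub>G\<^esub> x)"

definition totally_disconnected_space :: "'a topology \<Rightarrow> bool" where
  "totally_disconnected_space T \<longleftrightarrow>
     (\<forall>S. S \<subseteq> topspace T \<and> connectedin T S \<longrightarrow> (\<exists>a. S \<subseteq> {a}))"

definition profinite_group :: "('a, 'b) monoid_scheme \<Rightarrow> 'a topology \<Rightarrow> bool" where
  "profinite_group G T \<longleftrightarrow> topological_group G T \<and> compact_space T \<and>
     Hausdorff_space T \<and> totally_disconnected_space T"

definition pro_p_group :: "nat \<Rightarrow> ('a, 'b) monoid_scheme \<Rightarrow> 'a topology \<Rightarrow> bool" where
  "pro_p_group p G T \<longleftrightarrow> Factorial_Ring.prime p \<and> profinite_group G T \<and>
     (\<forall>N. N \<lhd> G \<and> openin T N \<longrightarrow> (\<exists>k. card (rcosets\<^bsub>G\<^esub> N) = p ^ k))"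

definition open_subgroup :: "'a set \<Rightarrow> ('a, 'b) monoid_scheme \<Rightarrow> 'a topology \<Rightarrow> bool" where
  "open_subgroup H G T \<longleftrightarrow> subgroup H G \<and> openin T H"

text \<open>Finite p-groups; every finite group is isomorphic to one whose carrier consists
  of natural numbers, so we let the carrier type be nat.\<close>
definition finite_p_group :: "nat \<Rightarrow> nat monoid \<Rightarrow> bool" where
  "finite_p_group p P \<longleftrightarrow> group P \<and> finite (carrier P) \<and> (\<exists>k. card (carrier P) = p ^ k)"

definition continuous_to_discrete :: "'a topology \<Rightarrow> ('a \<Rightarrow> nat) \<Rightarrow> bool" where
  "continuous_to_discrete S \<phi> \<longleftrightarrow> (\<forall>y. openin S {x \<in> topspace S. \<phi> x = y})"

text \<open>F is a free pro-p group on the subset B converging to 1 (Ribes--Zalesskii):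
  every map from B to a finite p-group sending almost all elements to 1 extends
  uniquely to a continuous homomorphism.\<close>
definition free_pro_p_on :: "nat \<Rightarrow> ('a, 'b) monoid_scheme \<Rightarrow> 'a topology \<Rightarrow> 'a set \<Rightarrow> bool" where
  "free_pro_p_on p F S B \<longleftrightarrow> pro_p_group p F S \<and> B \<subseteq> carrier F \<and>
     (\<forall>U. openin S U \<and> \<one>\<^bsub>F\<^esub> \<in> U \<longrightarrow> finite (B - U)) \<and>
     (\<forall>(P :: nat monoid) f. finite_p_group p P \<and> f \<in> B \<rightarrow> carrier P \<and>
         finite {x \<in> B. f x \<noteq> one P} \<longrightarrow>
        (\<exists>\<phi>. \<phi> \<in> hom F P \<and> continuous_to_discrete S \<phi> \<and> (\<forall>x\<in>B. \<phi> x = f x) \<and>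
           (\<forall>\<psi>. \<psi> \<in> hom F P \<and> continuous_to_discrete S \<psi> \<and> (\<forall>x\<in>B. \<psi> x = f x)
                 \<longrightarrow> (\<forall>x\<in>carrier F. \<psi> x = \<phi> x))))"

definition free_pro_p_group :: "nat \<Rightarrow> ('a, 'b) monoid_scheme \<Rightarrow> 'a topology \<Rightarrow> bool" where
  "free_pro_p_group p F S \<longleftrightarrow> (\<exists>B. free_pro_p_on p F S B)"

definition virtually_free_pro_p :: "nat \<Rightarrow> ('a, 'b) monoid_scheme \<Rightarrow> 'a topology \<Rightarrow> bool" where
  "virtually_free_pro_p p G T \<longleftrightarrow> pro_p_group p G T \<and>
     (\<exists>H. open_subgroup H G T \<and> free_pro_p_group p (G\<lparr>carrier := H\<rparr>) (subtopology T H))"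

definition procyclic :: "('a, 'b) monoid_scheme \<Rightarrow> 'a topology \<Rightarrow> bool" where
  "procyclic G T \<longleftrightarrow> (\<exists>g \<in> carrier G. T closure_of (generate G {g}) = carrier G)"

definition virtually_procyclic :: "('a, 'b) monoid_scheme \<Rightarrow> 'a topology \<Rightarrow> bool" where
  "virtually_procyclic G T \<longleftrightarrow>
     (\<exists>H. open_subgroup H G T \<and> procyclic (G\<lparr>carrier := H\<rparr>) (subtopology T H))"

text \<open>A word in F_r is a list of letters (i, b): generator x_i (i < r), with b = True
  for x_i and b = False for x_i^{-1}. Reduced nonempty words are exactly the
  nontrivial elements of F_r.\<close>
definition word_in :: "nat \<Rightarrow> (nat \<times> bool) list \<Rightarrow> bool" where
  "word_in r w \<longleftrightarrow> (\<forall>(i, b) \<in> set w. i < r)"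

fun reduced_word :: "(nat \<times> bool) list \<Rightarrow> bool" where
  "reduced_word ((i, b) # (j, c) # w) \<longleftrightarrow> \<not> (i = j \<and> b \<noteq> c) \<and> reduced_word ((j, c) # w)"
| "reduced_word _ \<longleftrightarrow> True"

definition nontrivial_word :: "nat \<Rightarrow> (nat \<times> bool) list \<Rightarrow> bool" where
  "nontrivial_word r w \<longleftrightarrow> word_in r w \<and> reduced_word w \<and> w \<noteq> []"

definition eval_word :: "('a, 'b) monoid_scheme \<Rightarrow> (nat \<times> bool) list \<Rightarrow> (nat \<Rightarrow> 'a) \<Rightarrow> 'a" where
  "eval_word G w g = foldr (\<lambda>(i, b) acc. (if b then g i else inv\<^bsub>G\<^esub> (g i)) \<otimes>\<^bsub>G\<^esub> acc) w \<one>\<^bsub>G\<^esub>"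

definition power_top :: "'a topology \<Rightarrow> nat \<Rightarrow> (nat \<Rightarrow> 'a) topology" where
  "power_top T r = product_topology (\<lambda>_. T) {..<r}"

definition haar_measure_power :: "('a, 'b) monoid_scheme \<Rightarrow> 'a topology \<Rightarrow> nat \<Rightarrow> (nat \<Rightarrow> 'a) measure \<Rightarrow> bool" where
  "haar_measure_power G T r \<mu> \<longleftrightarrow>
     prob_space \<mu> \<and>
     space \<mu> = topspace (power_top T r) \<and>
     sets \<mu> = sigma_sets (topspace (power_top T r)) (Collect (openin (power_top T r))) \<and>
     (\<forall>g \<in> topspace (power_top T r). \<forall>A \<in> sets \<mu>.
        emeasure \<mu> ((\<lambda>x. \<lambda>i\<in>{..<r}. g i \<otimes>\<^bsub>G\<^esub> x i) ` A) = emeasure \<mu> A) \<and>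
     (\<forall>A \<in> sets \<mu>. emeasure \<mu> A =
        (SUP K \<in> {K. K \<subseteq> A \<and> compactin (power_top T r) K}. emeasure \<mu> K))"

definition probabilistic_identity :: "('a, 'b) monoid_scheme \<Rightarrow> 'a topology \<Rightarrow> nat \<Rightarrow> (nat \<times> bool) list \<Rightarrow> bool" where
  "probabilistic_identity G T r w \<longleftrightarrow> nontrivial_word r w \<and>
     (\<exists>\<mu>. haar_measure_power G T r \<mu> \<and>
        emeasure \<mu> {g \<in> topspace (power_top T r). eval_word G w g = \<one>\<^bsub>G\<^esub>} > 0)"

definition randomly_free :: "('a, 'b) monoid_scheme \<Rightarrow> 'a topology \<Rightarrow> bool" where
  "randomly_free G T \<longleftrightarrow> \<not> (\<exists>r w. probabilistic_identity G T r w)"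

end

theory Submission
  imports Defs
begin

text \<open>
  Let \<open>H\<close> be an open free pro-\<open>p\<close> subgroup with basis \<open>B\<close>. If \<open>B\<close> has at most one element, \<open>H\<close> is procyclic.
  Otherwise let \<open>N0\<close> be the normal core of \<open>H\<close> and \<open>K\<close> the centralizer of \<open>N0\<close>, and suppose that \<open>w\<close> is a
  shortest reduced word with \<open>w(x) \<in> K\<close> on a set of positive measure. On a closed subset \<open>Y\<close> of positive measure
  no nonempty prefix of the tail of \<open>w\<close> lies in \<open>K\<close> modulo a suitable open normal subgroup.
  For every small open normal \<open>N\<close>, \<open>Y\<close> fills more than half of some coset \<open>y N\<^sup>r\<close>, so it meets its
  translates by \<open>N\<^sup>r\<close>. Comparing \<open>w\<close> at \<open>y\<close> and at a translate of \<open>y\<close> modulo commutators of \<open>N\<close> shows that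
  the Fox derivative \<open>D = 1 + \<Sum> \<plusminus> t\<close> of \<open>w\<close> at \<open>y\<close> maps the abelianization of \<open>N\<close> into the image of \<open>K\<close>,
  where minimality of \<open>w\<close> ensures that no \<open>t\<close> centralizes \<open>N0\<close>.

  To refute this, let \<open>M \<supseteq> N\<close> with \<open>M / N\<close> abelian and replace \<open>D\<close> by \<open>u D - D (t\<^sup>-\<^sup>1 u t)\<close> with \<open>u \<in> M\<close>: this kills
  the term \<open>t\<close> and multiplies the term \<open>1\<close> by \<open>u - t\<^sup>-\<^sup>1 u t\<close>. After all \<open>t\<close> are gone, a product of
  factors \<open>1 - c\<close> with \<open>c \<in> M / N\<close> of large order annihilates the abelianization of \<open>N\<close>. The Magnus
  embedding of \<open>H\<close> into wreath products provides both the elements \<open>u\<close> and an element of \<open>N\<close>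
  whose Fox derivative has two terms on \<open>M / N\<close>, which such a product cannot kill.
\<close>

section \<open>Profinite groups\<close>

text \<open>Fox derivatives live on \<open>H\<close>, while the conjugators \<open>t\<close> are
  arbitrary elements of \<open>G\<close>. The derivative on \<open>N\<close> is equivariant only
  under conjugation by \<open>H\<close>, so the derivatives of the conjugates of \<open>n\<close> by
  the various \<open>t\<close> are unrelated functions, and cancellation between the terms of
  \<open>D\<close> cannot be analysed directly. Conjugating \<open>n\<close> by an element of
  \<open>M\<close> does however translate each of these functions inside \<open>M / N\<close>, by an
  amount that depends on \<open>t\<close>. The elimination rests on this and on the fact that each
  \<open>t\<close> moves elements of \<open>M / N\<close>; that fact comes from commutators of
  \<open>t\<close> with elements of \<open>N0\<close>, which lie in \<open>H\<close> again. The
  second difficulty is the order of choices. The terms of \<open>D\<close> must be known before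
  \<open>n\<close> is chosen, but the point of \<open>Y\<close> whose translate by an element built
  from \<open>n\<close> stays in \<open>Y\<close> is found only afterwards. A coset more than half
  filled by \<open>Y\<close> resolves this: \<open>D\<close> is computed at one fixed point of the
  coset, and modulo commutators of \<open>N\<close> the values of a word at all points of the coset
  act on \<open>N\<close> by the same conjugation.\<close>

lemma clopen_base_totally_disconnected:
  assumes "compact_space Z" "Hausdorff_space Z" "totally_disconnected_space Z"
    and "openin Z U" "x \<in> U"
  obtains C where "openin Z C" "closedin Z C" "x \<in> C" "C \<subseteq> U"
proof -
  have x: "x \<in> topspace Z"
    using assms openin_subset by blast
  \<comment> \<open>In a compact Hausdorff space quasi-components are components, here single
    points; compactness of the complement of \<open>U\<close> then gives one clopen set that
    separates it from \<open>x\<close>.\<close>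
  have eq: "quasi_components_of Z = connected_components_of Z"
    using assms by (intro quasi_eq_connected_components_of) auto
  let ?Q = "quasi_component_of_set Z x"
  have Q: "?Q \<in> quasi_components_of Z"
    using x by (simp add: quasi_component_in_quasi_components_of)
  then have "connectedin Z ?Q"
    using eq connectedin_connected_components_of by blast
  then obtain a where "?Q \<subseteq> {a}"
    using assms(3) quasi_component_of_subset_topspace unfolding totally_disconnected_space_def by meson
  moreover have "x \<in> ?Q"
    using x by simp
  ultimately have Qx: "?Q = {x}" by blast
  have "compactin Z (topspace Z - U)"
    using assms closedin_compact_space by blast
  then have "separated_between Z ?Q (topspace Z - U)"
    using separated_between_quasi_component_compact[OF Q] assms(5) Qx by (simp add: disjnt_iff)
  then obtain C where "openin Z C" "closedin Z C" "?Q \<subseteq> C" "topspace Z - U \<subseteq> topspace Z - C"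
    unfolding separated_between by blast
  moreover have "C \<subseteq> U"
    using calculation closedin_subset by blast
  ultimately show ?thesis
    using that Qx by auto
qed

lemma (in group) cancel_inv_left: "x \<in> carrier G \<Longrightarrow> y \<in> carrier G \<Longrightarrow> inv x \<otimes> (x \<otimes> y) = y"
  and cancel_inv_right: "x \<in> carrier G \<Longrightarrow> y \<in> carrier G \<Longrightarrow> x \<otimes> (inv x \<otimes> y) = y"
  by (simp_all add: m_assoc[symmetric])

lemmas (in group) group_norm = m_assoc inv_mult_group cancel_inv_left cancel_inv_right

lemma (in group) coset_eq_iff:
  assumes "N \<lhd> G" "x \<in> carrier G" "y \<in> carrier G"
  shows "N #> x = N #> y \<longleftrightarrow> x \<otimes> inv y \<in> N"
proof -
  have sN: "subgroup N G" using assms(1) normal_imp_subgroup by blast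
  have "x \<in> N #> y \<longleftrightarrow> x \<otimes> inv y \<in> N"
    using subgroup.rcos_module[OF sN is_group assms(3,2)] .
  moreover have "x \<in> N #> y \<longleftrightarrow> N #> x = N #> y"
    using repr_independence[of x N y] rcos_self[of x N] assms sN by metis
  ultimately show ?thesis by simp
qed

locale profinite = group G for G (structure) +
  fixes T :: "'a topology"
  assumes profinite: "profinite_group G T"
begin

abbreviation open_normal :: "'a set \<Rightarrow> bool" where
  "open_normal N \<equiv> N \<lhd> G \<and> openin T N"

lemma topspace_eq [simp]: "topspace T = carrier G"
  and compact: "compact_space T" and Hausdorff: "Hausdorff_space T"
  and disconnected: "totally_disconnected_space T"
  and continuous_mult: "continuous_map (prod_topology T T) T (\<lambda>(x, y). x \<otimes> y)"
  and continuous_inv: "continuous_map T T (\<lambda>x. inv x)"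
  using profinite by (auto simp: profinite_group_def topological_group_def)

lemma continuous_map_mult:
  assumes "continuous_map Z T f" "continuous_map Z T g"
  shows "continuous_map Z T (\<lambda>x. f x \<otimes> g x)"
proof -
  have "continuous_map Z (prod_topology T T) (\<lambda>x. (f x, g x))"
    using assms by (simp add: continuous_map_pairedI)
  from continuous_map_compose[OF this continuous_mult] show ?thesis
    by (simp add: o_def)
qed

lemma continuous_map_inv:
  "continuous_map Z T f \<Longrightarrow> continuous_map Z T (\<lambda>x. inv (f x))"
  using continuous_map_compose[OF _ continuous_inv] by (simp add: o_def)

lemma openin_union_of_cosets:
  assumes M: "subgroup M G" "openin T M" and A: "A \<subseteq> carrier G"
    and closed: "\<And>x m. x \<in> A \<Longrightarrow> m \<in> M \<Longrightarrow> x \<otimes> m \<in> A"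
  shows "openin T A"
proof (subst openin_subopen, intro ballI)
  fix x assume x: "x \<in> A"
  then have xG: "x \<in> carrier G" using A by blast
  let ?U = "{y \<in> topspace T. inv x \<otimes> y \<in> M}"
  have "openin T ?U"
    using xG by (intro openin_continuous_map_preimage[OF _ M(2)] continuous_map_mult) auto
  moreover have "x \<in> ?U"
    using xG M(1) by (simp add: subgroup.one_closed)
  moreover have "?U \<subseteq> A"
  proof
    fix y assume "y \<in> ?U"
    then show "y \<in> A"
      using closed[OF x, of "inv x \<otimes> y"] xG by (simp add: inv_solve_left m_assoc[symmetric])
  qed
  ultimately show "\<exists>U. openin T U \<and> x \<in> U \<and> U \<subseteq> A" by blast
qed

lemma closedin_union_of_cosets:
  assumes M: "subgroup M G" "openin T M" and A: "A \<subseteq> carrier G"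
    and closed: "\<And>x m. x \<in> A \<Longrightarrow> m \<in> M \<Longrightarrow> x \<otimes> m \<in> A"
  shows "closedin T A"
proof -
  have "openin T (carrier G - A)"
  proof (rule openin_union_of_cosets[OF M])
    fix x m assume x: "x \<in> carrier G - A" and m: "m \<in> M"
    have mG: "m \<in> carrier G" by (rule subgroup.mem_carrier[OF M(1) m])
    have "x \<otimes> m \<notin> A"
    proof
      assume "x \<otimes> m \<in> A"
      moreover have "inv m \<in> M" using M(1) m by (rule subgroup.m_inv_closed)
      ultimately have "x \<otimes> m \<otimes> inv m \<in> A" by (rule closed)
      then show False using x mG by (simp add: m_assoc)
    qed
    then show "x \<otimes> m \<in> carrier G - A" using x mG by auto
  qed simp
  then show ?thesis
    using A by (simp add: closedin_def)
qed

text \<open>Projecting along a compact factor is a closed map.\<close>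
lemma openin_forall:
  assumes D: "closedin T D" and U: "openin T U"
    and c: "continuous_map (prod_topology T T) T (\<lambda>(x, y). f x y)"
  shows "openin T {y \<in> carrier G. \<forall>x\<in>D. f x y \<in> U}"
proof -
  let ?C = "{z \<in> topspace (prod_topology T T). fst z \<in> D \<and> (\<lambda>(x, y). f x y) z \<in> carrier G - U}"
  have "closedin (prod_topology T T)
      ({z \<in> topspace (prod_topology T T). fst z \<in> D} \<inter>
       {z \<in> topspace (prod_topology T T). (\<lambda>(x, y). f x y) z \<in> carrier G - U})"
    using U closedin_diff[OF closedin_topspace, of T U]
    by (intro closedin_Int closedin_continuous_map_preimage[OF continuous_map_fst D]
        closedin_continuous_map_preimage[OF c]) auto
  moreover have "\<dots> = ?C" by auto
  ultimately have "closedin (prod_topology T T) ?C" by simp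
  then have "closedin T (snd ` ?C)"
    using Abstract_Topological_Spaces.closed_map_snd[OF compact] unfolding closed_map_def by blast
  then have "openin T (topspace T - snd ` ?C)" by blast
  moreover have "topspace T - snd ` ?C = {y \<in> carrier G. \<forall>x\<in>D. f x y \<in> U}"
  proof -
    have "f x y \<in> carrier G" if "x \<in> carrier G" "y \<in> carrier G" for x y
      using continuous_map_image_subset_topspace[OF c] that by auto
    moreover have "D \<subseteq> carrier G" using closedin_subset[OF D] by simp
    ultimately show ?thesis by (auto simp: image_iff)
  qed
  ultimately show ?thesis by simp
qed

definition core :: "'a set \<Rightarrow> 'a set" where
  "core M = {x \<in> carrier G. \<forall>g\<in>carrier G. g \<otimes> x \<otimes> inv g \<in> M}"

lemma core_subset: "core M \<subseteq> M"
proof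
  fix x assume "x \<in> core M"
  then have "\<one> \<otimes> x \<otimes> inv \<one> \<in> M" "x \<in> carrier G" unfolding core_def by blast+
  then show "x \<in> M" by simp
qed

text \<open>Openness comes from compactness of \<open>G\<close>, by \<open>openin_forall\<close>
  applied to conjugation, rather than from an intersection of finitely many conjugates.\<close>

lemma open_normal_core:
  assumes M: "subgroup M G" "openin T M"
  shows "open_normal (core M)"
proof -
  let ?N = "{x \<in> carrier G. \<forall>g\<in>carrier G. g \<otimes> x \<otimes> inv g \<in> M}"
  have "openin T ?N"
  proof (rule openin_forall[OF _ M(2)])
    show "closedin T (carrier G)"
      using closedin_topspace[of T] by simp
    have "continuous_map (prod_topology T T) T (\<lambda>z. fst z \<otimes> snd z \<otimes> inv (fst z))"
      by (intro continuous_map_mult continuous_map_inv continuous_map_fst continuous_map_snd)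
    then show "continuous_map (prod_topology T T) T (\<lambda>(x, y). x \<otimes> y \<otimes> inv x)"
      by (simp add: case_prod_unfold)
  qed
  moreover have "?N \<lhd> G"
  proof (rule normal_invI)
    show "subgroup ?N G"
    proof
      fix x y assume x: "x \<in> ?N" and y: "y \<in> ?N"
      have "g \<otimes> (x \<otimes> y) \<otimes> inv g \<in> M" if "g \<in> carrier G" for g
      proof -
        have "g \<otimes> (x \<otimes> y) \<otimes> inv g = (g \<otimes> x \<otimes> inv g) \<otimes> (g \<otimes> y \<otimes> inv g)"
          using x y that by (simp add: group_norm)
        then show ?thesis using x y that M(1) by (simp add: subgroup.m_closed)
      qed
      then show "x \<otimes> y \<in> ?N" using x y by auto
    next
      fix x assume x: "x \<in> ?N"
      have "g \<otimes> inv x \<otimes> inv g \<in> M" if "g \<in> carrier G" for g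
      proof -
        have "g \<otimes> inv x \<otimes> inv g = inv (g \<otimes> x \<otimes> inv g)"
          using x that by (simp add: inv_mult_group m_assoc)
        then show ?thesis using x that M(1) by (simp add: subgroup.m_inv_closed)
      qed
      then show "inv x \<in> ?N" using x by auto
    qed (use M(1) in \<open>auto simp: subgroup.one_closed\<close>)
    fix g x assume g: "g \<in> carrier G" and x: "x \<in> ?N"
    have "k \<otimes> (g \<otimes> x \<otimes> inv g) \<otimes> inv k \<in> M" if k: "k \<in> carrier G" for k
    proof -
      have "k \<otimes> (g \<otimes> x \<otimes> inv g) \<otimes> inv k = (k \<otimes> g) \<otimes> x \<otimes> inv (k \<otimes> g)"
        using g x k by (simp add: inv_mult_group m_assoc)
      then show ?thesis using g x k by auto
    qed
    then show "g \<otimes> x \<otimes> inv g \<in> ?N" using g x by auto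
  qed
  ultimately show ?thesis by (simp add: core_def)
qed

text \<open>The right stabilizer of a clopen set \<open>C\<close> is a subgroup, and it is open
  because \<open>C\<close> is both closed (hence compact) and open. As \<open>C\<close> contains the
  identity, the stabilizer lies in \<open>C\<close>; its core is the required subgroup.\<close>

lemma open_normal_base:
  assumes "openin T U" "\<one> \<in> U"
  obtains N where "open_normal N" "N \<subseteq> U"
proof -
  obtain C where C: "openin T C" "closedin T C" "\<one> \<in> C" "C \<subseteq> U"
    using clopen_base_totally_disconnected[OF compact Hausdorff disconnected assms] by blast
  have CG: "C \<subseteq> carrier G" using closedin_subset[OF C(2)] by simp
  let ?S = "{y \<in> carrier G. \<forall>x\<in>C. x \<otimes> y \<in> C} \<inter> {y \<in> carrier G. \<forall>x\<in>C. x \<otimes> inv y \<in> C}"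
  have "continuous_map (prod_topology T T) T (\<lambda>z. fst z \<otimes> inv (snd z))"
    by (intro continuous_map_mult continuous_map_inv continuous_map_fst continuous_map_snd)
  then have "continuous_map (prod_topology T T) T (\<lambda>(x, y). x \<otimes> inv y)"
    by (simp add: case_prod_unfold)
  then have S: "openin T ?S"
    using C by (intro openin_Int openin_forall continuous_mult)
  have "subgroup ?S G"
  proof
    fix x y assume xy: "x \<in> ?S" "y \<in> ?S"
    then have "z \<otimes> (x \<otimes> y) = (z \<otimes> x) \<otimes> y" "z \<otimes> inv (x \<otimes> y) = (z \<otimes> inv y) \<otimes> inv x"
      if "z \<in> C" for z
      using that CG by (auto simp: group_norm)
    with xy show "x \<otimes> y \<in> ?S" by simp
  qed (use CG in auto)
  then have "open_normal (core ?S)" using S by (rule open_normal_core)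
  moreover have "?S \<subseteq> C"
  proof
    fix x assume "x \<in> ?S"
    then have "\<one> \<otimes> x \<in> C" "x \<in> carrier G" using C(3) by blast+
    then show "x \<in> C" by simp
  qed
  ultimately show ?thesis using that[of "core ?S"] C(4) core_subset[of ?S] by (meson subset_trans)
qed

lemma open_normal_Int: "open_normal M \<Longrightarrow> open_normal N \<Longrightarrow> open_normal (M \<inter> N)"
  by (auto intro: normal_subgroup_intersect openin_Int)

lemma open_normal_avoiding:
  assumes "x \<in> carrier G" "x \<noteq> \<one>"
  obtains N where "open_normal N" "x \<notin> N"
proof -
  have "t1_space T" using Hausdorff by (simp add: Hausdorff_imp_t1_space)
  then have "closedin T {x}"
    using assms by (simp add: closedin_t1_singleton)
  then have "openin T (topspace T - {x})" by blast
  moreover have "\<one> \<in> topspace T - {x}" using assms by simp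
  ultimately show ?thesis
    by (rule open_normal_base) (use that in blast)
qed

end

section \<open>Haar measure on powers\<close>

context profinite
begin

lemma open_normal_carrier: "open_normal (carrier G)"
  using normal_imp_subgroup openin_topspace[of T] normal_self by simp

lemma normal_subset: "N \<lhd> G \<Longrightarrow> N \<subseteq> carrier G"
  using normal_imp_subgroup subgroup.subset by metis

lemma open_normal_finite_Int:
  assumes "finite I" "\<And>i. i \<in> I \<Longrightarrow> \<exists>N. open_normal N \<and> N \<subseteq> U i"
  shows "\<exists>N. open_normal N \<and> (\<forall>i\<in>I. N \<subseteq> U i)"
  using assms
proof (induction I rule: finite_induct)
  case empty
  then show ?case using open_normal_carrier by auto
next
  case (insert i I)
  obtain N where N: "open_normal N" "\<forall>j\<in>I. N \<subseteq> U j"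
    using insert.IH insert.prems by (meson insertI2)
  obtain M where M: "open_normal M" "M \<subseteq> U i"
    using insert.prems by (meson insertI1)
  have "open_normal (M \<inter> N)" using open_normal_Int M N by simp
  moreover have "\<forall>j\<in>insert i I. M \<inter> N \<subseteq> U j" using M N by blast
  ultimately show ?case by blast
qed

lemma quotient_in_sym:
  assumes "N \<lhd> G" "x \<in> carrier G" "y \<in> carrier G" "x \<otimes> inv y \<in> N"
  shows "y \<otimes> inv x \<in> N"
proof -
  have "inv (x \<otimes> inv y) \<in> N"
    using assms normal_imp_subgroup subgroup.m_inv_closed by metis
  then show ?thesis using assms by (simp add: inv_mult_group)
qed

lemma quotient_in_trans:
  assumes "N \<lhd> G" "x \<in> carrier G" "y \<in> carrier G" "z \<in> carrier G" "x \<otimes> inv y \<in> N" "y \<otimes> inv z \<in> N"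
  shows "x \<otimes> inv z \<in> N"
proof -
  have "(x \<otimes> inv y) \<otimes> (y \<otimes> inv z) \<in> N"
    using assms normal_imp_subgroup subgroup.m_closed by metis
  then show ?thesis using assms by (simp add: group_norm)
qed

abbreviation close :: "nat \<Rightarrow> 'a set \<Rightarrow> (nat \<Rightarrow> 'a) \<Rightarrow> (nat \<Rightarrow> 'a) \<Rightarrow> bool" where
  "close r N x y \<equiv> (\<forall>i<r. x i \<otimes> inv (y i) \<in> N)"

lemma topspace_power: "topspace (power_top T r) = {..<r} \<rightarrow>\<^sub>E carrier G"
  by (simp add: power_top_def)

lemma in_power_carrier: "x \<in> topspace (power_top T r) \<Longrightarrow> i < r \<Longrightarrow> x i \<in> carrier G"
  unfolding topspace_power by auto

lemma continuous_map_coordinate: "i < r \<Longrightarrow> continuous_map (power_top T r) T (\<lambda>x. x i)"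
  using continuous_map_product_projection[of i "{..<r}" "\<lambda>_. T"] by (simp add: power_top_def)

lemma openin_close:
  assumes "open_normal N" "y \<in> topspace (power_top T r)"
  shows "openin (power_top T r) {x \<in> topspace (power_top T r). close r N x y}"
proof -
  have "openin (power_top T r) {x \<in> topspace (power_top T r). x i \<otimes> inv (y i) \<in> N}" if "i < r" for i
    using that assms in_power_carrier[OF assms(2) that]
    by (intro openin_continuous_map_preimage[where Y = T] continuous_map_mult continuous_map_coordinate) auto
  then have "openin (power_top T r) (topspace (power_top T r) \<inter>
      (\<Inter>i\<in>{..<r}. {x \<in> topspace (power_top T r). x i \<otimes> inv (y i) \<in> N}))"
    by (cases "r = 0") (auto intro!: openin_Int openin_INT)
  moreover have "\<dots> = {x \<in> topspace (power_top T r). close r N x y}" by auto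
  ultimately show ?thesis by simp
qed

lemma open_normal_power_base:
  assumes W: "openin (power_top T r) W" and z: "z \<in> W"
  obtains N where "open_normal N" "\<And>y. y \<in> topspace (power_top T r) \<Longrightarrow> close r N y z \<Longrightarrow> y \<in> W"
proof -
  have zt: "z \<in> topspace (power_top T r)" using openin_subset[OF W] z by blast
  obtain U where U: "z \<in> (\<Pi>\<^sub>E i\<in>{..<r}. U i)" "\<And>i. openin T (U i)" "(\<Pi>\<^sub>E i\<in>{..<r}. U i) \<subseteq> W"
    using product_topology_open_contains_basis[OF W[unfolded power_top_def] z] by auto
  let ?V = "\<lambda>i. {h \<in> topspace T. h \<otimes> z i \<in> U i}"
  have "\<exists>N. open_normal N \<and> N \<subseteq> ?V i" if "i \<in> {..<r}" for i
  proof -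
    have zi: "z i \<in> carrier G" using in_power_carrier[OF zt] that by simp
    have "openin T (?V i)"
      using zi by (intro openin_continuous_map_preimage[OF _ U(2)] continuous_map_mult) auto
    moreover have "\<one> \<in> ?V i" using zi U(1) that by auto
    ultimately show ?thesis by (rule open_normal_base) blast
  qed
  then obtain N where N: "open_normal N" "\<forall>i\<in>{..<r}. N \<subseteq> ?V i"
    using open_normal_finite_Int[of "{..<r}" ?V] by blast
  show ?thesis
  proof (rule that[OF N(1)])
    fix y assume y: "y \<in> topspace (power_top T r)" and c: "close r N y z"
    have "y i \<in> U i" if "i < r" for i
    proof -
      have "y i \<otimes> inv (z i) \<in> ?V i" using c N(2) that by blast
      then show ?thesis
        using in_power_carrier[OF y that] in_power_carrier[OF zt that] by (simp add: m_assoc)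
    qed
    then have "y \<in> (\<Pi>\<^sub>E i\<in>{..<r}. U i)"
      using y by (auto simp: topspace_power PiE_iff)
    then show "y \<in> W" using U(3) by blast
  qed
qed

end

locale haar_power = profinite +
  fixes r :: nat and \<mu> :: "(nat \<Rightarrow> 'a) measure"
  assumes haar: "haar_measure_power G T r \<mu>"
begin

abbreviation PT :: "(nat \<Rightarrow> 'a) topology" where "PT \<equiv> power_top T r"

lemma prob: "prob_space \<mu>" and space_eq: "space \<mu> = topspace PT"
  and sets_eq: "sets \<mu> = sigma_sets (topspace PT) (Collect (openin PT))"
  and invariant: "\<And>g A. g \<in> topspace PT \<Longrightarrow> A \<in> sets \<mu> \<Longrightarrow>
        emeasure \<mu> ((\<lambda>x. \<lambda>i\<in>{..<r}. g i \<otimes> x i) ` A) = emeasure \<mu> A"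
  and regular: "\<And>A. A \<in> sets \<mu> \<Longrightarrow> emeasure \<mu> A = (SUP K \<in> {K. K \<subseteq> A \<and> compactin PT K}. emeasure \<mu> K)"
  using haar unfolding haar_measure_power_def by blast+

end

sublocale haar_power \<subseteq> prob_space \<mu> by (rule prob)

context haar_power
begin

lemma open_sets: "openin PT A \<Longrightarrow> A \<in> sets \<mu>"
  unfolding sets_eq by (rule sigma_sets.Basic) simp

lemma closed_sets:
  assumes "closedin PT A" shows "A \<in> sets \<mu>"
proof -
  have "space \<mu> - (topspace PT - A) \<in> sets \<mu>"
    using assms open_sets by blast
  moreover have "space \<mu> - (topspace PT - A) = A"
    using closedin_subset[OF assms] space_eq by auto
  ultimately show ?thesis by simp
qed

lemma measure_directed_union:
  assumes F: "\<And>M. open_normal M \<Longrightarrow> openin PT (F M)"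
    and anti: "\<And>M N. open_normal M \<Longrightarrow> open_normal N \<Longrightarrow> N \<subseteq> M \<Longrightarrow> F M \<subseteq> F N"
    and e: "e > 0"
  obtains M where "open_normal M" "measure \<mu> (\<Union>N\<in>{N. open_normal N}. F N) < measure \<mu> (F M) + e"
proof -
  let ?U = "\<Union>N\<in>{N. open_normal N}. F N"
  have U: "openin PT ?U" using F by blast
  have "\<exists>K. K \<subseteq> ?U \<and> compactin PT K \<and> measure \<mu> ?U < measure \<mu> K + e"
  proof (cases "measure \<mu> ?U < e")
    case True
    then show ?thesis by (intro exI[of _ "{}"]) auto
  next
    case False
    then have "ennreal (measure \<mu> ?U - e) < emeasure \<mu> ?U"
      using e by (simp add: emeasure_eq_measure ennreal_less_iff)
    then obtain K where K: "K \<subseteq> ?U" "compactin PT K" "ennreal (measure \<mu> ?U - e) < emeasure \<mu> K"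
      unfolding regular[OF open_sets[OF U]] less_SUP_iff by blast
    have "measure \<mu> ?U - e < measure \<mu> K"
      using K(3) False by (simp add: emeasure_eq_measure ennreal_less_iff)
    then show ?thesis using K by (intro exI[of _ K]) auto
  qed
  then obtain K where K: "K \<subseteq> ?U" "compactin PT K" "measure \<mu> ?U < measure \<mu> K + e" by blast
  have "\<forall>A\<in>F ` {N. open_normal N}. openin PT A" using F by blast
  then obtain \<F> where \<F>: "finite \<F>" "\<F> \<subseteq> F ` {N. open_normal N}" "K \<subseteq> \<Union>\<F>"
    using K(1,2) unfolding compactin_def by (metis (no_types, lifting))
  then obtain I where I: "finite I" "I \<subseteq> {N. open_normal N}" "\<F> = F ` I"
    by (meson finite_subset_image)
  have "\<exists>M. open_normal M \<and> (\<forall>N\<in>I. M \<subseteq> N)"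
    using I by (intro open_normal_finite_Int) blast+
  then obtain M where M: "open_normal M" "\<And>N. N \<in> I \<Longrightarrow> M \<subseteq> N" by blast
  have "K \<subseteq> F M"
  proof
    fix x assume "x \<in> K"
    then obtain N where N: "N \<in> I" "x \<in> F N" using \<F>(3) I(3) by blast
    moreover have "open_normal N" using N(1) I(2) by blast
    ultimately show "x \<in> F M" using anti[of N M] M by blast
  qed
  then have "measure \<mu> K \<le> measure \<mu> (F M)"
    using open_sets[OF F[OF M(1)]] by (rule finite_measure_mono)
  then show ?thesis using that[OF M(1)] K(3) by simp
qed

definition left_translate :: "(nat \<Rightarrow> 'a) \<Rightarrow> (nat \<Rightarrow> 'a) \<Rightarrow> nat \<Rightarrow> 'a" where
  "left_translate g x = (\<lambda>i\<in>{..<r}. g i \<otimes> x i)"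

lemma left_translate_closed:
  "g \<in> topspace PT \<Longrightarrow> x \<in> topspace PT \<Longrightarrow> left_translate g x \<in> topspace PT"
  unfolding left_translate_def topspace_power by auto

text \<open>The image under translation by \<open>g\<close> is the preimage under translation by the
  inverse of \<open>g\<close>, which is continuous and so Borel measurable.\<close>

lemma left_translate_sets:
  assumes g: "g \<in> topspace PT" and A: "A \<in> sets \<mu>"
  shows "left_translate g ` A \<in> sets \<mu>"
proof -
  let ?g = "\<lambda>i\<in>{..<r}. inv (g i)"
  have gi: "?g \<in> topspace PT" using g unfolding topspace_power by auto
  have AP: "A \<subseteq> topspace PT" using sets.sets_into_space[OF A] space_eq by simp
  have cont: "continuous_map PT PT (left_translate ?g)"
    unfolding left_translate_def
    by (subst (2) power_top_def, subst continuous_map_componentwise)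
       (use in_power_carrier[OF g] in
         \<open>auto intro!: continuous_map_mult continuous_map_coordinate simp: topspace_power\<close>)
  have "left_translate ?g -` A \<inter> space \<mu> \<in> sets \<mu>"
  proof (rule measurable_sets[OF _ A])
    show "left_translate ?g \<in> measurable \<mu> \<mu>"
    proof (rule measurable_sigma_sets[OF sets_eq])
      show "left_translate ?g \<in> space \<mu> \<rightarrow> topspace PT"
        using left_translate_closed[OF gi] space_eq by auto
      fix y assume "y \<in> Collect (openin PT)"
      then have "openin PT {x \<in> topspace PT. left_translate ?g x \<in> y}"
        using openin_continuous_map_preimage[OF cont] by simp
      moreover have "left_translate ?g -` y \<inter> space \<mu> = {x \<in> topspace PT. left_translate ?g x \<in> y}"
        using space_eq by auto
      ultimately show "left_translate ?g -` y \<inter> space \<mu> \<in> sets \<mu>"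
        using open_sets by simp
    qed (use openin_subset in auto)
  qed
  moreover have "left_translate ?g -` A \<inter> space \<mu> = left_translate g ` A"
  proof
    have inv1: "left_translate g (left_translate ?g x) = x" if "x \<in> topspace PT" for x
      using that in_power_carrier[OF that] in_power_carrier[OF g]
      by (auto simp: left_translate_def topspace_power PiE_iff extensional_def group_norm fun_eq_iff)
    have inv2: "left_translate ?g (left_translate g x) = x" if "x \<in> topspace PT" for x
      using that in_power_carrier[OF that] in_power_carrier[OF g]
      by (auto simp: left_translate_def topspace_power PiE_iff extensional_def group_norm fun_eq_iff)
    show "left_translate ?g -` A \<inter> space \<mu> \<subseteq> left_translate g ` A"
    proof
      fix x assume "x \<in> left_translate ?g -` A \<inter> space \<mu>"
      then have "left_translate ?g x \<in> A" "x \<in> topspace PT" using space_eq by auto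
      then show "x \<in> left_translate g ` A" using inv1[of x] by (intro image_eqI) auto
    qed
    show "left_translate g ` A \<subseteq> left_translate ?g -` A \<inter> space \<mu>"
    proof
      fix x assume "x \<in> left_translate g ` A"
      then obtain a where a: "a \<in> A" "x = left_translate g a" by blast
      then have "a \<in> topspace PT" using AP by blast
      then show "x \<in> left_translate ?g -` A \<inter> space \<mu>"
        using a inv2[of a] space_eq left_translate_closed[OF g] by simp
    qed
  qed
  ultimately show ?thesis by simp
qed

lemma measure_left_translate:
  "g \<in> topspace PT \<Longrightarrow> A \<in> sets \<mu> \<Longrightarrow> measure \<mu> (left_translate g ` A) = measure \<mu> A"
  using invariant[of g A] by (simp add: left_translate_def[abs_def] measure_def)

lemma close_sym:
  assumes "N \<lhd> G" "x \<in> topspace PT" "y \<in> topspace PT" "close r N x y"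
  shows "close r N y x"
proof (intro allI impI)
  fix i assume i: "i < r"
  show "y i \<otimes> inv (x i) \<in> N"
    using quotient_in_sym[OF assms(1), of "x i" "y i"] assms(4) i
      in_power_carrier[OF assms(2) i] in_power_carrier[OF assms(3) i] by blast
qed

lemma close_trans:
  assumes "N \<lhd> G" "x \<in> topspace PT" "y \<in> topspace PT" "z \<in> topspace PT" "close r N x y" "close r N y z"
  shows "close r N x z"
proof (intro allI impI)
  fix i assume i: "i < r"
  show "x i \<otimes> inv (z i) \<in> N"
    using quotient_in_trans[OF assms(1), of "x i" "y i" "z i"] assms(5,6) i
      in_power_carrier[OF assms(2) i] in_power_carrier[OF assms(3) i] in_power_carrier[OF assms(4) i] by blast
qed

text \<open>For small \<open>N\<close>, the set \<open>Y\<close> fills more than half of some coset of \<open>N\<^sup>r\<close>.\<close>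
lemma dense_coset:
  assumes fin: "\<And>N. open_normal N \<Longrightarrow> finite (rcosets N)"
    and Y: "closedin PT Y" and pos: "measure \<mu> Y > 0"
  obtains N1 where "open_normal N1"
    "\<And>N. open_normal N \<Longrightarrow> N \<subseteq> N1 \<Longrightarrow> \<exists>y\<in>Y. \<forall>g \<in> {..<r} \<rightarrow>\<^sub>E N.
        \<exists>y'\<in>Y. close r N y' y \<and> left_translate g y' \<in> Y"
proof -
  have YP: "Y \<subseteq> topspace PT" using closedin_subset[OF Y] .
  have Ys: "Y \<in> sets \<mu>" using closed_sets[OF Y] .
  \<comment> \<open>The complement of the union of the cosets of \<open>N\<close> to the power
    \<open>r\<close> that meet \<open>Y\<close>. As \<open>N\<close> shrinks these open sets exhaust
    the complement of the closed set \<open>Y\<close>, so for some \<open>N1\<close> the union of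
    cosets has measure below twice that of \<open>Y\<close>.\<close>
  define F where "F N = {z \<in> topspace PT. \<not> (\<exists>y\<in>Y. close r N z y)}" for N
  have Fo: "openin PT (F N)" if N: "open_normal N" for N
  proof (subst openin_subopen, intro ballI)
    fix z assume z: "z \<in> F N"
    then have zP: "z \<in> topspace PT" by (simp add: F_def)
    let ?V = "{x \<in> topspace PT. close r N x z}"
    have "openin PT ?V" using openin_close[OF N zP] .
    moreover have "z \<in> ?V"
      using zP in_power_carrier[OF zP] N normal_imp_subgroup[of N G] subgroup.one_closed[of N G] by auto
    moreover have "?V \<subseteq> F N"
    proof
      fix x assume x: "x \<in> ?V"
      then have xP: "x \<in> topspace PT" and c: "close r N z x"
        using close_sym[of N x z] N zP by auto
      have "\<not> close r N x y" if "y \<in> Y" for y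
      proof
        assume "close r N x y"
        then have "close r N z y" using close_trans[of N z x y] c N zP xP that YP by blast
        then show False using z that by (auto simp: F_def)
      qed
      then show "x \<in> F N" using xP by (auto simp: F_def)
    qed
    ultimately show "\<exists>U. openin PT U \<and> z \<in> U \<and> U \<subseteq> F N" by blast
  qed
  have anti: "F M \<subseteq> F N" if "N \<subseteq> M" for M N
    using that unfolding F_def by blast
  obtain N1 where N1: "open_normal N1"
      "measure \<mu> (\<Union>N\<in>{N. open_normal N}. F N) < measure \<mu> (F N1) + measure \<mu> Y"
    using measure_directed_union[of F, OF Fo anti pos] by blast
  have "topspace PT - Y \<subseteq> (\<Union>N\<in>{N. open_normal N}. F N)"
  proof
    fix z assume z: "z \<in> topspace PT - Y"
    have "openin PT (topspace PT - Y)" using Y by blast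
    from open_normal_power_base[OF this z] obtain N where N: "open_normal N"
      "\<And>y. y \<in> topspace PT \<Longrightarrow> close r N y z \<Longrightarrow> y \<in> topspace PT - Y" by blast
    have "\<not> close r N z y" if "y \<in> Y" for y
    proof
      assume "close r N z y"
      then have "close r N y z" using close_sym[of N z y] N(1) z that YP by blast
      then show False using N(2)[of y] that YP by blast
    qed
    then have "z \<in> F N" using z by (auto simp: F_def)
    then show "z \<in> (\<Union>N\<in>{N. open_normal N}. F N)" using N(1) by blast
  qed
  moreover have "openin PT (\<Union>N\<in>{N. open_normal N}. F N)" using Fo by blast
  ultimately have "measure \<mu> (topspace PT - Y) \<le> measure \<mu> (\<Union>N\<in>{N. open_normal N}. F N)"
    using open_sets by (intro finite_measure_mono) auto
  moreover have "measure \<mu> (topspace PT - Y) = 1 - measure \<mu> Y"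
    using prob_compl[OF Ys] space_eq by simp
  ultimately have half: "1 - measure \<mu> (F N1) < 2 * measure \<mu> Y"
    using N1(2) by simp
  show ?thesis
  proof (rule that[OF N1(1)])
    fix N assume N: "open_normal N" "N \<subseteq> N1"
    then have nN: "N \<lhd> G" by blast
    define fib where "fib y = {x \<in> topspace PT. close r N x y}" for y
    have fibs: "fib y \<in> sets \<mu>" if "y \<in> Y" for y
      unfolding fib_def using that YP by (intro open_sets openin_close N(1)) auto
    have self: "y \<in> fib y" if "y \<in> Y" for y
      using that YP in_power_carrier[of y] subgroup.one_closed[OF normal_imp_subgroup[OF nN]]
      by (auto simp: fib_def)
    have same: "fib y = fib y'" if "y \<in> Y" "y' \<in> Y" "x \<in> fib y" "x \<in> fib y'" for x y y'
    proof -
      have xP: "x \<in> topspace PT" and yP: "y \<in> topspace PT" "y' \<in> topspace PT"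
        using that YP by (auto simp: fib_def)
      have c: "close r N x y" "close r N x y'" using that by (auto simp: fib_def)
      have c1: "close r N y y'" using close_trans[OF nN yP(1) xP yP(2) close_sym[OF nN xP yP(1) c(1)] c(2)] .
      have c2: "close r N y' y" using close_sym[OF nN yP(1) yP(2) c1] .
      have "close r N z y \<longleftrightarrow> close r N z y'" if "z \<in> topspace PT" for z
        using close_trans[OF nN that yP(1) yP(2) _ c1] close_trans[OF nN that yP(2) yP(1) _ c2] by blast
      then show ?thesis by (auto simp: fib_def)
    qed
    have finC: "finite (fib ` Y)"
    proof (rule finite_subset)
      let ?H = "\<lambda>c. {x \<in> topspace PT. \<forall>i<r. x i \<in> c i}"
      show "finite (?H ` ({..<r} \<rightarrow>\<^sub>E rcosets N))"
        using fin[OF N(1)] by (intro finite_imageI finite_PiE) auto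
      show "fib ` Y \<subseteq> ?H ` ({..<r} \<rightarrow>\<^sub>E rcosets N)"
      proof
        fix C assume "C \<in> fib ` Y"
        then obtain y where y: "y \<in> Y" "C = fib y" by blast
        let ?c = "\<lambda>i\<in>{..<r}. N #> y i"
        have "?c \<in> {..<r} \<rightarrow>\<^sub>E rcosets N"
          using y YP in_power_carrier[of y] by (auto intro!: rcosetsI normal_subset[OF nN])
        moreover have "?H ?c = fib y"
        proof -
          have "x i \<in> N #> y i \<longleftrightarrow> x i \<otimes> inv (y i) \<in> N" if "x \<in> topspace PT" "i < r" for x i
            using in_power_carrier[OF that] in_power_carrier[of y, OF _ that(2)] y(1) YP
              subgroup.rcos_module[OF normal_imp_subgroup[OF nN] is_group] by blast
          then show ?thesis unfolding fib_def by auto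
        qed
        ultimately show "C \<in> ?H ` ({..<r} \<rightarrow>\<^sub>E rcosets N)" using y(2) by blast
      qed
    qed
    \<comment> \<open>If \<open>Y\<close> filled at most half of every coset that it meets, summing
      over these finitely many disjoint cosets would bound twice the measure of \<open>Y\<close> by
      the measure of their union, against \<open>half\<close>.\<close>
    have "\<exists>y\<in>Y. measure \<mu> (fib y) < 2 * measure \<mu> (Y \<inter> fib y)"
    proof (rule ccontr)
      assume "\<not> ?thesis"
      then have le: "2 * measure \<mu> (Y \<inter> fib y) \<le> measure \<mu> (fib y)" if "y \<in> Y" for y
        using that by force
      have disj: "disjoint_family_on (\<lambda>C. C) (fib ` Y)"
        unfolding disjoint_family_on_def
      proof (intro ballI impI)
        fix C D assume "C \<in> fib ` Y" "D \<in> fib ` Y" "C \<noteq> D"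
        then obtain y y' where "y \<in> Y" "y' \<in> Y" "C = fib y" "D = fib y'" "fib y \<noteq> fib y'" by blast
        then show "C \<inter> D = {}" using same[of y y'] by blast
      qed
      have disj': "disjoint_family_on (\<lambda>C. Y \<inter> C) (fib ` Y)"
        using disj unfolding disjoint_family_on_def by blast
      have U: "(\<Union>C\<in>fib ` Y. Y \<inter> C) = Y" using self by blast
      have "2 * measure \<mu> Y = 2 * (\<Sum>C\<in>fib ` Y. measure \<mu> (Y \<inter> C))"
        using finite_measure_finite_Union[OF finC _ disj'] fibs Ys unfolding U by auto
      also have "\<dots> \<le> (\<Sum>C\<in>fib ` Y. measure \<mu> C)"
        unfolding sum_distrib_left using le by (intro sum_mono) auto
      also have "\<dots> = measure \<mu> (\<Union>C\<in>fib ` Y. C)"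
        using finite_measure_finite_Union[OF finC _ disj] fibs by (simp add: image_subset_iff)
      also have "\<dots> \<le> measure \<mu> (space \<mu> - F N1)"
      proof (rule finite_measure_mono)
        show "(\<Union>C\<in>fib ` Y. C) \<subseteq> space \<mu> - F N1"
          using N(2) unfolding fib_def F_def space_eq by blast
        show "space \<mu> - F N1 \<in> sets \<mu>" using open_sets[OF Fo[OF N1(1)]] by auto
      qed
      also have "\<dots> = 1 - measure \<mu> (F N1)"
        using prob_compl[OF open_sets[OF Fo[OF N1(1)]]] .
      finally show False using half by simp
    qed
    then obtain y where y: "y \<in> Y" "measure \<mu> (fib y) < 2 * measure \<mu> (Y \<inter> fib y)" by blast
    have yP: "y \<in> topspace PT" using y(1) YP by blast
    have "\<exists>y'\<in>Y. close r N y' y \<and> left_translate g y' \<in> Y" if g: "g \<in> {..<r} \<rightarrow>\<^sub>E N" for g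
    proof (rule ccontr)
      assume no: "\<not> ?thesis"
      have gP: "g \<in> topspace PT"
        using g normal_subset[OF nN] unfolding topspace_power by auto
      let ?A = "Y \<inter> fib y"
      have As: "?A \<in> sets \<mu>" using Ys fibs[OF y(1)] by blast
      have sub: "left_translate g ` ?A \<subseteq> fib y"
      proof
        fix x assume "x \<in> left_translate g ` ?A"
        then obtain a where a: "a \<in> ?A" "x = left_translate g a" by blast
        have aP: "a \<in> topspace PT" using a YP by blast
        have "x i \<otimes> inv (y i) \<in> N" if i: "i < r" for i
        proof -
          have "g i \<otimes> (a i \<otimes> inv (y i)) \<in> N"
            using g a i by (auto simp: fib_def intro!: subgroup.m_closed[OF normal_imp_subgroup[OF nN], of "g i" "a i \<otimes> inv (y i)"])
          then show ?thesis
            using a(2) i in_power_carrier[OF gP i] in_power_carrier[OF aP i] in_power_carrier[OF yP i]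
            by (simp add: left_translate_def m_assoc)
        qed
        then show "x \<in> fib y" using a(2) left_translate_closed[OF gP aP] by (simp add: fib_def)
      qed
      \<comment> \<open>Both \<open>?A\<close> and its translate lie in the same coset and fill more
        than half of it, so they cannot be disjoint.\<close>
      have "?A \<inter> left_translate g ` ?A = {}"
        using no by (auto simp: fib_def)
      then have "measure \<mu> (?A \<union> left_translate g ` ?A) = measure \<mu> ?A + measure \<mu> (left_translate g ` ?A)"
        using As left_translate_sets[OF gP As] by (intro finite_measure_Union) auto
      also have "\<dots> = 2 * measure \<mu> ?A" using measure_left_translate[OF gP As] by simp
      finally have "2 * measure \<mu> ?A \<le> measure \<mu> (fib y)"
        using finite_measure_mono[OF _ fibs[OF y(1)], of "?A \<union> left_translate g ` ?A"] sub by auto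
      then show False using y(2) by simp
    qed
    then show "\<exists>y\<in>Y. \<forall>g \<in> {..<r} \<rightarrow>\<^sub>E N. \<exists>y'\<in>Y. close r N y' y \<and> left_translate g y' \<in> Y"
      using y(1) by blast
  qed
qed

end

section \<open>Free pro-p groups and the Magnus embedding\<close>

declare mult_FactGroup [simp del] one_FactGroup [simp del]

text \<open>The regular wreath product of the integers modulo \<open>n\<close> by \<open>Q\<close>.
  A function on \<open>Q\<close> stands for an element of the group ring, and its translate by
  \<open>snd u\<close> for left multiplication, so a pair \<open>(f, q)\<close> is the Magnus matrix
  with rows \<open>(q, f)\<close> and \<open>(0, 1)\<close>. Coefficients are kept as
  representatives below \<open>n\<close> to make the carrier finite.\<close>

definition wreath :: "int \<Rightarrow> ('q, 'm) monoid_scheme \<Rightarrow> (('q \<Rightarrow> int) \<times> 'q) monoid" where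
  "wreath n Q = \<lparr>carrier = (carrier Q \<rightarrow>\<^sub>E {0..<n}) \<times> carrier Q,
     mult = (\<lambda>u v. (\<lambda>x\<in>carrier Q. (fst u x + fst v (inv\<^bsub>Q\<^esub> (snd u) \<otimes>\<^bsub>Q\<^esub> x)) mod n, snd u \<otimes>\<^bsub>Q\<^esub> snd v)),
     one = (\<lambda>x\<in>carrier Q. 0, \<one>\<^bsub>Q\<^esub>)\<rparr>"

lemma carrier_wreath: "carrier (wreath n Q) = (carrier Q \<rightarrow>\<^sub>E {0..<n}) \<times> carrier Q"
  and one_wreath: "\<one>\<^bsub>wreath n Q\<^esub> = (\<lambda>x\<in>carrier Q. 0, \<one>\<^bsub>Q\<^esub>)"
  and mult_wreath: "u \<otimes>\<^bsub>wreath n Q\<^esub> v =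
    (\<lambda>x\<in>carrier Q. (fst u x + fst v (inv\<^bsub>Q\<^esub> (snd u) \<otimes>\<^bsub>Q\<^esub> x)) mod n, snd u \<otimes>\<^bsub>Q\<^esub> snd v)"
  by (simp_all add: wreath_def)

lemma group_wreath:
  assumes "group Q" "n > 0"
  shows "group (wreath n Q)"
proof -
  interpret Q: group Q by fact
  show ?thesis
  proof (rule groupI)
    fix u v assume "u \<in> carrier (wreath n Q)" "v \<in> carrier (wreath n Q)"
    then show "u \<otimes>\<^bsub>wreath n Q\<^esub> v \<in> carrier (wreath n Q)"
      using assms by (auto simp: carrier_wreath mult_wreath)
  next
    show "\<one>\<^bsub>wreath n Q\<^esub> \<in> carrier (wreath n Q)"
      using assms by (auto simp: carrier_wreath one_wreath)
  next
    fix u v w assume uvw: "u \<in> carrier (wreath n Q)" "v \<in> carrier (wreath n Q)" "w \<in> carrier (wreath n Q)"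
    then have c: "snd u \<in> carrier Q" "snd v \<in> carrier Q" "snd w \<in> carrier Q"
      by (auto simp: carrier_wreath)
    have "(fst (u \<otimes>\<^bsub>wreath n Q\<^esub> v) x + fst w (inv\<^bsub>Q\<^esub> (snd u \<otimes>\<^bsub>Q\<^esub> snd v) \<otimes>\<^bsub>Q\<^esub> x)) mod n =
        (fst u x + fst (v \<otimes>\<^bsub>wreath n Q\<^esub> w) (inv\<^bsub>Q\<^esub> (snd u) \<otimes>\<^bsub>Q\<^esub> x)) mod n" if x: "x \<in> carrier Q" for x
    proof -
      have e: "inv\<^bsub>Q\<^esub> (snd u \<otimes>\<^bsub>Q\<^esub> snd v) \<otimes>\<^bsub>Q\<^esub> x = inv\<^bsub>Q\<^esub> (snd v) \<otimes>\<^bsub>Q\<^esub> (inv\<^bsub>Q\<^esub> (snd u) \<otimes>\<^bsub>Q\<^esub> x)"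
        and "inv\<^bsub>Q\<^esub> (snd u) \<otimes>\<^bsub>Q\<^esub> x \<in> carrier Q"
        using c x by (simp_all add: Q.inv_mult_group Q.m_assoc)
      then show ?thesis
        using x by (simp add: mult_wreath e mod_add_left_eq mod_add_right_eq add.assoc del: Q.m_closed)
    qed
    then have "(\<lambda>x\<in>carrier Q. (fst (u \<otimes>\<^bsub>wreath n Q\<^esub> v) x + fst w (inv\<^bsub>Q\<^esub> (snd u \<otimes>\<^bsub>Q\<^esub> snd v) \<otimes>\<^bsub>Q\<^esub> x)) mod n) =
        (\<lambda>x\<in>carrier Q. (fst u x + fst (v \<otimes>\<^bsub>wreath n Q\<^esub> w) (inv\<^bsub>Q\<^esub> (snd u) \<otimes>\<^bsub>Q\<^esub> x)) mod n)"
      by (rule restrict_ext)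
    moreover have "snd (u \<otimes>\<^bsub>wreath n Q\<^esub> v) = snd u \<otimes>\<^bsub>Q\<^esub> snd v" "snd (v \<otimes>\<^bsub>wreath n Q\<^esub> w) = snd v \<otimes>\<^bsub>Q\<^esub> snd w"
      by (simp_all add: mult_wreath)
    ultimately show "u \<otimes>\<^bsub>wreath n Q\<^esub> v \<otimes>\<^bsub>wreath n Q\<^esub> w = u \<otimes>\<^bsub>wreath n Q\<^esub> (v \<otimes>\<^bsub>wreath n Q\<^esub> w)"
      unfolding mult_wreath[of _ _ "u \<otimes>\<^bsub>wreath n Q\<^esub> v"] mult_wreath[of _ _ u "v \<otimes>\<^bsub>wreath n Q\<^esub> w"]
      using c by (simp add: Q.m_assoc)
  next
    fix u assume u: "u \<in> carrier (wreath n Q)"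
    then obtain f q where fq: "u = (f, q)" "f \<in> carrier Q \<rightarrow>\<^sub>E {0..<n}" "q \<in> carrier Q"
      by (auto simp: carrier_wreath)
    have "f x mod n = f x" if "x \<in> carrier Q" for x
      using fq(2) that by (auto simp: PiE_iff)
    then have "(\<lambda>x\<in>carrier Q. f x mod n) = f"
      using fq(2) by (auto simp: fun_eq_iff PiE_iff extensional_def)
    then show "\<one>\<^bsub>wreath n Q\<^esub> \<otimes>\<^bsub>wreath n Q\<^esub> u = u"
      using fq by (auto simp: mult_wreath one_wreath cong: restrict_cong)
    let ?v = "(\<lambda>x\<in>carrier Q. (- f (q \<otimes>\<^bsub>Q\<^esub> x)) mod n, inv\<^bsub>Q\<^esub> q)"
    have "?v \<otimes>\<^bsub>wreath n Q\<^esub> u = \<one>\<^bsub>wreath n Q\<^esub>"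
      using fq by (auto simp: mult_wreath one_wreath mod_simps cong: restrict_cong)
    moreover have "?v \<in> carrier (wreath n Q)"
      using fq assms(2) by (auto simp: carrier_wreath)
    ultimately show "\<exists>v\<in>carrier (wreath n Q). v \<otimes>\<^bsub>wreath n Q\<^esub> u = \<one>\<^bsub>wreath n Q\<^esub>" by blast
  qed
qed

lemma finite_wreath: "finite (carrier Q) \<Longrightarrow> finite (carrier (wreath n Q))"
  by (simp add: carrier_wreath finite_PiE)

lemma card_wreath: "finite (carrier Q) \<Longrightarrow>
    card (carrier (wreath (int n) Q)) = n ^ card (carrier Q) * card (carrier Q)"
  by (simp add: carrier_wreath card_cartesian_product card_PiE)

text \<open>The universal property in \<open>free_pro_p_on\<close> speaks of groups with carrier in
  \<open>nat\<close>; transport along a bijection makes it applicable to quotients and wreath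
  products.\<close>

lemma group_nat_copy:
  assumes "group Q" "finite (carrier Q)"
  obtains h and R :: "nat monoid" where "group R" "h \<in> iso Q R" "carrier R = h ` carrier Q" "inj_on h (carrier Q)"
proof -
  interpret Q: group Q by fact
  obtain h where h: "bij_betw h (carrier Q) {0..<card (carrier Q)}"
    using ex_bij_betw_finite_nat[OF assms(2)] by blast
  then have inj: "inj_on h (carrier Q)" by (rule bij_betw_imp_inj_on)
  define k where "k = inv_into (carrier Q) h"
  have kh: "k (h x) = x" if "x \<in> carrier Q" for x
    using inj that by (simp add: k_def)
  define R :: "nat monoid" where
    "R = \<lparr>carrier = h ` carrier Q, mult = (\<lambda>a b. h (k a \<otimes>\<^bsub>Q\<^esub> k b)), one = h \<one>\<^bsub>Q\<^esub>\<rparr>"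
  have simps: "carrier R = h ` carrier Q" "\<one>\<^bsub>R\<^esub> = h \<one>\<^bsub>Q\<^esub>"
    "\<And>x y. x \<in> carrier Q \<Longrightarrow> y \<in> carrier Q \<Longrightarrow> h x \<otimes>\<^bsub>R\<^esub> h y = h (x \<otimes>\<^bsub>Q\<^esub> y)"
    by (simp_all add: R_def kh)
  have "group R"
  proof (rule groupI)
    fix x assume "x \<in> carrier R"
    then obtain y where y: "y \<in> carrier Q" "x = h y" by (auto simp: simps)
    then have "h (inv\<^bsub>Q\<^esub> y) \<in> carrier R" "h (inv\<^bsub>Q\<^esub> y) \<otimes>\<^bsub>R\<^esub> x = \<one>\<^bsub>R\<^esub>"
      by (auto simp: simps)
    then show "\<exists>y\<in>carrier R. y \<otimes>\<^bsub>R\<^esub> x = \<one>\<^bsub>R\<^esub>" by blast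
  qed (auto simp: simps Q.m_assoc)
  moreover have "h \<in> iso Q R"
    using inj by (auto simp: iso_def hom_def simps bij_betw_def)
  ultimately show ?thesis using that simps(1) inj by blast
qed

lemma free_pro_p_extend:
  assumes F: "free_pro_p_on p F S B" and Q: "group Q" "finite (carrier Q)" "card (carrier Q) = p ^ k"
    and f: "f \<in> B \<rightarrow> carrier Q" "finite {x \<in> B. f x \<noteq> \<one>\<^bsub>Q\<^esub>}"
  obtains \<phi> where "\<phi> \<in> hom F Q" "\<And>y. openin S {x \<in> topspace S. \<phi> x = y}" "\<And>x. x \<in> B \<Longrightarrow> \<phi> x = f x"
proof -
  have top: "topspace S = carrier F"
    using F by (auto simp: free_pro_p_on_def pro_p_group_def profinite_group_def topological_group_def)
  obtain h and R :: "nat monoid" where R: "group R" "h \<in> iso Q R" "carrier R = h ` carrier Q" "inj_on h (carrier Q)"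
    by (rule group_nat_copy[OF Q(1,2)])
  interpret Q: group Q by fact
  interpret h: group_hom Q R h
    using R Q(1) by (simp add: group_hom_def group_hom_axioms_def iso_def)
  have "finite_p_group p R"
    using R Q by (auto simp: finite_p_group_def card_image)
  moreover have "h \<circ> f \<in> B \<rightarrow> carrier R" using f R(3) by auto
  moreover have "finite {x \<in> B. (h \<circ> f) x \<noteq> \<one>\<^bsub>R\<^esub>}"
    by (rule finite_subset[OF _ f(2)]) auto
  ultimately obtain \<phi> where \<phi>: "\<phi> \<in> hom F R" "continuous_to_discrete S \<phi>" "\<forall>x\<in>B. \<phi> x = (h \<circ> f) x"
    using F[unfolded free_pro_p_on_def, THEN conjunct2, THEN conjunct2, THEN conjunct2, rule_format, of R "h \<circ> f"]
    by blast
  let ?k = "inv_into (carrier Q) h"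
  have kiso: "?k \<in> hom R Q"
    using Q.iso_set_sym[OF R(2)] by (simp add: iso_def)
  show ?thesis
  proof (rule that[of "?k \<circ> \<phi>"])
    show "?k \<circ> \<phi> \<in> hom F Q" using \<phi>(1) kiso hom_compose by blast
    show "(?k \<circ> \<phi>) x = f x" if "x \<in> B" for x
      using \<phi>(3) that inv_into_f_f[OF R(4) Pi_mem[OF f(1) that]] by simp
    fix y
    have "{x \<in> topspace S. (?k \<circ> \<phi>) x = y} = (\<Union>z\<in>{z. ?k z = y}. {x \<in> topspace S. \<phi> x = z})"
      by auto
    then show "openin S {x \<in> topspace S. (?k \<circ> \<phi>) x = y}"
      using \<phi>(2) unfolding continuous_to_discrete_def by auto
  qed
qed

text \<open>This does the work of topological generation by \<open>B\<close>, which the definition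
  of freeness expresses only through uniqueness of extensions. The map on \<open>B\<close> is
  admissible because the kernel of \<open>\<phi>\<close> is open and \<open>B\<close> converges to
  the identity.\<close>

lemma free_pro_p_unique:
  assumes F: "free_pro_p_on p F S B" and Q: "group Q" "finite (carrier Q)" "card (carrier Q) = p ^ k"
    and \<phi>: "\<phi> \<in> hom F Q" "\<And>y. openin S {x \<in> topspace S. \<phi> x = y}"
    and \<psi>: "\<psi> \<in> hom F Q" "\<And>y. openin S {x \<in> topspace S. \<psi> x = y}"
    and eq: "\<And>x. x \<in> B \<Longrightarrow> \<phi> x = \<psi> x" and x: "x \<in> carrier F"
  shows "\<phi> x = \<psi> x"
proof -
  have top: "topspace S = carrier F" and gF: "group F" and BF: "B \<subseteq> carrier F"
    and conv: "\<And>U. openin S U \<Longrightarrow> \<one>\<^bsub>F\<^esub> \<in> U \<Longrightarrow> finite (B - U)"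
    using F by (auto simp: free_pro_p_on_def pro_p_group_def profinite_group_def topological_group_def)
  obtain h and R :: "nat monoid" where R: "group R" "h \<in> iso Q R" "carrier R = h ` carrier Q" "inj_on h (carrier Q)"
    by (rule group_nat_copy[OF Q(1,2)])
  interpret Q: group Q by fact
  interpret h: group_hom Q R h
    using R Q(1) by (simp add: group_hom_def group_hom_axioms_def iso_def)
  interpret \<phi>: group_hom F Q \<phi>
    using \<phi> gF Q(1) by (simp add: group_hom_def group_hom_axioms_def)
  interpret \<psi>: group_hom F Q \<psi>
    using \<psi> gF Q(1) by (simp add: group_hom_def group_hom_axioms_def)
  have pR: "finite_p_group p R"
    using R Q by (auto simp: finite_p_group_def card_image)
  have fB: "h \<circ> \<phi> \<in> B \<rightarrow> carrier R" using BF R(3) by auto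
  have "finite (B - {x \<in> topspace S. \<phi> x = \<one>\<^bsub>Q\<^esub>})"
    using conv[OF \<phi>(2), of "\<one>\<^bsub>Q\<^esub>"] top by auto
  then have fin: "finite {x \<in> B. (h \<circ> \<phi>) x \<noteq> \<one>\<^bsub>R\<^esub>}"
    by (rule finite_subset[rotated]) auto
  have cont: "continuous_to_discrete S (h \<circ> \<eta>)" if "\<And>y. openin S {x \<in> topspace S. \<eta> x = y}" for \<eta>
  proof -
    have "{x \<in> topspace S. (h \<circ> \<eta>) x = y} = (\<Union>z\<in>{z. h z = y}. {x \<in> topspace S. \<eta> x = z})" for y
      by auto
    then show ?thesis using that unfolding continuous_to_discrete_def by auto
  qed
  have hom: "h \<circ> \<phi> \<in> hom F R" "h \<circ> \<psi> \<in> hom F R"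
    using \<phi>(1) \<psi>(1) h.homh hom_compose by blast+
  obtain \<theta> where \<theta>: "\<forall>\<eta>. \<eta> \<in> hom F R \<and> continuous_to_discrete S \<eta> \<and> (\<forall>x\<in>B. \<eta> x = (h \<circ> \<phi>) x)
                 \<longrightarrow> (\<forall>x\<in>carrier F. \<eta> x = \<theta> x)"
    using F[unfolded free_pro_p_on_def, THEN conjunct2, THEN conjunct2, THEN conjunct2, rule_format, of R "h \<circ> \<phi>"]
      pR fB fin by blast
  have "(h \<circ> \<phi>) x = \<theta> x" "(h \<circ> \<psi>) x = \<theta> x"
    using \<theta> hom cont[OF \<phi>(2)] cont[OF \<psi>(2)] eq x by auto
  then show ?thesis
    using inj_onD[OF R(4), of "\<phi> x" "\<psi> x"] x by simp
qed

section \<open>Fox derivatives on a free pro-p group\<close>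

locale free_pro_p = group F for F (structure) +
  fixes p :: nat and S :: "'a topology" and B :: "'a set"
  assumes free: "free_pro_p_on p F S B"
begin

lemma prime: "Factorial_Ring.prime p" and pro_p: "pro_p_group p F S" and profinite_F: "profinite_group F S"
  and basis_subset: "B \<subseteq> carrier F"
  and basis_converges: "openin S U \<Longrightarrow> \<one> \<in> U \<Longrightarrow> finite (B - U)"
  using free by (auto simp: free_pro_p_on_def pro_p_group_def)

end

sublocale free_pro_p \<subseteq> profinite F S
  by unfold_locales (rule profinite_F)

context free_pro_p
begin

context
  fixes L assumes L: "open_normal L"
begin

lemma quotient_group: "group (F Mod L)" and carrier_quotient: "carrier (F Mod L) = rcosets L"
  using L normal.factorgroup_is_group by (auto simp: FactGroup_def)

lemma quotient_card: obtains e where "card (carrier (F Mod L)) = p ^ e" "finite (carrier (F Mod L))"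
proof -
  obtain e where e: "card (rcosets L) = p ^ e"
    using pro_p L unfolding pro_p_group_def by blast
  moreover have "p ^ e > 0" using prime prime_gt_0_nat by simp
  ultimately show ?thesis using that[of e] card_ge_0_finite[of "rcosets L"] by (simp add: carrier_quotient)
qed

lemma coset_hom: "(\<lambda>x. L #> x) \<in> hom F (F Mod L)"
  using L normal.r_coset_hom_Mod by blast

lemma coset_mult: "x \<in> carrier F \<Longrightarrow> y \<in> carrier F \<Longrightarrow> (L #> x) \<otimes>\<^bsub>F Mod L\<^esub> (L #> y) = L #> (x \<otimes> y)"
  using hom_mult[OF coset_hom] by simp

lemma coset_inv: "x \<in> carrier F \<Longrightarrow> inv\<^bsub>F Mod L\<^esub> (L #> x) = L #> (inv x)"
  using group_hom.hom_inv[of F "F Mod L" "\<lambda>x. L #> x" x] coset_hom quotient_group is_group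
  by (simp add: group_hom_def group_hom_axioms_def)

lemma coset_in: "x \<in> carrier F \<Longrightarrow> L #> x \<in> carrier (F Mod L)"
  using coset_hom by (auto simp: hom_def)

lemma coset_one: "L #> x = \<one>\<^bsub>F Mod L\<^esub> \<longleftrightarrow> x \<in> L" if "x \<in> carrier F"
  using coset_eq_iff[OF conjunct1[OF L] that, of \<one>] coset_mult_one[of L] normal_imp_subgroup[of L F] subgroup.subset[of L F] L that
  by (simp add: FactGroup_def)

lemma coset_continuous: "openin S {x \<in> topspace S. L #> x = y}"
proof (rule openin_union_of_cosets[of L])
  fix x l assume x: "x \<in> {x \<in> topspace S. L #> x = y}" and l: "l \<in> L"
  have lF: "l \<in> carrier F" using L l normal_imp_subgroup subgroup.mem_carrier by metis
  have "x \<otimes> l \<otimes> inv x \<in> L" using normal.inv_op_closed2[of L F x l] L x l by simp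
  then have "L #> (x \<otimes> l) = L #> x" using coset_eq_iff[OF conjunct1[OF L], of "x \<otimes> l" x] x lF by simp
  then show "x \<otimes> l \<in> {x \<in> topspace S. L #> x = y}" using x lF by simp
qed (use L normal_imp_subgroup in auto)

lemma wreath_group: "k > 0 \<Longrightarrow> group (wreath (int k) (F Mod L))"
  and wreath_card: "\<exists>e. card (carrier (wreath (int (p ^ k)) (F Mod L))) = p ^ e"
  and wreath_finite: "finite (carrier (wreath (int (p ^ k)) (F Mod L)))"
proof -
  show "k > 0 \<Longrightarrow> group (wreath (int k) (F Mod L))"
    using group_wreath[OF quotient_group] by simp
  obtain e where e: "card (carrier (F Mod L)) = p ^ e" "finite (carrier (F Mod L))"
    by (rule quotient_card)
  then show "finite (carrier (wreath (int (p ^ k)) (F Mod L)))" using finite_wreath by blast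
  have "card (carrier (wreath (int (p ^ k)) (F Mod L))) = p ^ (k * p ^ e + e)"
    using e card_wreath[of "F Mod L" "p ^ k"] by (simp add: power_add power_mult)
  then show "\<exists>e. card (carrier (wreath (int (p ^ k)) (F Mod L))) = p ^ e" by blast
qed

text \<open>The Fox derivative with respect to \<open>b\<close>, with values in the group ring of the quotient by \<open>L\<close>
  over the integers modulo \<open>p ^ k\<close>. It comes from the Magnus embedding
  \<open>b \<mapsto> (1, bL)\<close>, \<open>b' \<mapsto> (0, b'L)\<close> into the wreath product.\<close>
lemma fox_derivative:
  assumes b: "b \<in> B" and k: "k > 0"
  obtains \<phi> :: "'a \<Rightarrow> 'a \<Rightarrow> int" where
    "\<And>x g. x \<in> carrier F \<Longrightarrow> g \<in> carrier F \<Longrightarrow> \<phi> x g \<in> {0..<int (p ^ k)}"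
    "\<And>x y g. x \<in> carrier F \<Longrightarrow> y \<in> carrier F \<Longrightarrow> g \<in> carrier F \<Longrightarrow>
        \<phi> (x \<otimes> y) g = (\<phi> x g + \<phi> y (inv x \<otimes> g)) mod int (p ^ k)"
    "\<And>g. g \<in> carrier F \<Longrightarrow> \<phi> b g = (if g \<in> L then 1 else 0)"
    "\<And>b' g. b' \<in> B \<Longrightarrow> b' \<noteq> b \<Longrightarrow> g \<in> carrier F \<Longrightarrow> \<phi> b' g = 0"
    "\<And>x g l. x \<in> carrier F \<Longrightarrow> g \<in> carrier F \<Longrightarrow> l \<in> L \<Longrightarrow> \<phi> x (g \<otimes> l) = \<phi> x g"
    "openin S {x \<in> L. \<forall>g\<in>carrier F. \<phi> x g = 0}"
proof -
  let ?Q = "F Mod L" and ?n = "int (p ^ k)"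
  let ?W = "wreath ?n ?Q"
  have n1: "?n > 1" using prime_gt_1_nat[OF prime] k by (metis of_nat_1 of_nat_less_iff one_less_power)
  obtain e where e: "card (carrier ?Q) = p ^ e" "finite (carrier ?Q)"
    by (rule quotient_card)
  obtain e' where e': "card (carrier ?W) = p ^ e'" using wreath_card by blast
  have gW: "group ?W" using wreath_group[of "p ^ k"] prime_gt_0_nat[OF prime] by simp
  have fW: "finite (carrier ?W)" using wreath_finite .
  define f where "f x = (\<lambda>q\<in>carrier ?Q. if x = b \<and> q = L then 1 else (0::int), L #> x)" for x
  have "f x \<in> carrier ?W" if "x \<in> B" for x
  proof -
    have "L #> x \<in> carrier ?Q" using coset_in that basis_subset by blast
    then show ?thesis using n1 prime_gt_0_nat[OF prime] unfolding f_def carrier_wreath by auto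
  qed
  then have "f \<in> B \<rightarrow> carrier ?W" by blast
  moreover have "finite {x \<in> B. f x \<noteq> \<one>\<^bsub>?W\<^esub>}"
  proof (rule finite_subset)
    have "\<one> \<in> L" using L normal_imp_subgroup subgroup.one_closed by metis
    then show "finite (insert b (B - L))" using basis_converges L by simp
    show "{x \<in> B. f x \<noteq> \<one>\<^bsub>?W\<^esub>} \<subseteq> insert b (B - L)"
    proof
      fix x assume x: "x \<in> {x \<in> B. f x \<noteq> \<one>\<^bsub>?W\<^esub>}"
      have "f x = \<one>\<^bsub>?W\<^esub>" if "x \<noteq> b" "x \<in> L"
        using that x basis_subset coset_one[of x] by (auto simp: f_def one_wreath)
      then show "x \<in> insert b (B - L)" using x by blast
    qed
  qed
  ultimately obtain \<Phi> where \<Phi>: "\<Phi> \<in> hom F ?W" "\<And>y. openin S {x \<in> topspace S. \<Phi> x = y}"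
      "\<And>x. x \<in> B \<Longrightarrow> \<Phi> x = f x"
    using free_pro_p_extend[OF free gW fW e', of f] by blast
  interpret \<Phi>: group_hom F ?W \<Phi>
    using \<Phi>(1) gW is_group by (simp add: group_hom_def group_hom_axioms_def)
  have snd_hom: "snd \<circ> \<Phi> \<in> hom F ?Q"
  proof (rule homI)
    fix x y assume xy: "x \<in> carrier F" "y \<in> carrier F"
    show "(snd \<circ> \<Phi>) x \<in> carrier ?Q" using \<Phi>.hom_closed[OF xy(1)] by (auto simp: carrier_wreath)
    show "(snd \<circ> \<Phi>) (x \<otimes> y) = (snd \<circ> \<Phi>) x \<otimes>\<^bsub>?Q\<^esub> (snd \<circ> \<Phi>) y"
      using \<Phi>.hom_mult[OF xy] by (simp add: mult_wreath)
  qed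
  have snd_cont: "openin S {x \<in> topspace S. (snd \<circ> \<Phi>) x = y}" for y
  proof -
    have "{x \<in> topspace S. (snd \<circ> \<Phi>) x = y} = (\<Union>u\<in>{u. snd u = y}. {x \<in> topspace S. \<Phi> x = u})" by auto
    then show ?thesis using \<Phi>(2) by auto
  qed
  \<comment> \<open>The second component of \<open>\<Phi>\<close> and the quotient map agree on
    \<open>B\<close>, hence everywhere. This identifies the translation in the wreath product with
    translation by \<open>x\<close> itself.\<close>
  have snd: "snd (\<Phi> x) = L #> x" if "x \<in> carrier F" for x
    using free_pro_p_unique[OF free quotient_group e(2,1) snd_hom snd_cont coset_hom coset_continuous _ that]
      \<Phi>(3) by (simp add: f_def)
  define \<phi> where "\<phi> x g = fst (\<Phi> x) (L #> g)" for x g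
  show ?thesis
  proof (rule that[of \<phi>])
    fix x g assume x: "x \<in> carrier F" and g: "g \<in> carrier F"
    show "\<phi> x g \<in> {0..<?n}"
      using \<Phi>.hom_closed[OF x] coset_in[OF g] unfolding \<phi>_def carrier_wreath by (auto simp: mem_Times_iff)
    fix y assume y: "y \<in> carrier F"
    show "\<phi> (x \<otimes> y) g = (\<phi> x g + \<phi> y (inv x \<otimes> g)) mod ?n"
      using x y g coset_in[OF g] by (simp add: \<phi>_def mult_wreath snd coset_inv coset_mult)
  next
    fix g assume g: "g \<in> carrier F"
    have "L #> g = L \<longleftrightarrow> g \<in> L" using coset_one[OF g] by (simp add: FactGroup_def)
    then show "\<phi> b g = (if g \<in> L then 1 else 0)"
      using \<Phi>(3)[OF b] coset_in[OF g] by (simp add: \<phi>_def f_def)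
    fix b' assume "b' \<in> B" "b' \<noteq> b"
    then show "\<phi> b' g = 0" using \<Phi>(3)[of b'] coset_in[OF g] by (simp add: \<phi>_def f_def)
  next
    fix x g l assume g: "g \<in> carrier F" and l: "l \<in> L"
    have lF: "l \<in> carrier F" using L l normal_imp_subgroup subgroup.mem_carrier by metis
    have "g \<otimes> l \<otimes> inv g \<in> L" using normal.inv_op_closed2[of L F g l] L g l by simp
    then have "L #> (g \<otimes> l) = L #> g" using coset_eq_iff[OF conjunct1[OF L], of "g \<otimes> l" g] g lF by simp
    then show "\<phi> x (g \<otimes> l) = \<phi> x g" by (simp add: \<phi>_def)
  next
    have LF: "L \<subseteq> carrier F" using L normal_imp_subgroup subgroup.subset by metis
    \<comment> \<open>The set in question is the kernel of \<open>\<Phi>\<close>, which is open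
      because \<open>\<Phi>\<close> is continuous to a discrete group.\<close>
    have "{x \<in> L. \<forall>g\<in>carrier F. \<phi> x g = 0} = {x \<in> topspace S. \<Phi> x = \<one>\<^bsub>?W\<^esub>}"
    proof (intro Set.set_eqI iffI)
      fix x assume x: "x \<in> {x \<in> L. \<forall>g\<in>carrier F. \<phi> x g = 0}"
      then have xF: "x \<in> carrier F" using LF by auto
      have "fst (\<Phi> x) q = 0" if q: "q \<in> carrier ?Q" for q
      proof -
        obtain g where "g \<in> carrier F" "q = L #> g"
          using q unfolding carrier_quotient by (auto simp: RCOSETS_def)
        then show ?thesis using x by (auto simp: \<phi>_def)
      qed
      then have "fst (\<Phi> x) = (\<lambda>q\<in>carrier ?Q. 0)"
        using \<Phi>.hom_closed[OF xF] by (auto simp: carrier_wreath fun_eq_iff mem_Times_iff PiE_iff extensional_def)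
      moreover have "snd (\<Phi> x) = \<one>\<^bsub>?Q\<^esub>" using snd[OF xF] coset_one[OF xF] x by simp
      ultimately show "x \<in> {x \<in> topspace S. \<Phi> x = \<one>\<^bsub>?W\<^esub>}"
        using xF by (simp add: one_wreath prod_eq_iff)
    next
      fix x assume x: "x \<in> {x \<in> topspace S. \<Phi> x = \<one>\<^bsub>?W\<^esub>}"
      then have xF: "x \<in> carrier F" by simp
      have "x \<in> L" using snd[OF xF] coset_one[OF xF] x by (simp add: one_wreath)
      then show "x \<in> {x \<in> L. \<forall>g\<in>carrier F. \<phi> x g = 0}"
        using x coset_in by (simp add: \<phi>_def one_wreath)
    qed
    then show "openin S {x \<in> L. \<forall>g\<in>carrier F. \<phi> x g = 0}" using \<Phi>(2) by simp
  qed
qed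

end

text \<open>Conjugation by the indicator function of the image of the subgroup generated by \<open>c\<close> is trivial
  precisely on that image; so two homomorphisms agree on \<open>B\<close> and separate it from everything else.\<close>
lemma procyclic_if_basis_singleton:
  assumes c: "c \<in> carrier F" "B \<subseteq> {c}"
  shows "procyclic F S"
proof -
  let ?C = "generate F {c}"
  have sC: "subgroup ?C F" using c by (intro generate_is_subgroup) simp
  note CF = subgroup.subset[OF sC]
  have "x \<in> S closure_of ?C" if x: "x \<in> carrier F" for x
    unfolding in_closure_of
  proof (intro conjI allI impI)
    show "x \<in> topspace S" using x by simp
    fix U assume U: "x \<in> U \<and> openin S U"
    have "openin S {h \<in> topspace S. x \<otimes> h \<in> U}"
      using U x by (intro openin_continuous_map_preimage[where Y = S] continuous_map_mult) auto
    moreover have "\<one> \<in> {h \<in> topspace S. x \<otimes> h \<in> U}" using U x by simp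
    ultimately obtain L where L: "open_normal L" "L \<subseteq> {h \<in> topspace S. x \<otimes> h \<in> U}"
      by (rule open_normal_base)
    let ?Q = "F Mod L" and ?n = "int (p ^ 1)"
    let ?W = "wreath ?n ?Q"
    interpret Q: group ?Q using quotient_group[OF L(1)] .
    have n1: "?n > 1" using prime_gt_1_nat[OF prime] by simp
    have gW: "group ?W" using wreath_group[OF L(1), of "p ^ 1"] n1 by simp
    obtain e where e: "card (carrier ?W) = p ^ e" using wreath_card[OF L(1)] by blast
    define D where "D = (\<lambda>d. L #> d) ` ?C"
    interpret cos: group_hom F ?Q "\<lambda>d. L #> d"
      using coset_hom[OF L(1)] is_group Q.is_group by (simp add: group_hom_def group_hom_axioms_def)
    have D: "subgroup D ?Q" unfolding D_def by (rule cos.subgroup_img_is_subgroup[OF sC])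
    define \<chi>D :: "'a set \<Rightarrow> int" where "\<chi>D q = (if q \<in> D then 1 else 0)" for q
    define \<theta> where "\<theta> y = (\<lambda>q\<in>carrier ?Q. (\<chi>D q - \<chi>D (inv\<^bsub>?Q\<^esub> (L #> y) \<otimes>\<^bsub>?Q\<^esub> q)) mod ?n, L #> y)" for y
    define \<theta>0 where "\<theta>0 y = (\<lambda>q\<in>carrier ?Q. 0::int, L #> y)" for y
    have hom: "\<theta> \<in> hom F ?W"
    proof (rule homI)
      fix y z assume yz: "y \<in> carrier F" "z \<in> carrier F"
      show "\<theta> y \<in> carrier ?W" using yz n1 cos.hom_closed by (auto simp: \<theta>_def carrier_wreath)
      have "(\<chi>D q - \<chi>D (inv\<^bsub>?Q\<^esub> (L #> (y \<otimes> z)) \<otimes>\<^bsub>?Q\<^esub> q)) mod ?n =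
         (fst (\<theta> y) q + fst (\<theta> z) (inv\<^bsub>?Q\<^esub> (L #> y) \<otimes>\<^bsub>?Q\<^esub> q)) mod ?n" if q: "q \<in> carrier ?Q" for q
      proof -
        have "inv\<^bsub>?Q\<^esub> (L #> (y \<otimes> z)) \<otimes>\<^bsub>?Q\<^esub> q = inv\<^bsub>?Q\<^esub> (L #> z) \<otimes>\<^bsub>?Q\<^esub> (inv\<^bsub>?Q\<^esub> (L #> y) \<otimes>\<^bsub>?Q\<^esub> q)"
          using yz q by (simp add: Q.inv_mult_group Q.m_assoc)
        moreover have "inv\<^bsub>?Q\<^esub> (L #> y) \<otimes>\<^bsub>?Q\<^esub> q \<in> carrier ?Q" using yz q by simp
        ultimately show ?thesis using q by (simp add: \<theta>_def mod_add_left_eq mod_add_right_eq)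
      qed
      then show "\<theta> (y \<otimes> z) = \<theta> y \<otimes>\<^bsub>?W\<^esub> \<theta> z"
        using yz by (auto simp: mult_wreath \<theta>_def[of "y \<otimes> z"] intro!: restrict_ext) (simp_all add: \<theta>_def)
    qed
    have hom0: "\<theta>0 \<in> hom F ?W"
    proof (rule homI)
      fix y z assume yz: "y \<in> carrier F" "z \<in> carrier F"
      show "\<theta>0 y \<in> carrier ?W" using yz n1 cos.hom_closed by (auto simp: \<theta>0_def carrier_wreath)
      show "\<theta>0 (y \<otimes> z) = \<theta>0 y \<otimes>\<^bsub>?W\<^esub> \<theta>0 z"
        using yz by (auto simp: mult_wreath \<theta>0_def intro!: restrict_ext)
    qed
    have cont: "openin S {y \<in> topspace S. \<theta>' (L #> y) = u}" for \<theta>' :: "'a set \<Rightarrow> ('a set \<Rightarrow> int) \<times> 'a set" and u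
    proof -
      have "{y \<in> topspace S. \<theta>' (L #> y) = u} = (\<Union>q\<in>{q. \<theta>' q = u}. {y \<in> topspace S. L #> y = q})" by auto
      then show ?thesis using coset_continuous[OF L(1)] by auto
    qed
    have "openin S {y \<in> topspace S. \<theta> y = u}" "openin S {y \<in> topspace S. \<theta>0 y = u}" for u
      using cont[of "\<lambda>a. (\<lambda>q\<in>carrier ?Q. (\<chi>D q - \<chi>D (inv\<^bsub>?Q\<^esub> a \<otimes>\<^bsub>?Q\<^esub> q)) mod ?n, a)" u]
        cont[of "\<lambda>a. (\<lambda>q\<in>carrier ?Q. 0, a)" u] by (simp_all add: \<theta>_def \<theta>0_def)
    moreover have "\<theta> y = \<theta>0 y" if "y \<in> B" for y
    proof -
      have yC: "y \<in> ?C" using that c(2) generate.incl[of y "{c}"] by auto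
      then have "L #> y \<in> D" by (simp add: D_def)
      then have yD: "inv\<^bsub>?Q\<^esub> (L #> y) \<in> D" using D subgroup.m_inv_closed by metis
      have "inv\<^bsub>?Q\<^esub> (L #> y) \<otimes>\<^bsub>?Q\<^esub> q \<in> D \<longleftrightarrow> q \<in> D" if "q \<in> carrier ?Q" for q
        using yD subgroup.rcos_module subgroup.m_closed[OF D] subgroup.m_inv_closed[OF D] Q.cancel_inv_left
          Q.cancel_inv_right that subgroup.mem_carrier[OF D] Q.inv_closed
        by (metis Q.inv_inv)
      then show ?thesis by (auto simp: \<theta>_def \<theta>0_def \<chi>D_def intro!: restrict_ext)
    qed
    ultimately have "\<theta> x = \<theta>0 x"
      using free_pro_p_unique[OF free gW wreath_finite[OF L(1)] e hom _ hom0 _ _ x] by blast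
    \<comment> \<open>At the identity coset \<open>\<theta>0 x\<close> is 0 and
      \<open>\<theta> x\<close> is 1 minus the indicator of \<open>D\<close> at the inverse of
      \<open>x\<close>. These agree modulo \<open>p\<close> only if that inverse lies in
      \<open>D\<close>.\<close>
    then have "fst (\<theta> x) \<one>\<^bsub>?Q\<^esub> = fst (\<theta>0 x) \<one>\<^bsub>?Q\<^esub>" by simp
    then have "(1 - \<chi>D (inv\<^bsub>?Q\<^esub> (L #> x))) mod ?n = 0"
      using subgroup.one_closed[OF D] x by (simp add: \<theta>_def \<theta>0_def \<chi>D_def)
    then have "inv\<^bsub>?Q\<^esub> (L #> x) \<in> D"
      using n1 by (auto simp: \<chi>D_def split: if_splits)
    then obtain d where d: "d \<in> ?C" "L #> inv x = L #> d"
      using coset_inv[OF L(1) x] by (auto simp: D_def)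
    have dF: "d \<in> carrier F" using d CF by blast
    have "inv x \<otimes> inv d \<in> L" using coset_eq_iff[OF conjunct1[OF L(1)] inv_closed[OF x] dF] d(2) by blast
    then have "x \<otimes> (inv x \<otimes> inv d) \<in> U" using L(2) by blast
    then have "inv d \<in> U" using x dF by (simp add: cancel_inv_right)
    moreover have "inv d \<in> ?C" using subgroup.m_inv_closed[OF sC d(1)] .
    ultimately show "\<exists>y. y \<in> ?C \<and> y \<in> U" by blast
  qed
  moreover have "S closure_of ?C \<subseteq> carrier F" using closure_of_subset_topspace[of S ?C] by simp
  ultimately show ?thesis unfolding procyclic_def using c(1) by blast
qed

end

section \<open>Difference operators and cocycles\<close>

context comm_group
begin

text \<open>The action on functions of the product of the group ring elements \<open>x - y\<close>
  over the listed pairs, where \<open>x\<close> sends \<open>f\<close> to the function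
  \<open>f (inv x \<otimes> q)\<close> of \<open>q\<close>.\<close>

fun diff_op :: "('a \<times> 'a) list \<Rightarrow> ('a \<Rightarrow> int) \<Rightarrow> 'a \<Rightarrow> int" where
  "diff_op [] f q = f q"
| "diff_op ((x, y) # xs) f q = diff_op xs f (inv x \<otimes> q) - diff_op xs f (inv y \<otimes> q)"

lemma diff_op_cong:
  assumes "set xs \<subseteq> carrier G \<times> carrier G" "q \<in> carrier G" "\<And>q. q \<in> carrier G \<Longrightarrow> f q = g q"
  shows "diff_op xs f q = diff_op xs g q"
  using assms by (induction xs f q rule: diff_op.induct) auto

text \<open>Translations commute with one another in a commutative group, hence with every product
  of differences of translations.\<close>

lemma diff_op_translate:
  assumes "set xs \<subseteq> carrier G \<times> carrier G" "z \<in> carrier G" "q \<in> carrier G"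
  shows "diff_op xs (\<lambda>q. f (z \<otimes> q)) q = diff_op xs f (z \<otimes> q)"
  using assms(1,3)
proof (induction xs arbitrary: q)
  case (Cons a xs)
  obtain x y where a: "a = (x, y)" by fastforce
  then have "x \<in> carrier G" "y \<in> carrier G" using Cons.prems by auto
  with a Cons assms(2) show ?case by (simp add: m_lcomm)
qed simp

lemma diff_op_zero:
  assumes "set xs \<subseteq> carrier G \<times> carrier G" "(x, x) \<in> set xs" "q \<in> carrier G"
  shows "diff_op xs f q = 0"
  using assms
proof (induction xs arbitrary: q)
  case (Cons a xs)
  obtain y z where a: "a = (y, z)" by fastforce
  then have yz: "y \<in> carrier G" "z \<in> carrier G" using Cons.prems by auto
  show ?case
  proof (cases "(x, x) \<in> set xs")
    case True
    then show ?thesis using Cons a yz by simp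
  next
    case False
    then show ?thesis using Cons.prems a by auto
  qed
qed simp

definition supp :: "int \<Rightarrow> ('a \<Rightarrow> int) \<Rightarrow> 'a set" where
  "supp n f = {q \<in> carrier G. \<not> n dvd f q}"

text \<open>A function invariant under \<open>c\<close> is supported on a union of orbits, so \<open>1 - c\<close> cannot kill a
  function whose support is smaller than the order of \<open>c\<close>.\<close>
lemma diff_op_nonzero:
  assumes "set xs \<subseteq> carrier G \<times> carrier G" "finite (supp n f)" "supp n f \<noteq> {}" "card (supp n f) \<le> s"
    and "\<And>x y i. (x, y) \<in> set xs \<Longrightarrow> 0 < i \<Longrightarrow> i \<le> s * 2 ^ length xs \<Longrightarrow> (inv x \<otimes> y) [^] i \<noteq> \<one>"
  shows "finite (supp n (diff_op xs f)) \<and> supp n (diff_op xs f) \<noteq> {} \<and>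
    card (supp n (diff_op xs f)) \<le> s * 2 ^ length xs"
  using assms(1,5)
proof (induction xs)
  case Nil
  then show ?case using assms(2-4) by (simp add: supp_def)
next
  case (Cons a xs)
  obtain x y where a: "a = (x, y)" by fastforce
  then have xy: "x \<in> carrier G" "y \<in> carrier G" using Cons.prems by auto
  let ?E = "diff_op xs f" and ?E' = "diff_op (a # xs) f"
  have IH: "finite (supp n ?E)" "supp n ?E \<noteq> {}" "card (supp n ?E) \<le> s * 2 ^ length xs"
  proof -
    have "(inv u \<otimes> v) [^] i \<noteq> \<one>" if "(u, v) \<in> set xs" "0 < i" "i \<le> s * 2 ^ length xs" for u v and i :: nat
    proof (rule Cons.prems(2))
      show "(u, v) \<in> set (a # xs)" using that by simp
      have "s * 2 ^ length xs \<le> s * 2 ^ length (a # xs)" by simp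
      then show "i \<le> s * 2 ^ length (a # xs)" using that(3) by linarith
    qed (rule that(2))
    then show "finite (supp n ?E)" "supp n ?E \<noteq> {}" "card (supp n ?E) \<le> s * 2 ^ length xs"
      using Cons.IH Cons.prems(1) by auto
  qed
  \<comment> \<open>Each factor \<open>x - y\<close> at most doubles the support, which is the
    origin of \<open>2 ^ length xs\<close> in the bounds.\<close>
  have sub: "supp n ?E' \<subseteq> (\<lambda>q. x \<otimes> q) ` supp n ?E \<union> (\<lambda>q. y \<otimes> q) ` supp n ?E"
  proof
    fix q assume q: "q \<in> supp n ?E'"
    then have qG: "q \<in> carrier G" and "\<not> n dvd ?E (inv x \<otimes> q) - ?E (inv y \<otimes> q)"
      using a by (auto simp: supp_def)
    then consider "\<not> n dvd ?E (inv x \<otimes> q)" | "\<not> n dvd ?E (inv y \<otimes> q)" by (meson dvd_diff)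
    then show "q \<in> (\<lambda>q. x \<otimes> q) ` supp n ?E \<union> (\<lambda>q. y \<otimes> q) ` supp n ?E"
    proof cases
      case 1
      then have "inv x \<otimes> q \<in> supp n ?E" "q = x \<otimes> (inv x \<otimes> q)"
        using xy qG by (auto simp: supp_def cancel_inv_right)
      then show ?thesis by blast
    next
      case 2
      then have "inv y \<otimes> q \<in> supp n ?E" "q = y \<otimes> (inv y \<otimes> q)"
        using xy qG by (auto simp: supp_def cancel_inv_right)
      then show ?thesis by blast
    qed
  qed
  have fin: "finite (supp n ?E')" using sub IH(1) by (meson finite_Un finite_imageI finite_subset)
  have "card (supp n ?E') \<le> card ((\<lambda>q. x \<otimes> q) ` supp n ?E \<union> (\<lambda>q. y \<otimes> q) ` supp n ?E)"
    using sub IH(1) by (intro card_mono) auto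
  also have "\<dots> \<le> card ((\<lambda>q. x \<otimes> q) ` supp n ?E) + card ((\<lambda>q. y \<otimes> q) ` supp n ?E)"
    by (rule card_Un_le)
  also have "\<dots> \<le> card (supp n ?E) + card (supp n ?E)"
    using IH(1) by (intro add_mono card_image_le)
  also have "\<dots> \<le> s * 2 ^ length (a # xs)" using IH(3) by simp
  finally have card: "card (supp n ?E') \<le> s * 2 ^ length (a # xs)" .
  have "supp n ?E' \<noteq> {}"
  proof
    assume "supp n ?E' = {}"
    then have zero: "n dvd ?E (inv x \<otimes> q) - ?E (inv y \<otimes> q)" if "q \<in> carrier G" for q
      using that a by (auto simp: supp_def)
    let ?c = "inv x \<otimes> y"
    have cG: "?c \<in> carrier G" using xy by simp
    have step: "?c \<otimes> q \<in> supp n ?E" if "q \<in> supp n ?E" for q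
    proof -
      have q: "q \<in> carrier G" using that by (simp add: supp_def)
      have "n dvd ?E (?c \<otimes> q) - ?E q"
        using zero[of "y \<otimes> q"] q xy by (simp add: m_assoc cancel_inv_left)
      then have "n dvd ?E (?c \<otimes> q) \<longleftrightarrow> n dvd ?E q"
        by (metis diff_add_cancel dvd_add_right_iff)
      then show ?thesis using that q xy by (simp add: supp_def)
    qed
    obtain q0 where q0: "q0 \<in> supp n ?E" using IH(2) by blast
    then have q0G: "q0 \<in> carrier G" by (simp add: supp_def)
    have pw: "?c [^] i \<otimes> q0 \<in> supp n ?E" for i :: nat
    proof (induction i)
      case (Suc i)
      have "?c [^] Suc i \<otimes> q0 = ?c [^] i \<otimes> (?c \<otimes> q0)"
        using m_assoc[OF nat_pow_closed[OF cG] cG q0G] by simp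
      then have "?c [^] Suc i \<otimes> q0 = ?c \<otimes> (?c [^] i \<otimes> q0)"
        using m_lcomm[OF nat_pow_closed[OF cG] cG q0G] by simp
      then show ?case using step[OF Suc] by simp
    qed (use q0 q0G in simp)
    let ?k = "card (supp n ?E)"
    \<comment> \<open>The orbit of \<open>q0\<close> under \<open>?c\<close> stays in the support,
      and the bound on the order of \<open>?c\<close> would give \<open>?k + 1\<close> distinct
      points in a set of \<open>?k\<close> elements.\<close>
    have "inj_on (\<lambda>i::nat. ?c [^] i \<otimes> q0) {..?k}"
    proof (rule linorder_inj_onI)
      fix i j :: nat assume ij: "i < j" "i \<in> {..?k}" "j \<in> {..?k}"
      show "?c [^] i \<otimes> q0 \<noteq> ?c [^] j \<otimes> q0"
      proof
        assume "?c [^] i \<otimes> q0 = ?c [^] j \<otimes> q0"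
        then have eq: "?c [^] i = ?c [^] j" using cG q0G by simp
        have "?c [^] j = ?c [^] i \<otimes> ?c [^] (j - i)" using cG ij by (simp add: nat_pow_mult)
        then have "?c [^] (j - i) = \<one>" using eq cG
          by (metis l_cancel_one' nat_pow_closed)
        moreover have "j - i \<le> s * 2 ^ length (a # xs)"
        proof -
          have "j - i \<le> ?k" using ij by auto
          also have "\<dots> \<le> s * 2 ^ length (a # xs)" using IH(3) by simp
          finally show ?thesis .
        qed
        ultimately show False using Cons.prems(2)[of x y "j - i"] a ij by simp
      qed
    qed auto
    then have "card {..?k} \<le> card (supp n ?E)"
      using pw IH(1) by (intro card_inj_on_le[where f = "\<lambda>i::nat. ?c [^] i \<otimes> q0"]) auto
    then show False by simp
  qed
  then show ?case using fin card by blast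
qed

end

text \<open>The Fox derivative seen as a 1-cocycle on \<open>H\<close> with values in the group ring
  of \<open>H / L\<close> modulo \<open>n\<close>: \<open>\<phi> x g\<close> is the coefficient of
  the coset of \<open>g\<close>, and \<open>mult\<close> is the rule D(xy) = Dx + x Dy. Everything
  is phrased with the operations of \<open>G\<close>, because elements of \<open>H\<close> will be
  conjugated by elements outside \<open>H\<close>.\<close>

locale cocycle = group G for G (structure) +
  fixes H L :: "'a set" and n :: int and \<phi> :: "'a \<Rightarrow> 'a \<Rightarrow> int"
  assumes H: "subgroup H G" and L: "subgroup L G" "L \<subseteq> H"
    and conj_closed: "\<And>x l. x \<in> H \<Longrightarrow> l \<in> L \<Longrightarrow> x \<otimes> l \<otimes> inv x \<in> L"
    and n: "n > 1"
    and range: "\<And>x g. x \<in> H \<Longrightarrow> g \<in> H \<Longrightarrow> \<phi> x g \<in> {0..<n}"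
    and mult: "\<And>x y g. x \<in> H \<Longrightarrow> y \<in> H \<Longrightarrow> g \<in> H \<Longrightarrow> \<phi> (x \<otimes> y) g = (\<phi> x g + \<phi> y (inv x \<otimes> g)) mod n"
    and invariant: "\<And>x g l. x \<in> H \<Longrightarrow> g \<in> H \<Longrightarrow> l \<in> L \<Longrightarrow> \<phi> x (g \<otimes> l) = \<phi> x g"
begin

lemma H_closed [simp]: "\<one> \<in> H" "x \<in> H \<Longrightarrow> y \<in> H \<Longrightarrow> x \<otimes> y \<in> H" "x \<in> H \<Longrightarrow> inv x \<in> H"
  and H_carrier [simp]: "x \<in> H \<Longrightarrow> x \<in> carrier G"
  using H by (auto simp: subgroup.one_closed subgroup.m_closed subgroup.m_inv_closed subgroup.mem_carrier)

lemma L_closed [simp]: "\<one> \<in> L" "x \<in> L \<Longrightarrow> y \<in> L \<Longrightarrow> x \<otimes> y \<in> L" "x \<in> L \<Longrightarrow> inv x \<in> L"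
  and L_H [simp]: "x \<in> L \<Longrightarrow> x \<in> H"
  using L by (auto simp: subgroup.one_closed subgroup.m_closed subgroup.m_inv_closed)

lemma mod_n [simp]: "x \<in> H \<Longrightarrow> g \<in> H \<Longrightarrow> \<phi> x g mod n = \<phi> x g"
  using range[of x g] by simp

lemma pow_H [simp]: "x \<in> H \<Longrightarrow> x [^] (i::nat) \<in> H" and pow_L [simp]: "y \<in> L \<Longrightarrow> y [^] (i::nat) \<in> L"
  by (induction i) auto

lemma left_invariant:
  assumes "x \<in> H" "g \<in> H" "l \<in> L" shows "\<phi> x (l \<otimes> g) = \<phi> x g"
proof -
  have "inv g \<otimes> l \<otimes> inv (inv g) \<in> L" using assms by (intro conj_closed) auto
  then have "\<phi> x (g \<otimes> (inv g \<otimes> l \<otimes> inv (inv g))) = \<phi> x g" using assms invariant by blast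
  then show ?thesis using assms by (simp add: m_assoc cancel_inv_right)
qed

lemma one [simp]: "g \<in> H \<Longrightarrow> \<phi> \<one> g = 0"
  using mult[of \<one> \<one> g] range[of \<one> g] n
  by (simp add: mod_add_eq) (smt (verit) mod_pos_pos_trivial mod_add_self1 minus_mod_self2)

lemma inverse: "x \<in> H \<Longrightarrow> g \<in> H \<Longrightarrow> \<phi> (inv x) g = (- \<phi> x (x \<otimes> g)) mod n"
proof -
  assume x: "x \<in> H" and g: "g \<in> H"
  have "(\<phi> (inv x) g + \<phi> x (x \<otimes> g)) mod n = 0"
    using mult[of "inv x" x g] x g by simp
  then have "(\<phi> (inv x) g + \<phi> x (x \<otimes> g) - \<phi> x (x \<otimes> g)) mod n = (0 - \<phi> x (x \<otimes> g)) mod n"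
    by (metis mod_0 mod_diff_cong mod_mod_trivial)
  then show ?thesis using x g by simp
qed

lemma mult_L: "x \<in> L \<Longrightarrow> y \<in> H \<Longrightarrow> g \<in> H \<Longrightarrow> \<phi> (x \<otimes> y) g = (\<phi> x g + \<phi> y g) mod n"
  using mult[of x y g] left_invariant[of y g "inv x"] by simp

lemma inverse_L: "x \<in> L \<Longrightarrow> g \<in> H \<Longrightarrow> \<phi> (inv x) g = (- \<phi> x g) mod n"
  using inverse[of x g] left_invariant[of x g x] by simp

lemma pow_L_eq: "x \<in> L \<Longrightarrow> g \<in> H \<Longrightarrow> \<phi> (x [^] (i::nat)) g = (int i * \<phi> x g) mod n"
proof (induction i)
  case (Suc i)
  then show ?case using mult_L[of "x [^] i" x g]
    by (simp add: mod_add_left_eq mod_add_right_eq distrib_right add.commute)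
qed simp

text \<open>Since \<open>L\<close> acts trivially on functions on \<open>H / L\<close>, the cocycle
  is additive on \<open>L\<close> (\<open>mult_L\<close>). Here it becomes equivariant as well: the
  contributions of \<open>x\<close> and of its inverse cancel, and on \<open>L\<close> it is a map
  of \<open>H / L\<close>-modules from the abelianization of \<open>L\<close>.\<close>

lemma conj:
  assumes x: "x \<in> H" and l: "l \<in> L" and g: "g \<in> H"
  shows "\<phi> (x \<otimes> l \<otimes> inv x) g = \<phi> l (inv x \<otimes> g)"
proof -
  have "\<phi> (inv x) (inv (x \<otimes> l) \<otimes> g) = (- \<phi> x (x \<otimes> (inv (x \<otimes> l) \<otimes> g))) mod n"
    using x l g by (intro inverse) auto
  also have "x \<otimes> (inv (x \<otimes> l) \<otimes> g) = (x \<otimes> inv l \<otimes> inv x) \<otimes> g"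
    using x l g by (simp add: inv_mult_group m_assoc)
  also have "\<phi> x \<dots> = \<phi> x g" using x l g conj_closed[of x "inv l"] by (intro left_invariant) auto
  finally have "\<phi> (x \<otimes> l \<otimes> inv x) g = ((\<phi> x g + \<phi> l (inv x \<otimes> g)) mod n + (- \<phi> x g) mod n) mod n"
    using mult[of "x \<otimes> l" "inv x" g] mult[of x l g] x l g by simp
  also have "\<dots> = \<phi> l (inv x \<otimes> g) mod n" by (simp add: mod_add_eq)
  finally show ?thesis using x l g by simp
qed

lemma pow_zero: "\<forall>g\<in>H. \<phi> x g = 0 \<Longrightarrow> x \<in> H \<Longrightarrow> g \<in> H \<Longrightarrow> \<phi> (x [^] (i::nat)) g = 0"
proof (induction i arbitrary: g)
  case (Suc i)
  then show ?case using mult[of "x [^] i" x g] by simp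
qed simp

text \<open>The formula D(c^q) = 1 + c + ... + c^(q-1), read off at the coset of \<open>g\<close>.
  The count allows for powers that fall into the same coset.\<close>

lemma pow_delta:
  assumes c: "c \<in> H" "\<And>g. g \<in> H \<Longrightarrow> \<phi> c g = (if g \<in> L then 1 else 0)" and g: "g \<in> H"
  shows "\<phi> (c [^] (q::nat)) g = int (card {i. i < q \<and> inv (c [^] i) \<otimes> g \<in> L}) mod n"
proof (induction q)
  case (Suc q)
  have "{i. i < Suc q \<and> inv (c [^] i) \<otimes> g \<in> L} =
      (if inv (c [^] q) \<otimes> g \<in> L then insert q {i. i < q \<and> inv (c [^] i) \<otimes> g \<in> L}
       else {i. i < q \<and> inv (c [^] i) \<otimes> g \<in> L})"
    by (auto simp: less_Suc_eq)
  then show ?case using Suc c g mult[of "c [^] q" c g]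
    by (simp add: mod_add_left_eq mod_add_right_eq add.commute)
qed (use g in simp)

definition ker :: "'a set" where "ker = {x \<in> L. \<forall>g\<in>H. \<phi> x g = 0}"

lemma subgroup_ker: "subgroup ker G"
proof
  show "ker \<subseteq> carrier G" by (auto simp: ker_def)
qed (auto simp: ker_def mult_L inverse_L)

lemma commutator_in_ker: "x \<in> L \<Longrightarrow> y \<in> L \<Longrightarrow> x \<otimes> y \<otimes> inv x \<otimes> inv y \<in> ker"
  by (auto simp: ker_def mult_L inverse_L mod_simps)

context
  fixes c :: 'a and q :: nat
  assumes c: "c \<in> H" "\<And>g. g \<in> H \<Longrightarrow> \<phi> c g = (if g \<in> L then 1 else 0)"
    and q: "q > 0" "c [^] q \<in> L" "\<And>i. 0 < i \<Longrightarrow> i < q \<Longrightarrow> c [^] i \<notin> L"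
begin

lemma delta_one: "\<phi> (c [^] q) \<one> = 1"
proof -
  have "{i. i < q \<and> inv (c [^] i) \<otimes> \<one> \<in> L} = {0}"
  proof -
    have "c [^] i \<in> L" if "inv (c [^] i) \<otimes> \<one> \<in> L" for i :: nat
    proof -
      have "inv (inv (c [^] i) \<otimes> \<one>) \<in> L" using that by (rule L_closed(3))
      moreover have "inv (inv (c [^] i) \<otimes> \<one>) = c [^] i" using c(1) by simp
      ultimately show ?thesis by (rule back_subst)
    qed
    then have "i = 0" if "i < q" "inv (c [^] i) \<otimes> \<one> \<in> L" for i :: nat
      using that q(3)[of i] by blast
    moreover have "inv (c [^] (0::nat)) \<otimes> \<one> \<in> L" by simp
    ultimately show ?thesis using q(1) by blast
  qed
  then show ?thesis using pow_delta[OF c, of \<one> q] n by simp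
qed

lemma delta_pow: "0 < i \<Longrightarrow> int i < n \<Longrightarrow> (c [^] q) [^] i \<notin> ker"
  using pow_L_eq[of "c [^] q" \<one> i] q delta_one by (auto simp: ker_def intro!: bexI[of _ \<one>])

text \<open>With u = c^q, the derivative of the commutator is J (h - 1) D(u), and D(u) is supported
  on the cosets of powers of \<open>c\<close>. The inverse of \<open>h\<close> lies in none of
  these, so the coefficient at the identity is just -J, which is nonzero modulo
  \<open>n\<close>.\<close>

lemma delta_commutator:
  assumes h: "h \<in> H" "\<And>i::nat. inv (c [^] i) \<otimes> inv h \<notin> L" and J: "0 < J" "int J < n"
  shows "h \<otimes> (c [^] q) [^] J \<otimes> inv h \<otimes> inv ((c [^] q) [^] J) \<notin> ker"
proof
  let ?u = "c [^] q"
  assume "h \<otimes> ?u [^] J \<otimes> inv h \<otimes> inv (?u [^] J) \<in> ker"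
  then have "0 = \<phi> (h \<otimes> ?u [^] J \<otimes> inv h \<otimes> inv (?u [^] J)) \<one>" by (simp add: ker_def)
  also have "\<dots> = (\<phi> (?u [^] J) (inv h) + \<phi> (inv (?u [^] J)) \<one>) mod n"
    using mult_L[of "h \<otimes> ?u [^] J \<otimes> inv h" "inv (?u [^] J)" \<one>] conj[of h "?u [^] J" \<one>]
      conj_closed[of h "?u [^] J"] h q by simp
  also have "\<phi> (inv (?u [^] J)) \<one> = (- \<phi> (?u [^] J) \<one>) mod n"
    using inverse_L[of "?u [^] J" \<one>] q by simp
  also have "\<phi> (?u [^] J) \<one> = int J" using pow_L_eq[of ?u \<one> J] q delta_one J by simp
  also have "\<phi> (?u [^] J) (inv h) = 0"
    using pow_L_eq[of ?u "inv h" J] q h pow_delta[OF c, of "inv h" q] by simp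
  finally have "n dvd int J" by (simp add: mod_simps) (metis dvd_minus_iff mod_0_imp_dvd)
  then show False using J by (simp add: zdvd_not_zless)
qed

end

end

section \<open>Virtually free pro-p groups\<close>

locale virtually_free = profinite G T for G (structure) and T +
  fixes p :: nat and H B :: "'a set"
  assumes pro_p: "pro_p_group p G T" and H: "subgroup H G" "openin T H"
    and free: "free_pro_p_on p (G\<lparr>carrier := H\<rparr>) (subtopology T H) B"
begin

lemma free_pro_p_H: "free_pro_p (G\<lparr>carrier := H\<rparr>) p (subtopology T H) B"
  using free subgroup.subgroup_is_group[OF H(1) is_group]
  by (simp add: free_pro_p_def free_pro_p_axioms_def)

lemma prime: "Factorial_Ring.prime p" and basis_H: "B \<subseteq> H"
  using free_pro_p.prime[OF free_pro_p_H] free_pro_p.basis_subset[OF free_pro_p_H] by simp_all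

lemma finite_cosets: "open_normal N \<Longrightarrow> finite (rcosets N)"
proof -
  assume "open_normal N"
  then obtain k where "card (rcosets N) = p ^ k" using pro_p unfolding pro_p_group_def by blast
  then show ?thesis using prime_gt_0_nat[OF prime] card_ge_0_finite[of "rcosets N"] by simp
qed

definition H_normal :: "'a set \<Rightarrow> bool" where
  "H_normal L \<longleftrightarrow> subgroup L G \<and> openin T L \<and> L \<subseteq> H \<and> (\<forall>x\<in>H. \<forall>l\<in>L. x \<otimes> l \<otimes> inv x \<in> L)"

lemma H_normal_H: "H_normal H"
  using H unfolding H_normal_def by (auto intro!: subgroup.m_closed subgroup.m_inv_closed)

lemma H_normal_if_open_normal: "open_normal L \<Longrightarrow> L \<subseteq> H \<Longrightarrow> H_normal L"
  unfolding H_normal_def using normal.inv_op_closed2[of L G] subgroup.mem_carrier[OF H(1)]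
  by (auto simp: normal_imp_subgroup)

lemma open_normal_in_H:
  assumes "H_normal L"
  shows "L \<lhd> (G\<lparr>carrier := H\<rparr>) \<and> openin (subtopology T H) L"
proof
  interpret F: free_pro_p "G\<lparr>carrier := H\<rparr>" p "subtopology T H" B by (rule free_pro_p_H)
  have L: "subgroup L G" "openin T L" "L \<subseteq> H" "\<And>x l. x \<in> H \<Longrightarrow> l \<in> L \<Longrightarrow> x \<otimes> l \<otimes> inv x \<in> L"
    using assms unfolding H_normal_def by auto
  show "L \<lhd> (G\<lparr>carrier := H\<rparr>)"
  proof (rule F.normal_invI)
    show "subgroup L (G\<lparr>carrier := H\<rparr>)" using subgroup_incl[OF L(1) H(1) L(3)] .
    show "x \<otimes>\<^bsub>G\<lparr>carrier := H\<rparr>\<^esub> h \<otimes>\<^bsub>G\<lparr>carrier := H\<rparr>\<^esub> inv\<^bsub>G\<lparr>carrier := H\<rparr>\<^esub> x \<in> L"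
      if "x \<in> carrier (G\<lparr>carrier := H\<rparr>)" "h \<in> L" for x h
      using that L(4) H(1) by simp
  qed
  show "openin (subtopology T H) L" using L by (metis Int_absorb2 openin_subtopology_Int)
qed

lemma pow_in_H_normal:
  assumes "H_normal L" "x \<in> H"
  obtains e where "x [^] (p ^ e) \<in> L"
proof -
  interpret F: free_pro_p "G\<lparr>carrier := H\<rparr>" p "subtopology T H" B by (rule free_pro_p_H)
  let ?Q = "(G\<lparr>carrier := H\<rparr>) Mod L"
  note L = open_normal_in_H[OF assms(1)]
  interpret Q: group ?Q by (rule F.quotient_group[OF L])
  obtain e where e: "card (carrier ?Q) = p ^ e" "finite (carrier ?Q)"
    by (rule F.quotient_card[OF L])
  have x: "x \<in> carrier (G\<lparr>carrier := H\<rparr>)" using assms(2) by simp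
  have "(L #>\<^bsub>G\<lparr>carrier := H\<rparr>\<^esub> x) [^]\<^bsub>?Q\<^esub> (p ^ e) = \<one>\<^bsub>?Q\<^esub>"
    using Q.pow_order_eq_1[OF F.coset_in[OF L x]] e by (simp add: order_def)
  moreover have "(L #>\<^bsub>G\<lparr>carrier := H\<rparr>\<^esub> x) [^]\<^bsub>?Q\<^esub> (p ^ e) = L #>\<^bsub>G\<lparr>carrier := H\<rparr>\<^esub> (x [^]\<^bsub>G\<lparr>carrier := H\<rparr>\<^esub> (p ^ e))"
    using normal.FactGroup_pow[of L "G\<lparr>carrier := H\<rparr>" x "p ^ e"] L x by blast
  ultimately have "x [^]\<^bsub>G\<lparr>carrier := H\<rparr>\<^esub> (p ^ e) \<in> L"
    using F.coset_one[OF L, of "x [^]\<^bsub>G\<lparr>carrier := H\<rparr>\<^esub> (p ^ e)"] F.nat_pow_closed[OF x] by metis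
  then show ?thesis using that[of e] nat_pow_consistent[of x "p ^ e" H] by simp
qed

lemma fox_cocycle:
  assumes L: "H_normal L" and c: "c \<in> B" and k: "k > 0"
  shows "\<exists>\<phi>. cocycle G H L (int (p ^ k)) \<phi> \<and> (\<forall>g\<in>H. \<phi> c g = (if g \<in> L then 1 else 0)) \<and>
    (\<forall>c'\<in>B. c' \<noteq> c \<longrightarrow> (\<forall>g\<in>H. \<phi> c' g = 0)) \<and> openin T (cocycle.ker H L \<phi>)"
proof -
  interpret F: free_pro_p "G\<lparr>carrier := H\<rparr>" p "subtopology T H" B by (rule free_pro_p_H)
  have n1: "int (p ^ k) > 1" using prime_gt_1_nat[OF prime] k by (metis of_nat_1 of_nat_less_iff one_less_power)
  have carH: "carrier (G\<lparr>carrier := H\<rparr>) = H" and multH: "mult (G\<lparr>carrier := H\<rparr>) = mult G" by simp_all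
  show ?thesis
  proof (rule F.fox_derivative[OF open_normal_in_H[OF L] c k, unfolded carH multH])
    fix \<phi> assume \<phi>: "\<And>x g. x \<in> H \<Longrightarrow> g \<in> H \<Longrightarrow> \<phi> x g \<in> {0..<int (p ^ k)}"
      "\<And>x y g. x \<in> H \<Longrightarrow> y \<in> H \<Longrightarrow> g \<in> H \<Longrightarrow>
        \<phi> (x \<otimes> y) g = (\<phi> x g + \<phi> y (inv\<^bsub>G\<lparr>carrier := H\<rparr>\<^esub> x \<otimes> g)) mod int (p ^ k)"
      "\<And>g. g \<in> H \<Longrightarrow> \<phi> c g = (if g \<in> L then 1 else 0)"
      "\<And>b' g. b' \<in> B \<Longrightarrow> b' \<noteq> c \<Longrightarrow> g \<in> H \<Longrightarrow> \<phi> b' g = 0"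
      "\<And>x g l. x \<in> H \<Longrightarrow> g \<in> H \<Longrightarrow> l \<in> L \<Longrightarrow> \<phi> x (g \<otimes> l) = \<phi> x g"
      "openin (subtopology T H) {x \<in> L. \<forall>g\<in>H. \<phi> x g = 0}"
    have coc: "cocycle G H L (int (p ^ k)) \<phi>"
    proof (intro cocycle.intro cocycle_axioms.intro is_group)
      fix x y g assume "x \<in> H" "y \<in> H" "g \<in> H"
      then show "\<phi> (x \<otimes> y) g = (\<phi> x g + \<phi> y (inv x \<otimes> g)) mod int (p ^ k)"
        using \<phi>(2)[of x y g] H(1) by simp
    qed (use L n1 \<phi>(1) \<phi>(5) H(1) in \<open>unfold H_normal_def, blast+\<close>)
    have "openin T (cocycle.ker H L \<phi>)"
      unfolding cocycle.ker_def[OF coc] using \<phi>(6) H(2) openin_trans_full by blast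
    with coc show ?thesis using \<phi>(3,4) by (intro exI[of _ \<phi>]) simp
  qed
qed

end

section \<open>Commutators and products of conjugates\<close>

context group
begin

lemma conj_pow:
  assumes "x \<in> carrier G" "y \<in> carrier G"
  shows "(inv y \<otimes> x \<otimes> y) [^] (i::nat) = inv y \<otimes> x [^] i \<otimes> y"
proof (induction i)
  case (Suc i)
  then show ?case using assms by (simp add: group_norm)
qed (use assms in simp)

lemma commutator_commutes:
  assumes G: "x \<in> carrier G" "y \<in> carrier G" "w \<in> carrier G" and xw: "x \<otimes> w = w \<otimes> x"
    and xv: "x \<otimes> (inv y \<otimes> w \<otimes> y) = (inv y \<otimes> w \<otimes> y) \<otimes> x"
  shows "(x \<otimes> y \<otimes> inv x \<otimes> inv y) \<otimes> w = w \<otimes> (x \<otimes> y \<otimes> inv x \<otimes> inv y)"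
proof -
  let ?v = "inv y \<otimes> w \<otimes> y"
  have vG: "?v \<in> carrier G" using G by simp
  have "inv x \<otimes> ?v = inv x \<otimes> (?v \<otimes> x) \<otimes> inv x" using G vG by (simp add: m_assoc del: m_closed) (simp add: m_assoc G)
  also have "\<dots> = ?v \<otimes> inv x" unfolding xv[symmetric] using G by (simp add: m_assoc cancel_inv_left)
  finally have iv: "inv x \<otimes> ?v = ?v \<otimes> inv x" .
  have "(x \<otimes> y \<otimes> inv x \<otimes> inv y) \<otimes> w = x \<otimes> y \<otimes> (inv x \<otimes> ?v) \<otimes> inv y"
    using G by (simp add: group_norm)
  also have "\<dots> = (x \<otimes> w) \<otimes> y \<otimes> inv x \<otimes> inv y"
    unfolding iv using G by (simp add: group_norm)
  also have "\<dots> = w \<otimes> (x \<otimes> y \<otimes> inv x \<otimes> inv y)"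
    unfolding xw using G by (simp add: group_norm)
  finally show ?thesis .
qed

text \<open>In the abelian group \<open>M / N\<close>, \<open>triv\<close> says that
  \<open>t\<close> commutes with all \<open>J\<close>-th powers of elements of \<open>M\<close>. The
  set of these powers is stable under conjugation by \<open>c\<close>, so the commutator of
  \<open>t\<close> and \<open>c\<close> commutes with them too. Passing to the commutator matters
  because it can lie in \<open>H\<close> when \<open>t\<close> does not.\<close>

lemma pow_centralized_by_commutator:
  assumes N: "N \<lhd> G" and M: "M \<lhd> G"
    and ab: "\<And>x y. x \<in> M \<Longrightarrow> y \<in> M \<Longrightarrow> x \<otimes> y \<otimes> inv x \<otimes> inv y \<in> N"
    and t: "t \<in> carrier G" and c: "c \<in> carrier G"
    and triv: "\<And>u. u \<in> M \<Longrightarrow> (inv u \<otimes> (inv t \<otimes> u \<otimes> t)) [^] (J::nat) \<in> N" and u: "u \<in> M"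
  shows "(t \<otimes> c \<otimes> inv t \<otimes> inv c) \<otimes> u [^] J \<otimes> inv (t \<otimes> c \<otimes> inv t \<otimes> inv c) \<otimes> inv (u [^] J) \<in> N"
proof -
  let ?Q = "G Mod N" and ?\<pi> = "\<lambda>x. N #> x"
  interpret Q: group ?Q using N by (rule normal.factorgroup_is_group)
  interpret \<pi>: group_hom G ?Q ?\<pi>
    using normal.r_coset_hom_Mod[OF N] is_group Q.is_group by (simp add: group_hom_def group_hom_axioms_def)
  have MG: "x \<in> carrier G" if "x \<in> M" for x
    using that M normal_imp_subgroup subgroup.mem_carrier by metis
  have eq: "?\<pi> x = ?\<pi> y \<longleftrightarrow> x \<otimes> inv y \<in> N" if "x \<in> carrier G" "y \<in> carrier G" for x y
    using coset_eq_iff[OF N that] .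
  have one: "?\<pi> x = \<one>\<^bsub>?Q\<^esub> \<longleftrightarrow> x \<in> N" if "x \<in> carrier G" for x
    using eq[OF that one_closed] \<pi>.hom_one that by simp
  have comm: "?\<pi> x \<otimes>\<^bsub>?Q\<^esub> ?\<pi> y = ?\<pi> y \<otimes>\<^bsub>?Q\<^esub> ?\<pi> x" if "x \<in> M" "y \<in> M" for x y
  proof -
    have "x \<otimes> y \<otimes> inv (y \<otimes> x) \<in> N" using ab[OF that] MG that by (simp add: inv_mult_group m_assoc)
    then have "?\<pi> (x \<otimes> y) = ?\<pi> (y \<otimes> x)"
      using eq[of "x \<otimes> y" "y \<otimes> x"] MG[OF that(1)] MG[OF that(2)] by blast
    then show ?thesis using MG[OF that(1)] MG[OF that(2)] by simp
  qed
  have star: "?\<pi> t \<otimes>\<^bsub>?Q\<^esub> ?\<pi> (x [^] J) = ?\<pi> (x [^] J) \<otimes>\<^bsub>?Q\<^esub> ?\<pi> t" if x: "x \<in> M" for x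
  proof -
    let ?v = "inv t \<otimes> x \<otimes> t"
    have xG: "x \<in> carrier G" using MG x .
    have v: "?v \<in> M" using normal.inv_op_closed1[OF M t x] .
    have ix: "inv x \<in> M" using x M normal_imp_subgroup subgroup.m_inv_closed by metis
    have vG: "?v \<in> carrier G" using MG v .
    have "\<one>\<^bsub>?Q\<^esub> = ?\<pi> ((inv x \<otimes> ?v) [^] J)" using triv[OF x] one[of "(inv x \<otimes> ?v) [^] J"] xG t by (metis inv_closed m_closed nat_pow_closed)
    also have "\<dots> = (?\<pi> (inv x) \<otimes>\<^bsub>?Q\<^esub> ?\<pi> ?v) [^]\<^bsub>?Q\<^esub> J"
      using \<pi>.hom_nat_pow[of "inv x \<otimes> ?v" J] \<pi>.hom_mult[of "inv x" ?v] xG vG by simp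
    also have "\<dots> = ?\<pi> (inv x) [^]\<^bsub>?Q\<^esub> J \<otimes>\<^bsub>?Q\<^esub> ?\<pi> ?v [^]\<^bsub>?Q\<^esub> J"
      using comm[OF ix v] xG vG by (intro Q.pow_mult_distrib \<pi>.hom_closed) auto
    also have "\<dots> = ?\<pi> (inv x [^] J) \<otimes>\<^bsub>?Q\<^esub> ?\<pi> (?v [^] J)"
      using \<pi>.hom_nat_pow[of "inv x" J] \<pi>.hom_nat_pow[OF vG, of J] xG by simp
    also have "\<dots> = ?\<pi> (inv x [^] J \<otimes> (?v [^] J))" using \<pi>.hom_mult xG vG by simp
    also have "inv x [^] J \<otimes> (?v [^] J) = inv (x [^] J) \<otimes> (inv t \<otimes> x [^] J \<otimes> t)"
      using nat_pow_inv[OF xG] conj_pow[OF xG t] by simp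
    finally have "\<one>\<^bsub>?Q\<^esub> = ?\<pi> (inv (x [^] J) \<otimes> (inv t \<otimes> x [^] J \<otimes> t))" .
    then have n: "inv (x [^] J) \<otimes> (inv t \<otimes> x [^] J \<otimes> t) \<in> N"
      using one[of "inv (x [^] J) \<otimes> (inv t \<otimes> x [^] J \<otimes> t)"] xG t by (metis inv_closed m_closed nat_pow_closed)
    have "(t \<otimes> x [^] J) \<otimes> (inv (x [^] J) \<otimes> (inv t \<otimes> x [^] J \<otimes> t)) \<otimes> inv (t \<otimes> x [^] J) \<in> N"
      using normal.inv_op_closed2[OF N _ n, of "t \<otimes> x [^] J"] xG t by simp
    then have "(x [^] J \<otimes> t) \<otimes> inv (t \<otimes> x [^] J) \<in> N" using xG t by (simp add: group_norm)
    then have "?\<pi> (x [^] J \<otimes> t) = ?\<pi> (t \<otimes> x [^] J)"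
      using eq[of "x [^] J \<otimes> t" "t \<otimes> x [^] J"] xG t nat_pow_closed[OF xG, of J] by blast
    then show ?thesis using \<pi>.hom_mult[OF nat_pow_closed[OF xG, of J] t] \<pi>.hom_mult[OF t nat_pow_closed[OF xG, of J]] by metis
  qed
  have uG: "u \<in> carrier G" using MG u .
  let ?w = "u [^] J" and ?h = "t \<otimes> c \<otimes> inv t \<otimes> inv c"
  have v: "inv c \<otimes> u \<otimes> c \<in> M" using normal.inv_op_closed1[OF M c u] .
  have wG: "?w \<in> carrier G" using uG by simp
  have hG: "?h \<in> carrier G" using t c by simp
  have "?\<pi> ((inv c \<otimes> u \<otimes> c) [^] J) = inv\<^bsub>?Q\<^esub> ?\<pi> c \<otimes>\<^bsub>?Q\<^esub> ?\<pi> ?w \<otimes>\<^bsub>?Q\<^esub> ?\<pi> c"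
    unfolding conj_pow[OF uG c] using wG c by (simp del: \<pi>.hom_nat_pow)
  then have "(?\<pi> t \<otimes>\<^bsub>?Q\<^esub> ?\<pi> c \<otimes>\<^bsub>?Q\<^esub> inv\<^bsub>?Q\<^esub> ?\<pi> t \<otimes>\<^bsub>?Q\<^esub> inv\<^bsub>?Q\<^esub> ?\<pi> c) \<otimes>\<^bsub>?Q\<^esub> ?\<pi> ?w =
      ?\<pi> ?w \<otimes>\<^bsub>?Q\<^esub> (?\<pi> t \<otimes>\<^bsub>?Q\<^esub> ?\<pi> c \<otimes>\<^bsub>?Q\<^esub> inv\<^bsub>?Q\<^esub> ?\<pi> t \<otimes>\<^bsub>?Q\<^esub> inv\<^bsub>?Q\<^esub> ?\<pi> c)"
    using Q.commutator_commutes[OF \<pi>.hom_closed[OF t] \<pi>.hom_closed[OF c] \<pi>.hom_closed[OF wG] star[OF u]] star[OF v]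
    by simp
  moreover have "?\<pi> ?h = ?\<pi> t \<otimes>\<^bsub>?Q\<^esub> ?\<pi> c \<otimes>\<^bsub>?Q\<^esub> inv\<^bsub>?Q\<^esub> ?\<pi> t \<otimes>\<^bsub>?Q\<^esub> inv\<^bsub>?Q\<^esub> ?\<pi> c"
    using t c by simp
  ultimately have "?\<pi> (?h \<otimes> ?w) = ?\<pi> (?w \<otimes> ?h)"
    using \<pi>.hom_mult[OF hG wG] \<pi>.hom_mult[OF wG hG] by metis
  then have "(?h \<otimes> ?w) \<otimes> inv (?w \<otimes> ?h) \<in> N"
    using eq[of "?h \<otimes> ?w" "?w \<otimes> ?h"] hG wG m_closed by blast
  moreover have "(x \<otimes> ?w) \<otimes> inv (?w \<otimes> x) = x \<otimes> ?w \<otimes> inv x \<otimes> inv ?w" if "x \<in> carrier G" for x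
    using that wG by (simp add: inv_mult_group m_assoc)
  ultimately show ?thesis using hG by simp
qed

text \<open>The group ring element that is the sum of the signed \<open>t\<close>
  (\<open>True\<close> for plus), acting on \<open>n\<close> by conjugation and written
  multiplicatively. The factors are ordered; only modulo commutators of a normal subgroup containing
  \<open>n\<close> does their order become irrelevant.\<close>

definition conj_prod :: "('a \<times> bool) list \<Rightarrow> 'a \<Rightarrow> 'a" where
  "conj_prod ts n = foldr (\<lambda>(t, e) acc. t \<otimes> (if e then n else inv n) \<otimes> inv t \<otimes> acc) ts \<one>"

lemma conj_prod_simps [simp]: "conj_prod [] n = \<one>"
  "conj_prod ((t, e) # ts) n = t \<otimes> (if e then n else inv n) \<otimes> inv t \<otimes> conj_prod ts n"
  by (simp_all add: conj_prod_def)

lemma conj_prod_in_normal: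
  assumes N: "N \<lhd> G" and n: "n \<in> N" and ts: "fst ` set ts \<subseteq> carrier G"
  shows "conj_prod ts n \<in> N"
  using ts
proof (induction ts)
  case Nil
  then show ?case using subgroup.one_closed[OF normal_imp_subgroup[OF N]] by simp
next
  case (Cons te ts)
  obtain t e where te: "te = (t, e)" by fastforce
  then have t: "t \<in> carrier G" using Cons.prems by auto
  have "(if e then n else inv n) \<in> N" using n subgroup.m_inv_closed[OF normal_imp_subgroup[OF N]] by simp
  then have "t \<otimes> (if e then n else inv n) \<otimes> inv t \<in> N" by (rule normal.inv_op_closed2[OF N t])
  then show ?case using Cons te subgroup.m_closed[OF normal_imp_subgroup[OF N]] by simp
qed

end

context virtually_free
begin

definition N0 :: "'a set" where "N0 = core H"

text \<open>Words are considered modulo \<open>K\<close> because a finite direct factor of \<open>G\<close>, say, acts trivially on every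
  \<open>N \<subseteq> N0\<close> and is invisible to Fox derivatives.\<close>
definition K :: "'a set" where "K = {g \<in> carrier G. \<forall>c\<in>N0. g \<otimes> c = c \<otimes> g}"

text \<open>The approximations of \<open>K\<close> at finite level: they are clopen for open normal
  \<open>M\<close> (\<open>K_mod_clopen\<close>) and intersect in \<open>K\<close>
  (\<open>not_in_K\<close>). Lying outside one fixed \<open>K_mod M\<close> is thus a uniform way of
  lying outside \<open>K\<close>.\<close>

definition K_mod :: "'a set \<Rightarrow> 'a set" where
  "K_mod M = {g \<in> carrier G. \<forall>c\<in>N0. g \<otimes> c \<otimes> inv g \<otimes> inv c \<in> M}"

lemma open_normal_N0: "open_normal N0" and N0_H: "N0 \<subseteq> H"
  using open_normal_core[OF H] core_subset[of H] by (simp_all add: N0_def)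

end

text \<open>The conjugators are known only to lie outside \<open>K_mod M0\<close>, and
  \<open>m\<close> bounds their number. An element of \<open>H\<close> outside \<open>M0\<close> is
  not congruent modulo \<open>M\<close> both to a power of \<open>a\<close> and to a power of
  \<open>b\<close> (\<open>sep\<close>). \<open>N\<close> lies in the kernels of derivatives modulo
  \<open>p ^ S\<close> over \<open>M\<close>, which makes orders in the abelian group
  \<open>M / N\<close> large; \<open>N'\<close> lies in the kernel of the derivative modulo
  \<open>p\<close> over \<open>N\<close>. As \<open>J\<close> is divisible by all small numbers, an
  element of \<open>M\<close> whose \<open>J\<close>-th power is not in \<open>N\<close> has order
  above \<open>2 ^ (m + 2)\<close> modulo \<open>N\<close>; \<open>J\<close> is below
  \<open>p ^ S\<close> so that it survives as a coefficient.\<close>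

locale tower = virtually_free +
  fixes a b :: 'a and M0 M N N' :: "'a set" and m J S qa qb :: nat and \<phi>a \<phi>b \<phi> :: "'a \<Rightarrow> 'a \<Rightarrow> int"
  assumes aB: "a \<in> B" and bB: "b \<in> B" and ab: "a \<noteq> b"
    and M0: "open_normal M0" "M0 \<subseteq> N0" and M: "open_normal M" "M \<subseteq> M0"
    and N: "open_normal N" "N \<subseteq> M" and N': "open_normal N'"
    and sep: "\<And>h. h \<in> H \<Longrightarrow> h \<notin> M0 \<Longrightarrow>
        (\<forall>i::nat. inv (a [^] i) \<otimes> h \<notin> M) \<or> (\<forall>i::nat. inv (b [^] i) \<otimes> h \<notin> M)"
    and qa: "qa > 0" "a [^] qa \<in> M" "\<And>i. 0 < i \<Longrightarrow> i < qa \<Longrightarrow> a [^] i \<notin> M"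
    and qb: "qb > 0" "b [^] qb \<in> M" "\<And>i. 0 < i \<Longrightarrow> i < qb \<Longrightarrow> b [^] i \<notin> M"
    and J: "J > 0" "\<And>i. 0 < i \<Longrightarrow> i \<le> 2 ^ (m + 2) \<Longrightarrow> i dvd J" "int J < int (p ^ S)"
    and coa: "cocycle G H M (int (p ^ S)) \<phi>a" and cob: "cocycle G H M (int (p ^ S)) \<phi>b"
    and co: "cocycle G H N (int p) \<phi>"
    and da: "\<And>g. g \<in> H \<Longrightarrow> \<phi>a a g = (if g \<in> M then 1 else 0)"
    and db: "\<And>g. g \<in> H \<Longrightarrow> \<phi>b b g = (if g \<in> M then 1 else 0)"
    and d: "\<And>g. g \<in> H \<Longrightarrow> \<phi> b g = (if g \<in> N then 1 else 0)" "\<And>g. g \<in> H \<Longrightarrow> \<phi> a g = 0"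
    and kera: "N \<subseteq> cocycle.ker H M \<phi>a" and kerb: "N \<subseteq> cocycle.ker H M \<phi>b"
    and ker: "N' \<subseteq> cocycle.ker H N \<phi>"
    and abelian: "\<And>x y. x \<in> M \<Longrightarrow> y \<in> M \<Longrightarrow> x \<otimes> y \<otimes> inv x \<otimes> inv y \<in> N"
begin

lemma M_N0: "M \<subseteq> N0" and M_H: "M \<subseteq> H" and N_H: "N \<subseteq> H"
  using M0 M N N0_H by auto

lemma aH: "a \<in> H" and bH: "b \<in> H" using aB bB basis_H by auto

lemma H_carrier [simp]: "x \<in> H \<Longrightarrow> x \<in> carrier G" using subgroup.mem_carrier[OF H(1)] .

lemma M_carrier [simp]: "x \<in> M \<Longrightarrow> x \<in> carrier G" and N_carrier [simp]: "x \<in> N \<Longrightarrow> x \<in> carrier G"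
  using M_H N_H by auto

lemma sM: "subgroup M G" using M(1) normal_imp_subgroup by blast

lemma M_closed [simp]: "\<one> \<in> M" "x \<in> M \<Longrightarrow> y \<in> M \<Longrightarrow> x \<otimes> y \<in> M" "x \<in> M \<Longrightarrow> inv x \<in> M"
  using subgroup.one_closed[OF sM] subgroup.m_closed[OF sM] subgroup.m_inv_closed[OF sM] by auto

lemma M_conj: "g \<in> carrier G \<Longrightarrow> x \<in> M \<Longrightarrow> g \<otimes> x \<otimes> inv g \<in> M"
  using M(1) normal.inv_op_closed2[of M G g x] by blast

lemma sN: "subgroup N G" using N(1) normal_imp_subgroup by blast

lemma N_closed [simp]: "\<one> \<in> N" "x \<in> N \<Longrightarrow> y \<in> N \<Longrightarrow> x \<otimes> y \<in> N" "x \<in> N \<Longrightarrow> inv x \<in> N"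
  using subgroup.one_closed[OF sN] subgroup.m_closed[OF sN] subgroup.m_inv_closed[OF sN] by auto

lemma N_conj: "g \<in> carrier G \<Longrightarrow> x \<in> N \<Longrightarrow> g \<otimes> x \<otimes> inv g \<in> N"
  using N(1) normal.inv_op_closed2[of N G g x] by blast

text \<open>Otherwise the commutator \<open>?h\<close> of \<open>t\<close> with some
  \<open>c\<close> in \<open>N0\<close> would centralize the \<open>J\<close>-th powers of
  \<open>M\<close> modulo \<open>N\<close>. It lies in \<open>H\<close> but outside
  \<open>M0\<close>, so by \<open>sep\<close> its inverse is not congruent modulo \<open>M\<close>
  to any power of \<open>a\<close>, or not to any power of \<open>b\<close>, and
  \<open>delta_commutator\<close> for that generator gives a contradiction. A single generator would
  not do: \<open>?h\<close> could be one of its powers.\<close>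

lemma moving_element:
  assumes t: "t \<in> carrier G" "t \<notin> K_mod M0"
  shows "\<exists>u\<in>M. (inv u \<otimes> (inv t \<otimes> u \<otimes> t)) [^] J \<notin> N"
proof (rule ccontr)
  assume no: "\<not> ?thesis"
  then have triv: "(inv u \<otimes> (inv t \<otimes> u \<otimes> t)) [^] J \<in> N" if "u \<in> M" for u
    using that by blast
  obtain c where c: "c \<in> N0" "t \<otimes> c \<otimes> inv t \<otimes> inv c \<notin> M0"
    using t by (auto simp: K_mod_def)
  have cG: "c \<in> carrier G" using c N0_H by auto
  let ?h = "t \<otimes> c \<otimes> inv t \<otimes> inv c"
  have "?h \<in> N0"
    using open_normal_N0 normal.inv_op_closed2[of N0 G t c] c(1) t(1)
      subgroup.m_closed[OF normal_imp_subgroup[of N0]] subgroup.m_inv_closed[OF normal_imp_subgroup[of N0]] by blast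
  then have hH: "?h \<in> H" using N0_H by blast
  have key: "?h \<otimes> u [^] J \<otimes> inv ?h \<otimes> inv (u [^] J) \<in> N" if "u \<in> M" for u
    by (rule pow_centralized_by_commutator[of N M])
       (use N(1) M(1) abelian t(1) cG triv that in auto)
  have ihH: "inv ?h \<in> H" using subgroup.m_inv_closed[OF H(1) hH] .
  have "inv ?h \<notin> M0"
  proof
    assume "inv ?h \<in> M0"
    then have "inv (inv ?h) \<in> M0"
      using subgroup.m_inv_closed[OF normal_imp_subgroup[OF conjunct1[OF M0(1)]]] by blast
    then show False using c(2) hH by simp
  qed
  then consider "\<forall>i::nat. inv (a [^] i) \<otimes> inv ?h \<notin> M" | "\<forall>i::nat. inv (b [^] i) \<otimes> inv ?h \<notin> M"
    using sep[OF ihH] by blast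
  then show False
  proof cases
    case 1
    have "?h \<otimes> (a [^] qa) [^] J \<otimes> inv ?h \<otimes> inv ((a [^] qa) [^] J) \<notin> cocycle.ker H M \<phi>a"
      using cocycle.delta_commutator[OF coa aH da qa hH _ J(1,3)] 1 by blast
    then show False
      using key[OF qa(2)] kera by blast
  next
    case 2
    have "?h \<otimes> (b [^] qb) [^] J \<otimes> inv ?h \<otimes> inv ((b [^] qb) [^] J) \<notin> cocycle.ker H M \<phi>b"
      using cocycle.delta_commutator[OF cob bH db qb hH _ J(1,3)] 2 by blast
    then show False
      using key[OF qb(2)] kerb by blast
  qed
qed

end

section \<open>Derivatives on M / N and elimination of conjugators\<close>

context tower
begin

interpretation C: cocycle G H N "int p" \<phi> by (rule co)

abbreviation \<alpha> :: 'a where "\<alpha> \<equiv> a [^] qa"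
abbreviation \<beta> :: 'a where "\<beta> \<equiv> b [^] qb"

definition A :: "'a set monoid" where "A = (G Mod N)\<lparr>carrier := (\<lambda>x. N #> x) ` M\<rparr>"

lemma hom_A: "group_hom (G\<lparr>carrier := M\<rparr>) A (\<lambda>x. N #> x)" and comm_group_A: "comm_group A"
  and eq_A: "x \<in> M \<Longrightarrow> y \<in> M \<Longrightarrow> N #> x = N #> y \<longleftrightarrow> x \<otimes> inv y \<in> N"
proof -
  have nN: "N \<lhd> G" using N(1) by blast
  interpret Q: group "G Mod N" using nN by (rule normal.factorgroup_is_group)
  interpret \<pi>: group_hom G "G Mod N" "\<lambda>x. N #> x"
    using normal.r_coset_hom_Mod[OF nN] is_group Q.is_group by (simp add: group_hom_def group_hom_axioms_def)
  have sA: "subgroup ((\<lambda>x. N #> x) ` M) (G Mod N)" by (rule \<pi>.subgroup_img_is_subgroup[OF sM])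
  have gA: "group A" unfolding A_def by (rule subgroup.subgroup_is_group[OF sA Q.is_group])
  show eq: "N #> x = N #> y \<longleftrightarrow> x \<otimes> inv y \<in> N" if "x \<in> M" "y \<in> M" for x y
    using coset_eq_iff[OF nN, of x y] that by simp
  show "group_hom (G\<lparr>carrier := M\<rparr>) A (\<lambda>x. N #> x)"
    using gA subgroup.subgroup_is_group[OF sM is_group] \<pi>.hom_mult
    by (auto simp: group_hom_def group_hom_axioms_def hom_def A_def)
  show "comm_group A"
  proof (rule group.group_comm_groupI[OF gA])
    fix U V assume "U \<in> carrier A" "V \<in> carrier A"
    then obtain x y where xy: "x \<in> M" "y \<in> M" "U = N #> x" "V = N #> y" by (auto simp: A_def)
    have "x \<otimes> y \<otimes> inv (y \<otimes> x) \<in> N" using abelian[OF xy(1,2)] xy by (simp add: inv_mult_group m_assoc)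
    then have "N #> (x \<otimes> y) = N #> (y \<otimes> x)" using eq[of "x \<otimes> y" "y \<otimes> x"] xy by simp
    then show "U \<otimes>\<^bsub>A\<^esub> V = V \<otimes>\<^bsub>A\<^esub> U"
      using xy by (simp add: A_def)
  qed
qed

lemma carrier_A: "carrier A = (\<lambda>x. N #> x) ` M"
  by (simp add: A_def)

lemma in_A: "x \<in> M \<Longrightarrow> N #> x \<in> carrier A"
  by (simp add: carrier_A)

lemma mult_A: "x \<in> M \<Longrightarrow> y \<in> M \<Longrightarrow> (N #> x) \<otimes>\<^bsub>A\<^esub> (N #> y) = N #> (x \<otimes> y)"
  using group_hom.hom_mult[OF hom_A, of x y] by simp

lemma inv_A: "x \<in> M \<Longrightarrow> inv\<^bsub>A\<^esub> (N #> x) = N #> (inv x)"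
  using group_hom.hom_inv[OF hom_A, of x] m_inv_consistent[OF sM, of x] by simp

lemma one_A: "\<one>\<^bsub>A\<^esub> = N #> \<one>"
  using group_hom.hom_one[OF hom_A] by simp

lemma pow_A: "x \<in> M \<Longrightarrow> (N #> x) [^]\<^bsub>A\<^esub> (i::nat) = N #> (x [^] i)"
  using group_hom.hom_nat_pow[OF hom_A, of x i] nat_pow_consistent[of x i M] by simp

lemma one_A_iff: "x \<in> M \<Longrightarrow> N #> x = \<one>\<^bsub>A\<^esub> \<longleftrightarrow> x \<in> N"
  unfolding one_A using eq_A[of x \<one>] by simp

lemma pow_A_neq:
  fixes i :: nat
  assumes "x \<in> M" "x [^] J \<notin> N" "0 < i" "i \<le> 2 ^ (m + 2)"
  shows "(N #> x) [^]\<^bsub>A\<^esub> i \<noteq> \<one>\<^bsub>A\<^esub>"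
proof
  interpret A: comm_group A by (rule comm_group_A)
  assume "(N #> x) [^]\<^bsub>A\<^esub> i = \<one>\<^bsub>A\<^esub>"
  moreover obtain j where "J = i * j" using J(2)[OF assms(3,4)] by blast
  ultimately have "(N #> x) [^]\<^bsub>A\<^esub> J = \<one>\<^bsub>A\<^esub>"
    using A.nat_pow_pow[OF in_A[OF assms(1)], of i j] by simp
  then have "N #> (x [^] J) = \<one>\<^bsub>A\<^esub>" using pow_A[OF assms(1)] by simp
  moreover have "x [^] J \<in> M" using assms(1) by (induction J) auto
  ultimately show False using one_A_iff assms(2) by blast
qed

lemma \<alpha>_pow: "\<alpha> [^] J \<notin> N" and \<alpha>_notin: "\<alpha> \<notin> N"
proof -
  show "\<alpha> [^] J \<notin> N"
    using cocycle.delta_pow[OF coa aH da qa J(1,3)] kera by blast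
  have "\<alpha> [^] (1::nat) \<notin> N"
    using cocycle.delta_pow[OF coa aH da qa, of 1] J kera by fastforce
  then show "\<alpha> \<notin> N" using qa(2) by simp
qed

text \<open>A commutator whose Fox derivative, restricted to \<open>M / N\<close>, is \<open>\<alpha> - 1\<close>.\<close>
definition n0 :: 'a where "n0 = \<alpha> \<otimes> \<beta> \<otimes> inv \<alpha> \<otimes> inv \<beta>"

lemma n0_N: "n0 \<in> N" unfolding n0_def using abelian qa(2) qb(2) by blast

text \<open>The derivative of \<open>\<beta>\<close> is 1 + b + ... + b^(qb-1), and by minimality of
  \<open>qb\<close> every term except 1 lies outside \<open>M\<close>.\<close>

lemma \<phi>_\<beta>:
  assumes g: "g \<in> M"
  shows "\<phi> \<beta> g = (if g \<in> N then 1 else 0)"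
proof -
  have gH: "g \<in> H" using g M_H by blast
  have z: "i = 0" if "i < qb" "inv (b [^] i) \<otimes> g \<in> N" for i :: nat
  proof (rule ccontr)
    assume "i \<noteq> 0"
    have bi: "b [^] i \<in> carrier G" using bH by simp
    have "inv (b [^] i) \<otimes> g \<in> M" using that N(2) by blast
    then have "inv (inv (b [^] i) \<otimes> g \<otimes> inv g) \<in> M" using g M_closed by blast
    then have "b [^] i \<in> M" using bi g by (simp add: m_assoc)
    then show False using qb(3)[of i] that \<open>i \<noteq> 0\<close> by simp
  qed
  have "{i. i < qb \<and> inv (b [^] i) \<otimes> g \<in> N} = (if g \<in> N then {0} else {})"
  proof (cases "g \<in> N")
    case True
    have "inv (b [^] (0::nat)) \<otimes> g \<in> N" using True by simp
    then show ?thesis using z qb(1) True by auto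
  next
    case False
    have "inv (b [^] i) \<otimes> g \<notin> N" if "i < qb" for i :: nat
    proof
      assume "inv (b [^] i) \<otimes> g \<in> N"
      then have "inv (b [^] (0::nat)) \<otimes> g \<in> N" using z[OF that] by blast
      then show False using False g by simp
    qed
    then show ?thesis using False by auto
  qed
  then show ?thesis
    using C.pow_delta[OF bH d(1) gH, of qb] C.n by simp
qed

text \<open>The derivative of \<open>\<alpha>\<close> vanishes, so D(n0) = \<alpha> D(\<beta>) - n0
  D(\<beta>), and \<open>n0\<close> acts trivially because it lies in \<open>N\<close>.\<close>

lemma \<phi>_n0:
  assumes g: "g \<in> M"
  shows "\<phi> n0 g = ((if inv \<alpha> \<otimes> g \<in> N then 1 else 0) - (if g \<in> N then 1 else 0)) mod int p"
proof -
  have H': "g \<in> H" "\<alpha> \<in> H" "\<beta> \<in> H" using g M_H qa(2) qb(2) by auto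
  have \<alpha>0: "\<phi> \<alpha> x = 0" if "x \<in> H" for x using C.pow_zero[of a x qa] d(2) aH that by blast
  have i\<alpha>0: "\<phi> (inv \<alpha>) x = 0" if "x \<in> H" for x
    using C.inverse[OF H'(2) that] \<alpha>0[of "\<alpha> \<otimes> x"] H' that by simp
  let ?c = "\<alpha> \<otimes> \<beta> \<otimes> inv \<alpha>"
  have "\<phi> ?c g = (\<phi> (\<alpha> \<otimes> \<beta>) g + \<phi> (inv \<alpha>) (inv (\<alpha> \<otimes> \<beta>) \<otimes> g)) mod int p"
    using H' by (intro C.mult) auto
  also have "\<dots> = \<phi> (\<alpha> \<otimes> \<beta>) g" using i\<alpha>0[of "inv (\<alpha> \<otimes> \<beta>) \<otimes> g"] H' by simp
  also have "\<dots> = \<phi> \<beta> (inv \<alpha> \<otimes> g)" using C.mult[OF H'(2,3,1)] \<alpha>0[OF H'(1)] H' by simp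
  finally have c: "\<phi> ?c g = \<phi> \<beta> (inv \<alpha> \<otimes> g)" .
  have "\<phi> (inv \<beta>) (inv ?c \<otimes> g) = (- \<phi> \<beta> (\<beta> \<otimes> (inv ?c \<otimes> g))) mod int p"
    using H' by (intro C.inverse) auto
  also have "\<beta> \<otimes> (inv ?c \<otimes> g) = inv n0 \<otimes> g"
    using H' by (simp add: n0_def inv_mult_group m_assoc)
  also have "\<phi> \<beta> \<dots> = \<phi> \<beta> g" using C.left_invariant[of \<beta> g "inv n0"] n0_N H' by simp
  finally have "\<phi> (inv \<beta>) (inv ?c \<otimes> g) = (- \<phi> \<beta> g) mod int p" .
  moreover have "\<phi> n0 g = (\<phi> ?c g + \<phi> (inv \<beta>) (inv ?c \<otimes> g)) mod int p"
    unfolding n0_def using H' by (intro C.mult) auto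
  ultimately have "\<phi> n0 g = (\<phi> \<beta> (inv \<alpha> \<otimes> g) - \<phi> \<beta> g) mod int p"
    unfolding c by (simp add: mod_add_right_eq)
  then show ?thesis using \<phi>_\<beta>[of g] \<phi>_\<beta>[of "inv \<alpha> \<otimes> g"] g qa(2) by simp
qed

text \<open>The derivative of the conjugate of \<open>n\<close> by \<open>s\<close>, restricted to
  \<open>M / N\<close>; the choice of a representative turns it into a function on the carrier of
  \<open>A\<close>, where \<open>diff_op\<close> operates. Since \<open>s\<close> need not lie in
  \<open>H\<close>, this is not a translate of the derivative of \<open>n\<close>, so
  \<open>s\<close> has to remain a parameter.\<close>

definition F :: "'a \<Rightarrow> 'a \<Rightarrow> 'a set \<Rightarrow> int" where
  "F n s q = \<phi> (s \<otimes> n \<otimes> inv s) (SOME g. g \<in> M \<and> N #> g = q)"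

lemma F_eq:
  assumes "n \<in> N" "s \<in> carrier G" "g \<in> M"
  shows "F n s (N #> g) = \<phi> (s \<otimes> n \<otimes> inv s) g"
proof -
  let ?g = "SOME g'. g' \<in> M \<and> N #> g' = N #> g"
  have g': "?g \<in> M" "N #> ?g = N #> g"
    using someI[of "\<lambda>g'. g' \<in> M \<and> N #> g' = N #> g" g] assms(3) by auto
  have gH: "g \<in> H" "?g \<in> H" using assms(3) g'(1) M_H by auto
  have l: "?g \<otimes> inv g \<in> N" using eq_A[OF g'(1) assms(3)] g'(2) by blast
  have "\<phi> (s \<otimes> n \<otimes> inv s) ((?g \<otimes> inv g) \<otimes> g) = \<phi> (s \<otimes> n \<otimes> inv s) g"
    using C.left_invariant[OF _ gH(1) l] N_conj[OF assms(2,1)] N_H by blast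
  moreover have "(?g \<otimes> inv g) \<otimes> g = ?g" using gH by (simp add: m_assoc)
  ultimately show ?thesis by (simp add: F_def)
qed

lemma supp_F_n0:
  shows "finite (comm_group.supp A (int p) (F n0 \<one>))" "comm_group.supp A (int p) (F n0 \<one>) \<noteq> {}"
    "card (comm_group.supp A (int p) (F n0 \<one>)) \<le> 2"
proof -
  interpret A: comm_group A by (rule comm_group_A)
  have eq: "F n0 \<one> (N #> g) = \<phi> n0 g" if "g \<in> M" for g
    using F_eq[OF n0_N _ that, of \<one>] n0_N by simp
  have sub: "A.supp (int p) (F n0 \<one>) \<subseteq> {N #> \<one>, N #> \<alpha>}"
  proof
    fix q assume q: "q \<in> A.supp (int p) (F n0 \<one>)"
    then obtain g where g: "g \<in> M" "q = N #> g" by (auto simp: A.supp_def carrier_A)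
    then have "\<not> int p dvd \<phi> n0 g" using q eq by (auto simp: A.supp_def)
    then have "inv \<alpha> \<otimes> g \<in> N \<or> g \<in> N" using \<phi>_n0[OF g(1)] by (auto split: if_splits)
    then show "q \<in> {N #> \<one>, N #> \<alpha>}"
    proof
      assume "inv \<alpha> \<otimes> g \<in> N"
      then have "\<alpha> \<otimes> (inv \<alpha> \<otimes> g) \<otimes> inv \<alpha> \<in> N" using N_conj qa(2) M_carrier by blast
      then have "g \<otimes> inv \<alpha> \<in> N" using qa(2) g by (simp add: group_norm del: nat_pow_closed) 
      then show ?thesis using eq_A[OF g(1) qa(2)] g(2) by blast
    next
      assume "g \<in> N"
      then show ?thesis using eq_A[OF g(1), of \<one>] g by simp
    qed
  qed
  then show "finite (A.supp (int p) (F n0 \<one>))" by (rule finite_subset) simp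
  have "card (A.supp (int p) (F n0 \<one>)) \<le> card {N #> \<one>, N #> \<alpha>}" using sub by (intro card_mono) auto
  also have "\<dots> \<le> 2" by (simp add: card_insert_if)
  finally show "card (A.supp (int p) (F n0 \<one>)) \<le> 2" .
  have "inv \<alpha> \<otimes> \<one> \<notin> N"
  proof
    assume "inv \<alpha> \<otimes> \<one> \<in> N"
    then have "inv (inv \<alpha> \<otimes> \<one>) \<in> N" by (rule N_closed(3))
    then show False using \<alpha>_notin qa(2) by simp
  qed
  then have "\<phi> n0 \<one> = (-1) mod int p" using \<phi>_n0[of \<one>] by simp
  then have "\<not> int p dvd \<phi> n0 \<one>" using C.n by (simp add: dvd_mod_iff)
  then have "N #> \<one> \<in> A.supp (int p) (F n0 \<one>)" using eq[of \<one>] in_A[of \<one>] by (simp add: A.supp_def)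
  then show "A.supp (int p) (F n0 \<one>) \<noteq> {}" by blast
qed

lemma \<phi>_conj_prod:
  assumes n: "n \<in> N" and g: "g \<in> H" and ts: "fst ` set ts \<subseteq> carrier G"
  shows "(\<Sum>(t, e)\<leftarrow>ts. (if e then 1 else -1) * \<phi> (t \<otimes> n \<otimes> inv t) g) mod int p = \<phi> (conj_prod ts n) g"
  using ts
proof (induction ts)
  case (Cons te ts)
  obtain t e where te: "te = (t, e)" by fastforce
  then have t: "t \<in> carrier G" using Cons.prems by auto
  let ?x = "t \<otimes> n \<otimes> inv t" and ?y = "t \<otimes> (if e then n else inv n) \<otimes> inv t"
  have x: "?x \<in> N" and y: "?y \<in> N" using N_conj[OF t] n by simp_all
  have r: "conj_prod ts n \<in> N" using conj_prod_in_normal[OF conjunct1[OF N(1)] n] Cons.prems by simp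
  have "\<phi> ?y g = ((if e then 1 else -1) * \<phi> ?x g) mod int p"
  proof (cases e)
    case False
    have "?y = inv ?x" using False t n by (simp add: inv_mult_group m_assoc)
    then show ?thesis using C.inverse_L[OF x g] False by simp
  qed (use C.mod_n[of ?x g] x g N_H in auto)
  moreover have "\<phi> (conj_prod (te # ts) n) g = (\<phi> ?y g + \<phi> (conj_prod ts n) g) mod int p"
    using C.mult_L[OF y _ g, of "conj_prod ts n"] r N_H te by auto
  ultimately show ?case using Cons te by (simp add: mod_add_eq flip: Cons.IH)
qed (use g in simp)

text \<open>If every product lay in \<open>K\<close> modulo \<open>N'\<close>, the signed sum of the
  functions \<open>F n s\<close> would be the derivative of an element of \<open>K\<close>, for all
  \<open>n\<close> in \<open>N\<close>. Comparing this relation for \<open>n\<close> and for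
  conjugates of \<open>n\<close> by elements of \<open>M\<close> multiplies each function by an
  operator of its own. The operators can be arranged to vanish for all terms but the leading 1,
  whose operator cannot kill \<open>F n0 \<one>\<close>.\<close>

lemma elimination:
  assumes len: "length ts \<le> m"
    and ts: "\<And>t e. (t, e) \<in> set ts \<Longrightarrow> t \<in> carrier G \<and> t \<notin> K_mod M0"
  shows "\<exists>n\<in>N. \<forall>\<kappa>\<in>K. \<forall>n'\<in>N'. conj_prod ((\<one>, True) # ts) n \<noteq> \<kappa> \<otimes> n'"
proof (rule ccontr)
  interpret A: comm_group A by (rule comm_group_A)
  assume "\<not> ?thesis"
  then have bad: "\<exists>\<kappa>\<in>K. \<exists>n'\<in>N'. conj_prod ((\<one>, True) # ts) n = \<kappa> \<otimes> n'" if "n \<in> N" for n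
    using that by blast
  let ?L = "(\<one>, True) # ts"
  have ts': "t \<in> carrier G" "t \<notin> K_mod M0" if t: "t \<in> fst ` set ts" for t
  proof -
    from t obtain e where "(t, e) \<in> set ts" by auto
    then show "t \<in> carrier G" "t \<notin> K_mod M0" using ts by blast+
  qed
  have LG: "fst ` set ?L \<subseteq> carrier G" using ts'(1) by auto
  have "\<forall>t\<in>fst ` set ts. \<exists>u. u \<in> M \<and> (inv u \<otimes> (inv t \<otimes> u \<otimes> t)) [^] J \<notin> N"
    using moving_element[OF ts'] by blast
  then obtain U where U: "\<And>t. t \<in> fst ` set ts \<Longrightarrow> U t \<in> M"
      "\<And>t. t \<in> fst ` set ts \<Longrightarrow> (inv (U t) \<otimes> (inv t \<otimes> U t \<otimes> t)) [^] J \<notin> N"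
    using bchoice[of "fst ` set ts" "\<lambda>t u. u \<in> M \<and> (inv u \<otimes> (inv t \<otimes> u \<otimes> t)) [^] J \<notin> N"] by blast
  define V where "V t = inv t \<otimes> U t \<otimes> t" for t
  note tG = ts'(1)
  have V: "V t \<in> M" if "t \<in> fst ` set ts" for t
    using M_conj[of "inv t" "U t"] tG[OF that] U(1)[OF that] by (simp add: V_def)
  \<comment> \<open>The operator that the term \<open>s\<close> acquires: a factor
    \<open>U t - s V(t) s^-1\<close> for each \<open>t\<close> treated so far, and a factor
    \<open>1 - \<alpha>\<close> that disposes of the element of \<open>K\<close>.\<close>
  define pairs where "pairs s us = map (\<lambda>t. (N #> U t, N #> (s \<otimes> V t \<otimes> inv s))) us @ [(\<one>\<^bsub>A\<^esub>, N #> \<alpha>)]" for s us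
  have pairs_A: "set (pairs s us) \<subseteq> carrier A \<times> carrier A" if "set us \<subseteq> fst ` set ts" "s \<in> carrier G" for s us
  proof -
    have "N #> U t \<in> carrier A" "N #> (s \<otimes> V t \<otimes> inv s) \<in> carrier A" if "t \<in> set us" for t
      using that \<open>set us \<subseteq> fst ` set ts\<close> U(1)[of t] V[of t] M_conj[OF \<open>s \<in> carrier G\<close>, of "V t"] in_A by blast+
    then show ?thesis using in_A[OF qa(2)] A.one_closed by (auto simp: pairs_def)
  qed
  define sg :: "bool \<Rightarrow> int" where "sg e = (if e then 1 else -1)" for e
  \<comment> \<open>The relation is kept for all \<open>n\<close> simultaneously, since each
    induction step subtracts its instance at a conjugate of \<open>n\<close> from a translate of its
    instance at \<open>n\<close>.\<close>
  have E: "int p dvd (\<Sum>(s, e)\<leftarrow>?L. sg e * A.diff_op (pairs s us) (F n s) q)"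
    if "set us \<subseteq> fst ` set ts" "n \<in> N" "q \<in> carrier A" for us n q
    using that
  proof (induction us arbitrary: n q)
    case Nil
    note n = Nil.prems(2)
    obtain g where g: "g \<in> M" "q = N #> g" using Nil.prems(3) by (auto simp: carrier_A)
    have ig: "inv \<alpha> \<otimes> g \<in> M" using g qa(2) by simp
    have H': "g \<in> H" "inv \<alpha> \<otimes> g \<in> H" "\<alpha> \<in> H" using g ig qa(2) M_H by auto
    have "A.diff_op (pairs s []) (F n s) q = \<phi> (s \<otimes> n \<otimes> inv s) g - \<phi> (s \<otimes> n \<otimes> inv s) (inv \<alpha> \<otimes> g)"
      if "s \<in> carrier G" for s
      using F_eq[OF n that g(1)] F_eq[OF n that ig] g mult_A[of "inv \<alpha>" g] inv_A[OF qa(2)] qa(2) in_A[OF g(1)]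
      by (simp add: pairs_def)
    then have "(\<Sum>(s, e)\<leftarrow>?L. sg e * A.diff_op (pairs s []) (F n s) q) =
        (\<Sum>(s, e)\<leftarrow>?L. sg e * \<phi> (s \<otimes> n \<otimes> inv s) g - sg e * \<phi> (s \<otimes> n \<otimes> inv s) (inv \<alpha> \<otimes> g))"
      using LG by (intro arg_cong[where f = sum_list] map_cong refl) (auto simp: right_diff_distrib)
    also have "\<dots> = (\<Sum>(s, e)\<leftarrow>?L. sg e * \<phi> (s \<otimes> n \<otimes> inv s) g) - (\<Sum>(s, e)\<leftarrow>?L. sg e * \<phi> (s \<otimes> n \<otimes> inv s) (inv \<alpha> \<otimes> g))"
      unfolding case_prod_unfold by (rule sum_list_subtractf)
    finally have sum: "(\<Sum>(s, e)\<leftarrow>?L. sg e * A.diff_op (pairs s []) (F n s) q) = \<dots>" .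
    obtain \<kappa> n' where \<kappa>: "\<kappa> \<in> K" "n' \<in> N'" "conj_prod ?L n = \<kappa> \<otimes> n'" using bad[OF n] by blast
    have n': "n' \<in> N" "\<And>g. g \<in> H \<Longrightarrow> \<phi> n' g = 0"
      using ker \<kappa>(2) unfolding C.ker_def by auto
    have \<kappa>G: "\<kappa> \<in> carrier G" using \<kappa>(1) by (simp add: K_def)
    have "\<kappa> \<otimes> n' \<otimes> inv n' \<in> N" using conj_prod_in_normal[OF conjunct1[OF N(1)] n LG] n'(1) unfolding \<kappa>(3) by (rule N_closed(2)[OF _ N_closed(3)])
    then have \<kappa>N: "\<kappa> \<in> N" using \<kappa>G n'(1) by (simp add: m_assoc)
    have \<phi>\<kappa>: "\<phi> (conj_prod ?L n) x = \<phi> \<kappa> x" if "x \<in> H" for x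
      unfolding \<kappa>(3) using C.mult_L[OF \<kappa>N _ that, of n'] n' that \<kappa>N N_H by auto
    \<comment> \<open>Elements of \<open>K\<close> commute with \<open>\<alpha>\<close>, which lies
      in \<open>M\<close> and so in \<open>N0\<close>. By equivariance the derivative of
      \<open>\<kappa>\<close> is invariant under \<open>\<alpha>\<close>, and the factor
      \<open>1 - \<alpha>\<close> annihilates it.\<close>
    have "\<alpha> \<otimes> \<kappa> = \<kappa> \<otimes> \<alpha>" using \<kappa>(1) qa(2) M_N0 by (auto simp: K_def)
    then have "\<alpha> \<otimes> \<kappa> \<otimes> inv \<alpha> = \<kappa>" using \<kappa>G qa(2) by (simp add: m_assoc)
    then have "\<phi> \<kappa> (inv \<alpha> \<otimes> g) = \<phi> \<kappa> g" using C.conj[OF H'(3) \<kappa>N H'(1)] by simp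
    then have "(\<Sum>(s, e)\<leftarrow>?L. sg e * \<phi> (s \<otimes> n \<otimes> inv s) g) mod int p =
        (\<Sum>(s, e)\<leftarrow>?L. sg e * \<phi> (s \<otimes> n \<otimes> inv s) (inv \<alpha> \<otimes> g)) mod int p"
      using \<phi>_conj_prod[OF n H'(1) LG] \<phi>_conj_prod[OF n H'(2) LG] \<phi>\<kappa>[OF H'(1)] \<phi>\<kappa>[OF H'(2)]
      unfolding sg_def by simp
    then show ?case unfolding sum by (simp add: mod_eq_dvd_iff)
  next
    case (Cons t us)
    have t: "t \<in> fst ` set ts" and us: "set us \<subseteq> fst ` set ts" using Cons.prems(1) by auto
    note n = Cons.prems(2) and q = Cons.prems(3)
    have VG: "V t \<in> carrier G" and UA: "N #> U t \<in> carrier A" using V[OF t] U(1)[OF t] in_A by auto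
    let ?n = "V t \<otimes> n \<otimes> inv (V t)"
    have n': "?n \<in> N" using N_conj[OF VG n] .
    have eq: "A.diff_op (pairs s (t # us)) (F n s) q =
        A.diff_op (pairs s us) (F n s) (inv\<^bsub>A\<^esub> (N #> U t) \<otimes>\<^bsub>A\<^esub> q) - A.diff_op (pairs s us) (F ?n s) q"
      if s: "s \<in> carrier G" for s
    proof -
      let ?m = "s \<otimes> V t \<otimes> inv s"
      have m: "?m \<in> M" using M_conj[OF s V[OF t]] .
      have mA: "inv\<^bsub>A\<^esub> (N #> ?m) \<in> carrier A" using in_A[OF m] by simp
      \<comment> \<open>Conjugating \<open>n\<close> by \<open>V t\<close> conjugates
        \<open>s n s^-1\<close> by \<open>?m\<close>, which lies in \<open>M\<close> and thus in
        \<open>H\<close> even though \<open>s\<close> may not. Equivariance therefore applies and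
        yields a translation by \<open>?m\<close>.\<close>
      have "F ?n s x = F n s (inv\<^bsub>A\<^esub> (N #> ?m) \<otimes>\<^bsub>A\<^esub> x)" if x: "x \<in> carrier A" for x
      proof -
        obtain g where g: "g \<in> M" "x = N #> g" using x by (auto simp: carrier_A)
        have "s \<otimes> ?n \<otimes> inv s = ?m \<otimes> (s \<otimes> n \<otimes> inv s) \<otimes> inv ?m"
          using s VG n by (simp add: group_norm)
        then have "F ?n s x = \<phi> (?m \<otimes> (s \<otimes> n \<otimes> inv s) \<otimes> inv ?m) g"
          using F_eq[OF n' s g(1)] g(2) by simp
        also have "\<dots> = \<phi> (s \<otimes> n \<otimes> inv s) (inv ?m \<otimes> g)"
          using C.conj[OF _ N_conj[OF s n], of ?m g] m g M_H by blast
        also have "\<dots> = F n s (N #> (inv ?m \<otimes> g))"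
          using F_eq[OF n s, of "inv ?m \<otimes> g"] m g by (metis M_closed(2,3))
        also have "N #> (inv ?m \<otimes> g) = inv\<^bsub>A\<^esub> (N #> ?m) \<otimes>\<^bsub>A\<^esub> x"
          using mult_A[OF M_closed(3)[OF m] g(1)] inv_A[OF m] g(2) by simp
        finally show ?thesis .
      qed
      then have "A.diff_op (pairs s us) (F ?n s) q = A.diff_op (pairs s us) (\<lambda>x. F n s (inv\<^bsub>A\<^esub> (N #> ?m) \<otimes>\<^bsub>A\<^esub> x)) q"
        by (intro A.diff_op_cong pairs_A us s q) auto
      also have "\<dots> = A.diff_op (pairs s us) (F n s) (inv\<^bsub>A\<^esub> (N #> ?m) \<otimes>\<^bsub>A\<^esub> q)"
        by (rule A.diff_op_translate[OF pairs_A[OF us s] mA q])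
      finally show ?thesis by (simp add: pairs_def)
    qed
    then have "(\<Sum>(s, e)\<leftarrow>?L. sg e * A.diff_op (pairs s (t # us)) (F n s) q) =
        (\<Sum>(s, e)\<leftarrow>?L. sg e * A.diff_op (pairs s us) (F n s) (inv\<^bsub>A\<^esub> (N #> U t) \<otimes>\<^bsub>A\<^esub> q) -
          sg e * A.diff_op (pairs s us) (F ?n s) q)"
      using LG by (intro arg_cong[where f = sum_list] map_cong refl) (auto simp: right_diff_distrib)
    also have "\<dots> = (\<Sum>(s, e)\<leftarrow>?L. sg e * A.diff_op (pairs s us) (F n s) (inv\<^bsub>A\<^esub> (N #> U t) \<otimes>\<^bsub>A\<^esub> q)) -
        (\<Sum>(s, e)\<leftarrow>?L. sg e * A.diff_op (pairs s us) (F ?n s) q)"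
      unfolding case_prod_unfold by (rule sum_list_subtractf)
    finally show ?case
      using Cons.IH[OF us n, of "inv\<^bsub>A\<^esub> (N #> U t) \<otimes>\<^bsub>A\<^esub> q"] Cons.IH[OF us n' q] UA q by simp
  qed
  let ?us = "map fst ts"
  have us: "set ?us \<subseteq> fst ` set ts" by simp
  \<comment> \<open>For \<open>s = t\<close> the factor belonging to \<open>t\<close> is
    \<open>U t - U t\<close>, since \<open>V t\<close> was defined as the conjugate of
    \<open>U t\<close> that \<open>t\<close> carries back to \<open>U t\<close>.\<close>
  have zero: "A.diff_op (pairs t ?us) f q = 0" if "t \<in> fst ` set ts" "q \<in> carrier A" for t f q
  proof (rule A.diff_op_zero[OF pairs_A[OF us tG[OF that(1)]] _ that(2)])
    have "t \<otimes> V t \<otimes> inv t = U t" using tG[OF that(1)] U(1)[OF that(1)] by (simp add: V_def group_norm)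
    then show "(N #> U t, N #> U t) \<in> set (pairs t ?us)" using that(1) by (force simp: pairs_def)
  qed
  have "int p dvd A.diff_op (pairs \<one> ?us) (F n0 \<one>) q" if q: "q \<in> carrier A" for q
  proof -
    have "(\<Sum>(s, e)\<leftarrow>ts. sg e * A.diff_op (pairs s ?us) (F n0 s) q) = (\<Sum>(s, e)\<leftarrow>ts. 0)"
      using zero[OF _ q] by (intro arg_cong[where f = sum_list] map_cong refl) force
    also have "\<dots> = 0" by (simp add: case_prod_unfold)
    finally show ?thesis using E[OF us n0_N q] by (simp add: sg_def)
  qed
  then have "A.supp (int p) (A.diff_op (pairs \<one> ?us) (F n0 \<one>)) = {}" by (auto simp: A.supp_def)
  moreover have "(inv\<^bsub>A\<^esub> x \<otimes>\<^bsub>A\<^esub> y) [^]\<^bsub>A\<^esub> i \<noteq> \<one>\<^bsub>A\<^esub>"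
    if xy: "(x, y) \<in> set (pairs \<one> ?us)" and i: "0 < i" "i \<le> 2 * 2 ^ length (pairs \<one> ?us)" for x y and i :: nat
  proof -
    \<comment> \<open>The support of \<open>F n0 \<one>\<close> has at most 2 elements and each of
      the \<open>length ts + 1\<close> factors may double it; hence the exponent
      \<open>m + 2\<close> in the choice of \<open>J\<close>.\<close>
    have "(2::nat) * 2 ^ length (pairs \<one> ?us) = 2 ^ (length ts + 2)" by (simp add: pairs_def)
    also have "\<dots> \<le> 2 ^ (m + 2)" using len by (intro power_increasing) auto
    finally have i': "i \<le> 2 ^ (m + 2)" using i(2) by simp
    from xy consider t where "t \<in> fst ` set ts" "x = N #> U t" "y = N #> (\<one> \<otimes> V t \<otimes> inv \<one>)" | "x = \<one>\<^bsub>A\<^esub>" "y = N #> \<alpha>"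
      by (auto simp: pairs_def)
    then show ?thesis
    proof cases
      case 1
      then have "inv\<^bsub>A\<^esub> x \<otimes>\<^bsub>A\<^esub> y = N #> (inv (U t) \<otimes> V t)"
        using U(1)[OF 1(1)] V[OF 1(1)] by (simp add: inv_A mult_A)
      then show ?thesis
        using pow_A_neq[of "inv (U t) \<otimes> V t" i] U[OF 1(1)] V[OF 1(1)] i(1) i' by (simp add: V_def)
    next
      case 2
      then have "inv\<^bsub>A\<^esub> x \<otimes>\<^bsub>A\<^esub> y = N #> \<alpha>" using in_A[OF qa(2)] by simp
      then show ?thesis using pow_A_neq[OF qa(2) \<alpha>_pow i(1) i'] by simp
    qed
  qed
  ultimately show False
    using A.diff_op_nonzero[OF pairs_A[OF us one_closed] supp_F_n0] by blast
qed

end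

section \<open>Choice of the tower\<close>

context virtually_free
begin

lemma least_pow:
  assumes "H_normal L" "x \<in> H"
  shows "\<exists>q::nat. q > 0 \<and> x [^] q \<in> L \<and> (\<forall>i. 0 < i \<longrightarrow> i < q \<longrightarrow> x [^] i \<notin> L)"
proof -
  obtain e where e: "x [^] (p ^ e) \<in> L" by (rule pow_in_H_normal[OF assms])
  have "0 < p ^ e" using prime_gt_0_nat[OF prime] by simp
  with e have ex: "\<exists>q::nat. 0 < q \<and> x [^] q \<in> L" by blast
  let ?R = "\<lambda>q::nat. 0 < q \<and> x [^] q \<in> L"
  have "?R (Least ?R)" using LeastI_ex[OF ex] .
  moreover have "x [^] i \<notin> L" if "0 < i" "i < Least ?R" for i :: nat
    using not_less_Least[OF that(2)] that(1) by simp
  ultimately show ?thesis by (intro exI[of _ "Least ?R"] conjI allI impI) blast+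
qed

lemma commutator_in_core:
  assumes M: "M \<lhd> G" and D: "\<And>x y. x \<in> M \<Longrightarrow> y \<in> M \<Longrightarrow> x \<otimes> y \<otimes> inv x \<otimes> inv y \<in> D"
    and xy: "x \<in> M" "y \<in> M"
  shows "x \<otimes> y \<otimes> inv x \<otimes> inv y \<in> core D"
proof -
  have MG: "x \<in> carrier G" "y \<in> carrier G" using xy normal_subset[OF M] by auto
  have "g \<otimes> (x \<otimes> y \<otimes> inv x \<otimes> inv y) \<otimes> inv g \<in> D" if g: "g \<in> carrier G" for g
  proof -
    have "g \<otimes> (x \<otimes> y \<otimes> inv x \<otimes> inv y) \<otimes> inv g =
      (g \<otimes> x \<otimes> inv g) \<otimes> (g \<otimes> y \<otimes> inv g) \<otimes> inv (g \<otimes> x \<otimes> inv g) \<otimes> inv (g \<otimes> y \<otimes> inv g)"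
      using g MG by (simp add: group_norm)
    then show ?thesis
      using D[OF normal.inv_op_closed2[OF M g xy(1)] normal.inv_op_closed2[OF M g xy(2)]] by simp
  qed
  then show ?thesis using MG by (simp add: core_def)
qed

text \<open>Each level is the core of kernels of derivatives over the level above, because these
  kernels come from \<open>H\<close> and need not be normal in \<open>G\<close>. The result holds
  for all lists of at most \<open>m\<close> conjugators at once: \<open>N\<close> is chosen before
  the point at which the terms of the derivative are evaluated.\<close>

lemma conj_prod_notin_K:
  assumes ab: "a \<in> B" "b \<in> B" "a \<noteq> b" and M0: "open_normal M0" "M0 \<subseteq> N0" and N1: "open_normal N1"
  obtains N N' where "open_normal N" "open_normal N'" "N \<subseteq> N1" "N' \<subseteq> N"
    "\<And>x y. x \<in> N \<Longrightarrow> y \<in> N \<Longrightarrow> x \<otimes> y \<otimes> inv x \<otimes> inv y \<in> N'"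
    "\<And>ts. length ts \<le> m \<Longrightarrow> (\<And>t e. (t, e) \<in> set ts \<Longrightarrow> t \<in> carrier G \<and> t \<notin> K_mod M0) \<Longrightarrow>
      \<exists>n\<in>N. \<forall>\<kappa>\<in>K. \<forall>n'\<in>N'. conj_prod ((\<one>, True) # ts) n \<noteq> \<kappa> \<otimes> n'"
proof -
  have aH: "a \<in> H" and bH: "b \<in> H" using ab basis_H by auto
  have HG: "x \<in> carrier G" if "x \<in> H" for x using subgroup.mem_carrier[OF H(1) that] .
  have sM0: "subgroup M0 G" using M0(1) normal_imp_subgroup by blast
  have HM0: "H_normal M0" using H_normal_if_open_normal[OF M0(1)] M0(2) N0_H by blast
  obtain e where e: "a [^] (p ^ e) \<in> M0" by (rule pow_in_H_normal[OF HM0 aH])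
  \<comment> \<open>\<open>Suc e\<close> instead of \<open>e\<close> ensures a modulus above 1 even
    if \<open>a\<close> already lies in \<open>M0\<close>.\<close>
  let ?k = "p ^ Suc e"
  have ak: "a [^] (?k * j) \<in> M0" for j
  proof -
    have "(a [^] (p ^ e)) [^] i \<in> M0" for i :: nat
      using e sM0 by (induction i) (auto simp: subgroup.one_closed subgroup.m_closed)
    then have "(a [^] (p ^ e)) [^] (p * j) \<in> M0" .
    then show ?thesis using nat_pow_pow[OF HG[OF aH], of "p ^ e" "p * j"] by (simp add: mult.assoc mult.left_commute)
  qed
  \<comment> \<open>For \<open>L = H\<close> the group ring is just the integers modulo
    \<open>?k\<close>, and \<open>\<psi>\<close> is the homomorphism from \<open>H\<close> that
    sends \<open>a\<close> to 1 and all other basis elements to 0.\<close>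
  obtain \<psi> where \<psi>: "cocycle G H H (int ?k) \<psi>" "\<forall>g\<in>H. \<psi> a g = (if g \<in> H then 1 else 0)"
    "\<forall>c'\<in>B. c' \<noteq> a \<longrightarrow> (\<forall>g\<in>H. \<psi> c' g = 0)" "openin T (cocycle.ker H H \<psi>)"
    using fox_cocycle[OF H_normal_H ab(1), of "Suc e"] by blast
  interpret \<psi>: cocycle G H H "int ?k" \<psi> by (rule \<psi>(1))
  define M where "M = core (N1 \<inter> M0 \<inter> \<psi>.ker)"
  have sN1: "subgroup N1 G" using N1 normal_imp_subgroup by blast
  have "subgroup (N1 \<inter> M0 \<inter> \<psi>.ker) G"
    by (intro subgroups_Inter_pair sN1 sM0 \<psi>.subgroup_ker)
  moreover have "openin T (N1 \<inter> M0 \<inter> \<psi>.ker)" using N1 M0 \<psi>(4) by (intro openin_Int) auto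
  ultimately have M: "open_normal M" unfolding M_def by (rule open_normal_core)
  have Msub: "M \<subseteq> N1 \<inter> M0 \<inter> \<psi>.ker" unfolding M_def by (rule core_subset)
  have HM: "H_normal M" using H_normal_if_open_normal[OF M] Msub M0(2) N0_H by blast
  \<comment> \<open>An element congruent modulo \<open>M\<close> both to a power of \<open>b\<close>
    and to the \<open>i\<close>-th power of \<open>a\<close> has value 0 and also \<open>i\<close>
    under \<open>\<psi>\<close>. So \<open>?k\<close> divides \<open>i\<close>, and that power of
    \<open>a\<close> lies in \<open>M0\<close>, as does the element.\<close>
  have sep: "(\<forall>i::nat. inv (a [^] i) \<otimes> h \<notin> M) \<or> (\<forall>i::nat. inv (b [^] i) \<otimes> h \<notin> M)"
    if h: "h \<in> H" "h \<notin> M0" for h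
  proof (rule ccontr)
    assume "\<not> ?thesis"
    then obtain i j :: nat where ij: "inv (a [^] i) \<otimes> h \<in> M" "inv (b [^] j) \<otimes> h \<in> M" by blast
    have ai: "a [^] i \<in> H" "b [^] j \<in> H" using aH bH by simp_all
    have split: "h = a [^] i \<otimes> (inv (a [^] i) \<otimes> h)" "h = b [^] j \<otimes> (inv (b [^] j) \<otimes> h)"
      using ai HG h by (simp_all add: cancel_inv_right)
    have "inv (a [^] i) \<otimes> h \<in> \<psi>.ker" "inv (b [^] j) \<otimes> h \<in> \<psi>.ker" using ij Msub by blast+
    then have z: "\<psi> (inv (a [^] i) \<otimes> h) \<one> = 0" "\<psi> (inv (b [^] j) \<otimes> h) \<one> = 0"
      unfolding \<psi>.ker_def using \<psi>.H_closed(1) by blast+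
    have "\<forall>g\<in>H. \<psi> b g = 0" using \<psi>(3) ab(2,3) by auto
    then have "\<psi> (b [^] j) \<one> = 0" using \<psi>.pow_zero[OF _ bH \<psi>.H_closed(1)] by simp
    then have "\<psi> h \<one> = 0"
      using \<psi>.mult_L[OF ai(2), of "inv (b [^] j) \<otimes> h" \<one>] z(2) h ai split(2) by simp
    moreover have "\<psi> h \<one> = int i mod int ?k"
      using \<psi>.mult_L[OF ai(1), of "inv (a [^] i) \<otimes> h" \<one>] z(1) h ai \<psi>.pow_L_eq[OF aH, of \<one> i] \<psi>(2)
        split(1) by simp
    ultimately have "int i mod int ?k = 0" by simp
    then have "?k dvd i" by (simp only: of_nat_mod[symmetric] of_nat_eq_0_iff mod_eq_0_iff_dvd)
    then have "a [^] i \<in> M0" using ak by (auto elim!: dvdE)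
    moreover have "inv (a [^] i) \<otimes> h \<in> M0" using ij Msub by blast
    ultimately have "h \<in> M0" using split(1) subgroup.m_closed[OF sM0, of "a [^] i" "inv (a [^] i) \<otimes> h"] by simp
    then show False using h by blast
  qed
  obtain qa :: nat where qa: "qa > 0" "a [^] qa \<in> M" "\<forall>i. 0 < i \<longrightarrow> i < qa \<longrightarrow> a [^] i \<notin> M"
    using least_pow[OF HM aH] by blast
  obtain qb :: nat where qb: "qb > 0" "b [^] qb \<in> M" "\<forall>i. 0 < i \<longrightarrow> i < qb \<longrightarrow> b [^] i \<notin> M"
    using least_pow[OF HM bH] by blast
  \<comment> \<open>A factorial is divisible by all numbers up to its argument. As
    \<open>J < 2 ^ J \<le> p ^ J\<close>, the exponent \<open>S\<close> of the tower can be
    \<open>J\<close> itself.\<close>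
  define J :: nat where "J = fact (2 ^ (m + 2))"
  have J: "J > 0" "\<And>i. 0 < i \<Longrightarrow> i \<le> 2 ^ (m + 2) \<Longrightarrow> i dvd J"
    by (auto simp: J_def intro: dvd_fact)
  have "J < 2 ^ J" by (rule less_exp)
  also have "\<dots> \<le> p ^ J" using prime_ge_2_nat[OF prime] by (intro power_mono) auto
  finally have J': "int J < int (p ^ J)" by linarith
  obtain \<phi>a where \<phi>a: "cocycle G H M (int (p ^ J)) \<phi>a" "\<forall>g\<in>H. \<phi>a a g = (if g \<in> M then 1 else 0)"
    "openin T (cocycle.ker H M \<phi>a)"
    using fox_cocycle[OF HM ab(1) J(1)] by blast
  obtain \<phi>b where \<phi>b: "cocycle G H M (int (p ^ J)) \<phi>b" "\<forall>g\<in>H. \<phi>b b g = (if g \<in> M then 1 else 0)"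
    "openin T (cocycle.ker H M \<phi>b)"
    using fox_cocycle[OF HM ab(2) J(1)] by blast
  define N where "N = core (cocycle.ker H M \<phi>a \<inter> cocycle.ker H M \<phi>b)"
  have "subgroup (cocycle.ker H M \<phi>a \<inter> cocycle.ker H M \<phi>b) G"
    by (intro subgroups_Inter_pair cocycle.subgroup_ker[OF \<phi>a(1)] cocycle.subgroup_ker[OF \<phi>b(1)])
  then have N: "open_normal N" unfolding N_def by (rule open_normal_core) (intro openin_Int \<phi>a(3) \<phi>b(3))
  have Nsub: "N \<subseteq> cocycle.ker H M \<phi>a \<inter> cocycle.ker H M \<phi>b" unfolding N_def by (rule core_subset)
  have NM: "N \<subseteq> M" using Nsub unfolding cocycle.ker_def[OF \<phi>a(1)] by blast
  \<comment> \<open>Both kernels contain the commutators of \<open>M\<close>, and conjugates of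
    these are again commutators of \<open>M\<close>, so they lie in the core.\<close>
  have abelian: "x \<otimes> y \<otimes> inv x \<otimes> inv y \<in> N" if "x \<in> M" "y \<in> M" for x y
    unfolding N_def
    by (rule commutator_in_core[OF conjunct1[OF M] _ that])
       (intro IntI cocycle.commutator_in_ker[OF \<phi>a(1)] cocycle.commutator_in_ker[OF \<phi>b(1)])
  have HN: "H_normal N" using H_normal_if_open_normal[OF N] NM Msub M0(2) N0_H by blast
  obtain \<phi> where \<phi>: "cocycle G H N (int (p ^ 1)) \<phi>" "\<forall>g\<in>H. \<phi> b g = (if g \<in> N then 1 else 0)"
    "\<forall>c'\<in>B. c' \<noteq> b \<longrightarrow> (\<forall>g\<in>H. \<phi> c' g = 0)" "openin T (cocycle.ker H N \<phi>)"
    using fox_cocycle[OF HN ab(2) zero_less_one] by blast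
  define N' where "N' = core (cocycle.ker H N \<phi>)"
  have N': "open_normal N'" unfolding N'_def by (rule open_normal_core[OF cocycle.subgroup_ker[OF \<phi>(1)] \<phi>(4)])
  have N'sub: "N' \<subseteq> cocycle.ker H N \<phi>" unfolding N'_def by (rule core_subset)
  have "tower G T p H B a b M0 M N N' m J J qa qb \<phi>a \<phi>b \<phi>"
  proof (intro tower.intro tower_axioms.intro virtually_free_axioms ab M0 M N N' NM J J' \<phi>a(1) \<phi>b(1) N'sub
      qa(1,2) qb(1,2))
    show "cocycle G H N (int p) \<phi>" using \<phi>(1) by simp
    show "\<phi> a g = 0" if "g \<in> H" for g using \<phi>(3) ab that by blast
    show "M \<subseteq> M0" "N \<subseteq> cocycle.ker H M \<phi>a" "N \<subseteq> cocycle.ker H M \<phi>b" using Msub Nsub by auto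
    show "(\<forall>i::nat. inv (a [^] i) \<otimes> h \<notin> M) \<or> (\<forall>i::nat. inv (b [^] i) \<otimes> h \<notin> M)" if "h \<in> H" "h \<notin> M0" for h
      using that by (rule sep)
    show "a [^] i \<notin> M" if "0 < i" "i < qa" for i using qa(3) that by simp
    show "b [^] i \<notin> M" if "0 < i" "i < qb" for i using qb(3) that by simp
    show "\<phi>a a g = (if g \<in> M then 1 else 0)" "\<phi>b b g = (if g \<in> M then 1 else 0)"
      "\<phi> b g = (if g \<in> N then 1 else 0)" if "g \<in> H" for g
      using \<phi>a(2) \<phi>b(2) \<phi>(2) that by simp_all
    show "x \<otimes> y \<otimes> inv x \<otimes> inv y \<in> N" if "x \<in> M" "y \<in> M" for x y using that by (rule abelian)
  qed
  then interpret tw: tower G T p H B a b M0 M N N' m J J qa qb \<phi>a \<phi>b \<phi> .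
  show ?thesis
  proof (rule that[OF N N'])
    show "N \<subseteq> N1" using NM Msub by blast
    show "N' \<subseteq> N" using N'sub unfolding cocycle.ker_def[OF \<phi>(1)] by blast
    show "x \<otimes> y \<otimes> inv x \<otimes> inv y \<in> N'" if "x \<in> N" "y \<in> N" for x y
      unfolding N'_def by (rule commutator_in_core[OF conjunct1[OF N] cocycle.commutator_in_ker[OF \<phi>(1)] that])
  qed (rule tw.elimination)
qed

end

section \<open>Perturbation of words\<close>

lemma reduced_word_append: "reduced_word (v @ w) \<Longrightarrow> reduced_word v"
proof (induction v rule: reduced_word.induct)
  case (1 i b j c v)
  then show ?case by simp
qed auto

lemma reduced_word_Cons: "reduced_word (l # w) \<Longrightarrow> reduced_word w"
  by (cases l; cases w) auto

context group
begin

definition letter :: "(nat \<Rightarrow> 'a) \<Rightarrow> nat \<Rightarrow> bool \<Rightarrow> 'a" where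
  "letter x i e = (if e then x i else inv (x i))"

lemma eval_word_Nil [simp]: "eval_word G [] x = \<one>"
  and eval_word_Cons [simp]: "eval_word G ((i, e) # w) x = letter x i e \<otimes> eval_word G w x"
  by (simp_all add: eval_word_def letter_def)

lemma letter_closed: "x i \<in> carrier G \<Longrightarrow> letter x i e \<in> carrier G"
  by (simp add: letter_def)

lemma eval_word_closed:
  assumes "\<forall>i<r. x i \<in> carrier G" "word_in r w"
  shows "eval_word G w x \<in> carrier G"
  using assms(2)
proof (induction w)
  case (Cons l w)
  obtain i e where "l = (i, e)" by fastforce
  then show ?case using Cons assms(1) letter_closed[of x i] by (simp add: word_in_def)
qed simp

text \<open>The terms of the Fox derivative of a word, evaluated at \<open>y\<close>, for the generator \<open>x\<^sub>i\<close> if \<open>b\<close> and for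
  its inverse otherwise.\<close>
fun fox_terms :: "(nat \<Rightarrow> 'a) \<Rightarrow> nat \<Rightarrow> bool \<Rightarrow> (nat \<times> bool) list \<Rightarrow> ('a \<times> bool) list" where
  "fox_terms y i b [] = []"
| "fox_terms y i b ((j, c) # w) =
    (if j = i then if c = b then [(letter y i b, True)] else [(\<one>, False)] else []) @
    map (\<lambda>(t, e). (letter y j c \<otimes> t, e)) (fox_terms y i b w)"

lemma length_fox_terms: "length (fox_terms y i b w) \<le> length w"
  by (induction y i b w rule: fox_terms.induct) auto

text \<open>A letter equal to the distinguished one contributes the prefix that includes it, and an
  inverse letter the prefix before it, since the distinguished letter is perturbed on its right.
  With this convention the empty prefix arises only if the word starts with the inverse of the
  distinguished letter; for the tail of a reduced word beginning with that letter this cannot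
  happen.\<close>

lemma fox_terms_prefix:
  assumes y: "\<forall>i<r. y i \<in> carrier G" and "word_in r w" "(t, e) \<in> set (fox_terms y i b w)"
  shows "\<exists>k\<le>length w. t = eval_word G (take k w) y \<and> (k = 0 \<longrightarrow> hd w = (i, \<not> b))"
  using assms(2,3)
proof (induction w arbitrary: t)
  case (Cons l w)
  obtain j c where l: "l = (j, c)" by fastforce
  have j: "j < r" and w: "word_in r w" using Cons.prems(1) l by (auto simp: word_in_def)
  show ?case
  proof (cases "(t, e) \<in> (\<lambda>(t, e). (letter y j c \<otimes> t, e)) ` set (fox_terms y i b w)")
    case True
    then obtain t' where t': "t = letter y j c \<otimes> t'" "(t', e) \<in> set (fox_terms y i b w)" by auto
    then obtain k where "k \<le> length w" "t' = eval_word G (take k w) y" using Cons.IH[OF w] by blast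
    then show ?thesis using t' l by (intro exI[of _ "Suc k"]) simp
  next
    case False
    then have *: "j = i" "(t, e) = (if c = b then (letter y i b, True) else (\<one>, False))"
      using Cons.prems(2) l by (auto split: if_splits)
    show ?thesis
    proof (cases "c = b")
      case True
      then show ?thesis using * l j y letter_closed[of y j b] by (intro exI[of _ 1]) simp
    next
      case False
      then show ?thesis using * l by (intro exI[of _ 0]) auto
    qed
  qed
qed simp

lemma conj_prod_closed:
  assumes "n \<in> carrier G" "fst ` set ts \<subseteq> carrier G"
  shows "conj_prod ts n \<in> carrier G"
  using assms(2)
proof (induction ts)
  case (Cons te ts)
  then show ?case using assms(1) by (cases te) auto
qed simp

lemma conj_prod_append:
  assumes "n \<in> carrier G" "fst ` set (ts @ us) \<subseteq> carrier G"
  shows "conj_prod (ts @ us) n = conj_prod ts n \<otimes> conj_prod us n"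
  using assms(2)
proof (induction ts)
  case Nil
  then show ?case using conj_prod_closed[of n us] assms(1) by simp
next
  case (Cons te ts)
  obtain t e where te: "te = (t, e)" by fastforce
  have "conj_prod ts n \<in> carrier G" "conj_prod us n \<in> carrier G" "t \<in> carrier G"
    using Cons.prems te conj_prod_closed[OF assms(1)] by auto
  then show ?case using Cons te assms(1) by (simp add: m_assoc)
qed

lemma conj_prod_conj:
  assumes "n \<in> carrier G" "l \<in> carrier G" "fst ` set ts \<subseteq> carrier G"
  shows "conj_prod (map (\<lambda>(t, e). (l \<otimes> t, e)) ts) n = l \<otimes> conj_prod ts n \<otimes> inv l"
  using assms(3)
proof (induction ts)
  case (Cons te ts)
  obtain t e where te: "te = (t, e)" by fastforce
  then have "t \<in> carrier G" "conj_prod ts n \<in> carrier G" using Cons.prems conj_prod_closed assms(1) by auto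
  then show ?case using Cons te assms by (simp add: group_norm)
qed (use assms in simp)

lemma fox_terms_closed:
  assumes y: "\<forall>i<r. y i \<in> carrier G" and "word_in r w" "i < r"
  shows "fst ` set (fox_terms y i b w) \<subseteq> carrier G"
proof
  fix t assume "t \<in> fst ` set (fox_terms y i b w)"
  then obtain e where "(t, e) \<in> set (fox_terms y i b w)" by auto
  then obtain k where "t = eval_word G (take k w) y" using fox_terms_prefix[OF y assms(2)] by blast
  moreover have "word_in r (take k w)" using assms(2) set_take_subset[of k w] by (auto simp: word_in_def)
  ultimately show "t \<in> carrier G" using eval_word_closed[OF y] by simp
qed

text \<open>Moving the factors \<open>\<sigma>\<close> to the left turns each of them into a
  conjugate by a prefix evaluated at \<open>y'\<close>. The prefixes at \<open>y\<close> and
  \<open>y'\<close> differ by elements of \<open>N\<close>, and \<open>N\<close> is commutative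
  modulo \<open>N'\<close>, so the conjugates may be computed at the fixed point \<open>y\<close>
  although \<open>y'\<close> will depend on \<open>n\<close>.\<close>

lemma eval_word_perturb:
  assumes N: "N \<lhd> G" and N': "N' \<lhd> G" "N' \<subseteq> N"
    and comm: "\<And>x y. x \<in> N \<Longrightarrow> y \<in> N \<Longrightarrow> x \<otimes> y \<otimes> inv x \<otimes> inv y \<in> N'"
    and yA: "\<forall>j<r. y j \<in> carrier G" and yA': "\<forall>j<r. y' j \<in> carrier G"
    and x': "\<And>j. j < r \<Longrightarrow> j \<noteq> i \<Longrightarrow> x' j = y' j"
    and close: "\<And>j. j < r \<Longrightarrow> y' j \<otimes> inv (y j) \<in> N"
    and i: "i < r" "x' i \<in> carrier G" "letter x' i b = letter y' i b \<otimes> \<sigma>"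
    and \<sigma>: "\<sigma> \<in> N" "\<sigma> \<otimes> inv n \<in> N'" "n \<in> N" and w: "word_in r w"
  shows "eval_word G w x' \<otimes> inv (conj_prod (fox_terms y i b w) n \<otimes> eval_word G w y') \<in> N'"
proof -
  have y: "y j \<in> carrier G" and y': "y' j \<in> carrier G" if "j < r" for j using yA yA' that by auto
  let ?Q = "G Mod N'" and ?\<pi> = "\<lambda>x. N' #> x"
  interpret Q: group ?Q using N'(1) by (rule normal.factorgroup_is_group)
  interpret \<pi>: group_hom G ?Q ?\<pi>
    using normal.r_coset_hom_Mod[OF N'(1)] is_group Q.is_group by (simp add: group_hom_def group_hom_axioms_def)
  have eq: "?\<pi> x = ?\<pi> y \<longleftrightarrow> x \<otimes> inv y \<in> N'" if "x \<in> carrier G" "y \<in> carrier G" for x y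
    using coset_eq_iff[OF N'(1) that] .
  note sN = normal_imp_subgroup[OF N]
  have NG [simp]: "x \<in> carrier G" if "x \<in> N" for x using subgroup.mem_carrier[OF sN that] .
  have conj: "?\<pi> (x \<otimes> c \<otimes> inv x) = ?\<pi> (z \<otimes> c \<otimes> inv z)"
    if G: "x \<in> carrier G" "z \<in> carrier G" and xz: "x \<otimes> inv z \<in> N" and c: "c \<in> N" for x z c
  proof -
    have zc: "z \<otimes> c \<otimes> inv z \<in> N" using normal.inv_op_closed2[OF N G(2) c] .
    from comm[OF xz zc] have "(x \<otimes> c \<otimes> inv x) \<otimes> inv (z \<otimes> c \<otimes> inv z) \<in> N'"
      using G c by (simp add: group_norm)
    then show ?thesis using eq[of "x \<otimes> c \<otimes> inv x" "z \<otimes> c \<otimes> inv z"] G c by simp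
  qed
  have lc: "letter y' j e \<otimes> inv (letter y j e) \<in> N" if j: "j < r" for j e
  proof (cases e)
    case False
    have "inv (y' j) \<otimes> (y' j \<otimes> inv (y j)) \<otimes> inv (inv (y' j)) \<in> N"
      using normal.inv_op_closed2[OF N _ close[OF j]] y'[OF j] by blast
    then have "inv (inv (y j) \<otimes> y' j) \<in> N"
      using subgroup.m_inv_closed[OF sN] y'[OF j] y[OF j] by (simp add: cancel_inv_left)
    then show ?thesis using False y[OF j] y'[OF j] by (simp add: letter_def inv_mult_group)
  qed (use close[OF j] in \<open>simp add: letter_def\<close>)
  have ly: "letter y j e \<in> carrier G" "letter y' j e \<in> carrier G" if "j < r" for j e
    using letter_closed[of y j e] letter_closed[of y' j e] y y' that by auto
  have xG: "\<forall>j<r. x' j \<in> carrier G"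
  proof (intro allI impI)
    fix j assume "j < r"
    then show "x' j \<in> carrier G" using x'[of j] y'[of j] i(2) by (cases "j = i") auto
  qed
  have \<pi>\<sigma>: "?\<pi> \<sigma> = ?\<pi> n" using eq[of \<sigma> n] \<sigma> by simp
  have "?\<pi> (eval_word G w x') = ?\<pi> (conj_prod (fox_terms y i b w) n \<otimes> eval_word G w y')"
    using w
  proof (induction w)
    case (Cons l w)
    obtain j c where l: "l = (j, c)" by fastforce
    have j: "j < r" and w: "word_in r w" using Cons.prems(1) l by (auto simp: word_in_def)
    let ?C = "conj_prod (fox_terms y i b w) n" and ?l = "letter y j c" and ?l' = "letter y' j c" and ?lx = "letter x' j c"
    let ?hd = "if j = i then if c = b then [(letter y i b, True)] else [(\<one>, False)] else []"
    have tG: "fst ` set (fox_terms y i b w) \<subseteq> carrier G" using fox_terms_closed[OF yA w i(1)] .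
    have CN: "?C \<in> N" using conj_prod_in_normal[OF N \<sigma>(3) tG] .
    have eG: "eval_word G w y' \<in> carrier G" "eval_word G w x' \<in> carrier G"
      using eval_word_closed[OF yA' w] eval_word_closed[OF xG w] by simp_all
    have hdG: "fst ` set ?hd \<subseteq> carrier G" using ly[OF i(1)] by auto
    have hdC: "conj_prod ?hd n \<in> carrier G" using conj_prod_closed[OF NG[OF \<sigma>(3)] hdG] .
    have lxG: "?lx \<in> carrier G" using letter_closed[of x' j c] xG j by blast
    have hd: "?\<pi> ?lx = ?\<pi> (conj_prod ?hd n \<otimes> ?l')"
    proof (cases "j = i")
      case True
      show ?thesis
      proof (cases "c = b")
        case same: True
        let ?z = "letter y i b" and ?z' = "letter y' i b"
        have "?\<pi> ?lx = ?\<pi> ((?z' \<otimes> \<sigma> \<otimes> inv ?z') \<otimes> ?z')"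
          using True same i ly[OF i(1)] \<sigma> by (simp add: group_norm)
        also have "\<dots> = ?\<pi> (?z' \<otimes> \<sigma> \<otimes> inv ?z') \<otimes>\<^bsub>?Q\<^esub> ?\<pi> ?z'"
          using ly[OF i(1)] \<sigma> by (intro \<pi>.hom_mult) auto
        also have "?\<pi> (?z' \<otimes> \<sigma> \<otimes> inv ?z') = ?\<pi> (?z \<otimes> \<sigma> \<otimes> inv ?z)"
          using ly[OF i(1)] lc[OF i(1)] \<sigma>(1) by (intro conj)
        also have "\<dots> = ?\<pi> (?z \<otimes> n \<otimes> inv ?z)"
          using ly[OF i(1)] \<sigma> \<pi>\<sigma> by simp
        also have "\<dots> \<otimes>\<^bsub>?Q\<^esub> ?\<pi> ?z' = ?\<pi> ((?z \<otimes> n \<otimes> inv ?z) \<otimes> ?z')"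
          using ly[OF i(1)] \<sigma> by (intro \<pi>.hom_mult[symmetric]) auto
        finally show ?thesis using True same ly[OF i(1)] \<sigma> by simp
      next
        case opp: False
        have "?lx = inv (letter x' i b)" "?l' = inv (letter y' i b)"
          using True opp i(1,2) y'[OF i(1)] by (auto simp: letter_def)
        then have "?lx = inv \<sigma> \<otimes> ?l'" using i(3) ly[OF i(1)] \<sigma> by (simp add: inv_mult_group)
        then have "?\<pi> ?lx = ?\<pi> (inv n \<otimes> ?l')" using \<pi>\<sigma> \<sigma> ly[OF j] by simp
        then show ?thesis using True opp \<sigma> by simp
      qed
    next
      case False
      then show ?thesis using x'[OF j] ly[OF j] by (simp add: letter_def)
    qed
    have "?\<pi> (eval_word G (l # w) x') = ?\<pi> ?lx \<otimes>\<^bsub>?Q\<^esub> ?\<pi> (eval_word G w x')"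
      using l lxG eG by simp
    also have "\<dots> = ?\<pi> (conj_prod ?hd n \<otimes> ?l') \<otimes>\<^bsub>?Q\<^esub> ?\<pi> (?C \<otimes> eval_word G w y')"
      unfolding hd using Cons.IH[OF w] by simp
    also have "\<dots> = ?\<pi> (conj_prod ?hd n \<otimes> (?l' \<otimes> ?C \<otimes> inv ?l') \<otimes> (?l' \<otimes> eval_word G w y'))"
    proof -
      have "conj_prod ?hd n \<otimes> ?l' \<otimes> (?C \<otimes> eval_word G w y') =
        conj_prod ?hd n \<otimes> (?l' \<otimes> ?C \<otimes> inv ?l') \<otimes> (?l' \<otimes> eval_word G w y')"
        using hdC ly[OF j, of c] NG[OF CN] eG by (simp add: m_assoc cancel_inv_left)
      then show ?thesis using \<pi>.hom_mult[of "conj_prod ?hd n \<otimes> ?l'" "?C \<otimes> eval_word G w y'"] hdC ly[OF j, of c] NG[OF CN] eG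
        by (metis m_closed)
    qed
    also have "\<dots> = ?\<pi> (conj_prod ?hd n) \<otimes>\<^bsub>?Q\<^esub> ?\<pi> (?l' \<otimes> ?C \<otimes> inv ?l') \<otimes>\<^bsub>?Q\<^esub> ?\<pi> (?l' \<otimes> eval_word G w y')"
      using hdC ly[OF j, of c] NG[OF CN] eG by (metis \<pi>.hom_mult inv_closed m_closed)
    also have "?\<pi> (?l' \<otimes> ?C \<otimes> inv ?l') = ?\<pi> (?l \<otimes> ?C \<otimes> inv ?l)"
      using ly[OF j] lc[OF j] CN by (intro conj)
    also have "?\<pi> (conj_prod ?hd n) \<otimes>\<^bsub>?Q\<^esub> ?\<pi> (?l \<otimes> ?C \<otimes> inv ?l) \<otimes>\<^bsub>?Q\<^esub> ?\<pi> (?l' \<otimes> eval_word G w y') =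
        ?\<pi> (conj_prod ?hd n \<otimes> (?l \<otimes> ?C \<otimes> inv ?l) \<otimes> (?l' \<otimes> eval_word G w y'))"
      using hdC ly[OF j, of c] NG[OF CN] eG by (metis \<pi>.hom_mult inv_closed m_closed)
    also have "conj_prod ?hd n \<otimes> (?l \<otimes> ?C \<otimes> inv ?l) = conj_prod (fox_terms y i b (l # w)) n"
    proof -
      have "fst ` set (map (\<lambda>(t, e). (?l \<otimes> t, e)) (fox_terms y i b w)) \<subseteq> carrier G"
        using tG ly[OF j, of c] by fastforce
      then have "conj_prod (?hd @ map (\<lambda>(t, e). (?l \<otimes> t, e)) (fox_terms y i b w)) n =
        conj_prod ?hd n \<otimes> conj_prod (map (\<lambda>(t, e). (?l \<otimes> t, e)) (fox_terms y i b w)) n"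
        using hdG \<sigma>(3) by (intro conj_prod_append) auto
      also have "conj_prod (map (\<lambda>(t, e). (?l \<otimes> t, e)) (fox_terms y i b w)) n = ?l \<otimes> ?C \<otimes> inv ?l"
        using tG ly[OF j, of c] \<sigma>(3) by (intro conj_prod_conj) auto
      finally show ?thesis unfolding l fox_terms.simps by (rule sym)
    qed
    finally show ?case using l by simp
  qed simp
  moreover have "conj_prod (fox_terms y i b w) n \<in> carrier G"
    using conj_prod_closed[OF NG[OF \<sigma>(3)] fox_terms_closed[OF yA w i(1)]] .
  ultimately show ?thesis
    using eq[of "eval_word G w x'" "conj_prod (fox_terms y i b w) n \<otimes> eval_word G w y'"]
      eval_word_closed[OF yA' w] eval_word_closed[OF xG w] by simp
qed

end

section \<open>Random freeness\<close>

context virtually_free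
begin

lemma K_normal: "K \<lhd> G"
proof (rule normal_invI)
  have N0G: "x \<in> carrier G" if "x \<in> N0" for x using that N0_H subgroup.mem_carrier[OF H(1)] by blast
  show "subgroup K G"
  proof
    fix x y assume xy: "x \<in> K" "y \<in> K"
    have "x \<otimes> y \<otimes> c = c \<otimes> (x \<otimes> y)" if c: "c \<in> N0" for c
    proof -
      have G: "x \<in> carrier G" "y \<in> carrier G" "c \<in> carrier G" using xy c N0G by (auto simp: K_def)
      have e: "x \<otimes> c = c \<otimes> x" "y \<otimes> c = c \<otimes> y" using xy c by (auto simp: K_def)
      have "x \<otimes> y \<otimes> c = x \<otimes> (y \<otimes> c)" using G by (simp add: m_assoc)
      also have "\<dots> = (x \<otimes> c) \<otimes> y" unfolding e(2) using G by (simp add: m_assoc)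
      also have "\<dots> = c \<otimes> (x \<otimes> y)" unfolding e(1) using G by (simp add: m_assoc)
      finally show ?thesis .
    qed
    then show "x \<otimes> y \<in> K" using xy by (auto simp: K_def)
  next
    fix x assume x: "x \<in> K"
    have "inv x \<otimes> c = c \<otimes> inv x" if c: "c \<in> N0" for c
    proof -
      have G: "x \<in> carrier G" "c \<in> carrier G" using x c N0G by (auto simp: K_def)
      have e: "x \<otimes> c = c \<otimes> x" using x c by (auto simp: K_def)
      have "inv x \<otimes> c = inv x \<otimes> (c \<otimes> x) \<otimes> inv x" using G by (simp add: m_assoc)
      also have "\<dots> = c \<otimes> inv x" unfolding e[symmetric] using G by (simp add: cancel_inv_left)
      finally show ?thesis .
    qed
    then show "inv x \<in> K" using x by (auto simp: K_def)
  qed (auto simp: K_def N0G)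
  fix g x assume g: "g \<in> carrier G" and x: "x \<in> K"
  have xG: "x \<in> carrier G" using x by (simp add: K_def)
  have "g \<otimes> x \<otimes> inv g \<otimes> c = c \<otimes> (g \<otimes> x \<otimes> inv g)" if c: "c \<in> N0" for c
  proof -
    have cG: "c \<in> carrier G" using N0G c .
    let ?d = "inv g \<otimes> c \<otimes> g"
    have "?d \<in> N0" using normal.inv_op_closed1[OF conjunct1[OF open_normal_N0] g c] .
    then have e: "x \<otimes> ?d = ?d \<otimes> x" using x by (auto simp: K_def)
    have "g \<otimes> x \<otimes> inv g \<otimes> c = g \<otimes> (x \<otimes> ?d) \<otimes> inv g" using g xG cG by (simp add: group_norm)
    also have "\<dots> = c \<otimes> (g \<otimes> x \<otimes> inv g)" unfolding e using g xG cG by (simp add: group_norm)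
    finally show ?thesis .
  qed
  then show "g \<otimes> x \<otimes> inv g \<in> K" using g xG by (auto simp: K_def)
qed

lemma N0_carrier: "x \<in> N0 \<Longrightarrow> x \<in> carrier G"
  using N0_H subgroup.mem_carrier[OF H(1)] by blast

lemma K_closed: "closedin T K"
proof -
  have "closedin T (\<Inter>c\<in>N0. {g \<in> topspace T. g \<otimes> c = c \<otimes> g})"
  proof (intro closedin_INT)
    show "N0 \<noteq> {}" using open_normal_N0 normal_imp_subgroup subgroup.one_closed by blast
    fix c assume c: "c \<in> N0"
    show "closedin T {g \<in> topspace T. g \<otimes> c = c \<otimes> g}"
      using N0_carrier[OF c]
      by (intro closedin_continuous_maps_eq[OF Hausdorff] continuous_map_mult) auto
  qed
  moreover have "\<dots> = K"
  proof -
    have "\<one> \<in> N0" using subgroup.one_closed[OF normal_imp_subgroup[OF conjunct1[OF open_normal_N0]]] .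
    then show ?thesis by (auto simp: K_def)
  qed
  ultimately show ?thesis by simp
qed

lemma K_mod_mult:
  assumes M: "open_normal M" and g: "g \<in> K_mod M" and m: "m \<in> M"
  shows "g \<otimes> m \<in> K_mod M"
proof -
  note nM = conjunct1[OF M]
  note sM = normal_imp_subgroup[OF nM]
  have G: "g \<in> carrier G" "m \<in> carrier G" using g subgroup.mem_carrier[OF sM m] by (auto simp: K_mod_def)
  have "g \<otimes> m \<otimes> c \<otimes> inv (g \<otimes> m) \<otimes> inv c \<in> M" if c: "c \<in> N0" for c
  proof -
    have cG: "c \<in> carrier G" using N0_carrier c .
    have 1: "g \<otimes> c \<otimes> inv g \<otimes> inv c \<in> M" using g c by (auto simp: K_mod_def)
    have "c \<otimes> inv m \<otimes> inv c \<in> M" using normal.inv_op_closed2[OF nM cG] subgroup.m_inv_closed[OF sM m] by blast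
    then have "m \<otimes> (c \<otimes> inv m \<otimes> inv c) \<in> M" using subgroup.m_closed[OF sM m] by blast
    then have "g \<otimes> (m \<otimes> (c \<otimes> inv m \<otimes> inv c)) \<otimes> inv g \<in> M" by (rule normal.inv_op_closed2[OF nM G(1)])
    from subgroup.m_closed[OF sM this 1] show ?thesis using G cG by (simp add: group_norm)
  qed
  then show ?thesis using G by (simp add: K_mod_def)
qed

lemma K_mod_clopen: "open_normal M \<Longrightarrow> openin T (K_mod M) \<and> closedin T (K_mod M)"
  using openin_union_of_cosets[of M "K_mod M"] closedin_union_of_cosets[of M "K_mod M"] K_mod_mult[of M]
    normal_imp_subgroup[of M G] by (auto simp: K_mod_def)

lemma K_mod_mono: "M \<subseteq> M' \<Longrightarrow> K_mod M \<subseteq> K_mod M'"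
  by (auto simp: K_mod_def)

text \<open>Some commutator of \<open>g\<close> with an element of \<open>N0\<close> is nontrivial,
  and an open normal subgroup avoids it.\<close>

lemma not_in_K:
  assumes "g \<in> carrier G" "g \<notin> K"
  shows "\<exists>M. open_normal M \<and> g \<notin> K_mod M"
proof -
  obtain c where c: "c \<in> N0" "g \<otimes> c \<noteq> c \<otimes> g" using assms by (auto simp: K_def)
  have cG: "c \<in> carrier G" using N0_carrier c(1) .
  have "g \<otimes> c \<otimes> inv g \<otimes> inv c \<noteq> \<one>"
  proof
    assume "g \<otimes> c \<otimes> inv g \<otimes> inv c = \<one>"
    then have "(g \<otimes> c \<otimes> inv g \<otimes> inv c) \<otimes> (c \<otimes> g) = \<one> \<otimes> (c \<otimes> g)" by simp
    then show False using c(2) assms(1) cG by (simp add: group_norm)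
  qed
  then obtain M where "open_normal M" "g \<otimes> c \<otimes> inv g \<otimes> inv c \<notin> M"
    using open_normal_avoiding[of "g \<otimes> c \<otimes> inv g \<otimes> inv c"] assms(1) cG by auto
  then show ?thesis using c(1) by (auto simp: K_mod_def)
qed

end

context haar_power
begin

lemma continuous_map_eval_word: "word_in r w \<Longrightarrow> continuous_map PT T (eval_word G w)"
proof (induction w)
  case Nil
  then show ?case by (simp add: eval_word_def[abs_def])
next
  case (Cons l w)
  obtain i e where l: "l = (i, e)" by fastforce
  have "i < r" "word_in r w" using Cons.prems l by (auto simp: word_in_def)
  then have "continuous_map PT T (\<lambda>x. (if e then x i else inv (x i)) \<otimes> eval_word G w x)"
    using Cons.IH continuous_map_coordinate[of i r] continuous_map_inv[OF continuous_map_coordinate[of i r]]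
    by (cases e) (auto intro!: continuous_map_mult)
  then show ?case by (simp add: l eval_word_def[abs_def])
qed

end

lemma (in virtually_free) randomly_free_if_two_generators:
  assumes ab: "a \<in> B" "b \<in> B" "a \<noteq> b"
  shows "randomly_free G T"
  unfolding randomly_free_def
proof
  assume "\<exists>r w. probabilistic_identity G T r w"
  then obtain r w0 \<mu> where w0: "nontrivial_word r w0" and haar: "haar_measure_power G T r \<mu>"
    and pos0: "emeasure \<mu> {g \<in> topspace (power_top T r). eval_word G w0 g = \<one>} > 0"
    unfolding probabilistic_identity_def by blast
  interpret \<mu>: haar_power G T r \<mu> by unfold_locales (rule haar)
  let ?PT = "power_top T r"
  define Z where "Z v = {x \<in> topspace ?PT. eval_word G v x \<in> K}" for v
  have Zc: "closedin ?PT (Z v)" if "word_in r v" for v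
    unfolding Z_def by (rule closedin_continuous_map_preimage[OF \<mu>.continuous_map_eval_word[OF that] K_closed])
  define good where "good v \<longleftrightarrow> nontrivial_word r v \<and> measure \<mu> (Z v) > 0" for v
  have "good w0"
  proof -
    have wr: "word_in r w0" using w0 by (simp add: nontrivial_word_def)
    have "\<one> \<in> K" using subgroup.one_closed[OF normal_imp_subgroup[OF K_normal]] .
    then have "emeasure \<mu> {g \<in> topspace ?PT. eval_word G w0 g = \<one>} \<le> emeasure \<mu> (Z w0)"
      using \<mu>.closed_sets[OF Zc[OF wr]] by (intro emeasure_mono) (auto simp: Z_def)
    then have "emeasure \<mu> (Z w0) > 0" using pos0 by order
    then show ?thesis using w0 by (simp add: good_def \<mu>.emeasure_eq_measure)
  qed
  then obtain w where w: "good w" and min: "\<And>v. good v \<Longrightarrow> length w \<le> length v"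
    using ex_has_least_nat[of good w0 length] by blast
  have nw: "word_in r w" "reduced_word w" "w \<noteq> []" and posw: "measure \<mu> (Z w) > 0"
    using w by (auto simp: good_def nontrivial_word_def)
  obtain i b' u where wu: "w = (i, b') # u" using nw(3) by (cases w) auto
  have i: "i < r" and ur: "word_in r u" using nw(1) wu by (auto simp: word_in_def)
  have ured: "reduced_word u" using nw(2) wu reduced_word_Cons by blast
  \<comment> \<open>The nonempty prefixes of the tail, including the tail itself. They are shorter
    than \<open>w\<close>, so by minimality each takes values in \<open>K\<close> only on a null
    set.\<close>
  define V where "V = (\<lambda>k. take k u) ` {1..length u}"
  have Vfin: "finite V" by (simp add: V_def)
  have Vr: "word_in r v" if "v \<in> V" for v
    using that ur set_take_subset[of _ u] by (auto simp: V_def word_in_def)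
  have Vnull: "measure \<mu> (Z v) = 0" if v: "v \<in> V" for v
  proof -
    obtain k where k: "1 \<le> k" "k \<le> length u" "v = take k u" using v by (auto simp: V_def)
    have "v \<noteq> []" using k by (cases u) auto
    moreover have "reduced_word v"
      using reduced_word_append[of "take k u" "drop k u"] ured k(3) by simp
    ultimately have "nontrivial_word r v" using Vr[OF v] by (simp add: nontrivial_word_def)
    moreover have "\<not> good v" using min[of v] k wu by auto
    ultimately have "\<not> measure \<mu> (Z v) > 0" by (simp add: good_def)
    then show ?thesis using measure_nonneg[of \<mu> "Z v"] by linarith
  qed
  define F where "F M = {x \<in> topspace ?PT. \<forall>v\<in>V. eval_word G v x \<notin> K_mod M}" for M
  have Fclopen: "openin ?PT (F M) \<and> closedin ?PT (F M)" if M: "open_normal M" for M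
  proof -
    have e: "{x \<in> topspace ?PT. eval_word G v x \<in> carrier G - K_mod M} = {x \<in> topspace ?PT. eval_word G v x \<notin> K_mod M}"
      if "v \<in> V" for v
      using continuous_map_image_subset_topspace[OF \<mu>.continuous_map_eval_word[OF Vr[OF that]]] by auto
    have "openin T (carrier G - K_mod M)" "closedin T (carrier G - K_mod M)"
      using K_mod_clopen[OF M] openin_diff[OF openin_topspace, of T "K_mod M"]
        closedin_diff[OF closedin_topspace, of T "K_mod M"] by simp_all
    then have "openin ?PT {x \<in> topspace ?PT. eval_word G v x \<notin> K_mod M} \<and>
        closedin ?PT {x \<in> topspace ?PT. eval_word G v x \<notin> K_mod M}" if "v \<in> V" for v
      unfolding e[OF that, symmetric]
      using openin_continuous_map_preimage[OF \<mu>.continuous_map_eval_word[OF Vr[OF that]]]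
        closedin_continuous_map_preimage[OF \<mu>.continuous_map_eval_word[OF Vr[OF that]]] by blast
    then have "openin ?PT (topspace ?PT \<inter> (\<Inter>v\<in>V. {x \<in> topspace ?PT. eval_word G v x \<notin> K_mod M}))"
      "closedin ?PT (topspace ?PT \<inter> (\<Inter>v\<in>V. {x \<in> topspace ?PT. eval_word G v x \<notin> K_mod M}))"
      using Vfin by (cases "V = {}"; auto intro!: openin_Int openin_INT closedin_Int closedin_INT)+
    moreover have "topspace ?PT \<inter> (\<Inter>v\<in>V. {x \<in> topspace ?PT. eval_word G v x \<notin> K_mod M}) = F M"
      by (auto simp: F_def)
    ultimately show ?thesis by simp
  qed
  have anti: "F M \<subseteq> F N" if "N \<subseteq> M" for M N using K_mod_mono[OF that] by (auto simp: F_def)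
  \<comment> \<open>The sets \<open>F M\<close> grow to a set of measure 1, so one of them has
    measure above 1 minus that of \<open>Z w\<close> and must meet \<open>Z w\<close> in positive
    measure.\<close>
  obtain M1 where M1: "open_normal M1"
      "measure \<mu> (\<Union>N\<in>{N. open_normal N}. F N) < measure \<mu> (F M1) + measure \<mu> (Z w)"
    using \<mu>.measure_directed_union[of F "measure \<mu> (Z w)"] Fclopen anti posw by blast
  have "measure \<mu> (\<Union>N\<in>{N. open_normal N}. F N) = 1"
  proof -
    have null: "measure \<mu> (\<Union>v\<in>V. Z v) = 0"
    proof -
      have "measure \<mu> (\<Union>v\<in>V. Z v) \<le> (\<Sum>v\<in>V. measure \<mu> (Z v))"
        using \<mu>.closed_sets[OF Zc[OF Vr]] by (intro measure_UNION_le Vfin) auto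
      also have "\<dots> = 0" using Vnull by simp
      finally show ?thesis using measure_nonneg[of \<mu> "\<Union>v\<in>V. Z v"] by linarith
    qed
    have "space \<mu> - (\<Union>v\<in>V. Z v) \<subseteq> (\<Union>N\<in>{N. open_normal N}. F N)"
    proof
      fix x assume x: "x \<in> space \<mu> - (\<Union>v\<in>V. Z v)"
      then have xP: "x \<in> topspace ?PT" using \<mu>.space_eq by simp
      have "\<exists>M. open_normal M \<and> eval_word G v x \<notin> K_mod M" if "v \<in> V" for v
      proof -
        have "eval_word G v x \<in> carrier G"
          using continuous_map_image_subset_topspace[OF \<mu>.continuous_map_eval_word[OF Vr[OF that]]] xP by auto
        moreover have "eval_word G v x \<notin> K" using x xP that by (auto simp: Z_def)
        ultimately show ?thesis using not_in_K by blast
      qed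
      then obtain Mv where Mv: "\<And>v. v \<in> V \<Longrightarrow> open_normal (Mv v)" "\<And>v. v \<in> V \<Longrightarrow> eval_word G v x \<notin> K_mod (Mv v)"
        by metis
      have "\<exists>N. open_normal N \<and> (\<forall>v\<in>V. N \<subseteq> Mv v)" using Mv(1) by (intro open_normal_finite_Int[OF Vfin]) blast
      then obtain N where N: "open_normal N" "\<And>v. v \<in> V \<Longrightarrow> N \<subseteq> Mv v" by blast
      have "x \<in> F N" using xP Mv(2) K_mod_mono[OF N(2)] by (auto simp: F_def)
      then show "x \<in> (\<Union>N\<in>{N. open_normal N}. F N)" using N(1) by blast
    qed
    moreover have Us: "(\<Union>N\<in>{N. open_normal N}. F N) \<in> sets \<mu>" using Fclopen by (intro \<mu>.open_sets) blast
    ultimately have "measure \<mu> (space \<mu> - (\<Union>v\<in>V. Z v)) \<le> measure \<mu> (\<Union>N\<in>{N. open_normal N}. F N)"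
      by (rule \<mu>.finite_measure_mono)
    moreover have "measure \<mu> (space \<mu> - (\<Union>v\<in>V. Z v)) = 1"
      using \<mu>.prob_compl[of "\<Union>v\<in>V. Z v"] null \<mu>.closed_sets[OF Zc[OF Vr]] Vfin by (simp add: sets.finite_UN)
    ultimately show ?thesis using \<mu>.prob_le_1[of "\<Union>N\<in>{N. open_normal N}. F N"] by linarith
  qed
  with M1(2) have sum1: "1 < measure \<mu> (F M1) + measure \<mu> (Z w)" by simp
  \<comment> \<open>The tower needs \<open>M0 \<subseteq> N0\<close>; shrinking \<open>M1\<close>
    only enlarges \<open>F\<close>.\<close>
  define M0 where "M0 = M1 \<inter> N0"
  have M0: "open_normal M0" "M0 \<subseteq> N0" using open_normal_Int[OF M1(1) open_normal_N0] by (auto simp: M0_def)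
  have F0s: "F M0 \<in> sets \<mu>" "F M1 \<in> sets \<mu>" using \<mu>.open_sets Fclopen M0(1) M1(1) by blast+
  have Zs: "Z w \<in> sets \<mu>" using \<mu>.closed_sets[OF Zc[OF nw(1)]] .
  have "measure \<mu> (F M1) \<le> measure \<mu> (F M0)"
    using anti[of M0 M1] F0s by (intro \<mu>.finite_measure_mono) (auto simp: M0_def)
  then have sum0: "1 < measure \<mu> (F M0) + measure \<mu> (Z w)" using sum1 by linarith
  define Y where "Y = Z w \<inter> F M0"
  have Yc: "closedin ?PT Y" unfolding Y_def using Zc[OF nw(1)] Fclopen[OF M0(1)] by (intro closedin_Int) auto
  have "measure \<mu> (Z w \<union> F M0) = measure \<mu> (Z w) + measure \<mu> (F M0) - measure \<mu> (Z w \<inter> F M0)"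
    using Zs F0s by (intro measure_Un3) (auto simp: fmeasurable_def \<mu>.emeasure_eq_measure)
  then have posY: "measure \<mu> Y > 0" using sum0 \<mu>.prob_le_1[of "Z w \<union> F M0"] by (simp add: Y_def)
  show False
  proof (rule \<mu>.dense_coset[OF finite_cosets Yc posY])
    fix N1 assume N1: "open_normal N1"
      "\<And>N. open_normal N \<Longrightarrow> N \<subseteq> N1 \<Longrightarrow> \<exists>y\<in>Y. \<forall>g \<in> {..<r} \<rightarrow>\<^sub>E N.
        \<exists>y'\<in>Y. close r N y' y \<and> \<mu>.left_translate g y' \<in> Y"
    show False
    proof (rule conj_prod_notin_K[OF ab M0 N1(1), of "length u"])
      fix N N' assume N: "open_normal N" "open_normal N'" "N \<subseteq> N1" "N' \<subseteq> N"
        "\<And>x y. x \<in> N \<Longrightarrow> y \<in> N \<Longrightarrow> x \<otimes> y \<otimes> inv x \<otimes> inv y \<in> N'"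
        "\<And>ts. length ts \<le> length u \<Longrightarrow> (\<And>t e. (t, e) \<in> set ts \<Longrightarrow> t \<in> carrier G \<and> t \<notin> K_mod M0) \<Longrightarrow>
          \<exists>n\<in>N. \<forall>\<kappa>\<in>K. \<forall>n'\<in>N'. conj_prod ((\<one>, True) # ts) n \<noteq> \<kappa> \<otimes> n'"
      note nN = conjunct1[OF N(1)] and nN' = conjunct1[OF N(2)]
      note sN = normal_imp_subgroup[OF nN] and sN' = normal_imp_subgroup[OF nN']
      obtain y where y: "y \<in> Y" and dense: "\<And>g. g \<in> {..<r} \<rightarrow>\<^sub>E N \<Longrightarrow>
          \<exists>y'\<in>Y. close r N y' y \<and> \<mu>.left_translate g y' \<in> Y"
        using N1(2)[OF N(1,3)] by blast
      have YG: "\<forall>j<r. x j \<in> carrier G" if "x \<in> Y" for x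
        using that in_power_carrier[of x r] by (auto simp: Y_def Z_def)
      note yG = YG[OF y]
      define ts where "ts = fox_terms y i b' u"
      have ts: "t \<in> carrier G \<and> t \<notin> K_mod M0" if t: "(t, e) \<in> set ts" for t e
      proof -
        obtain k where k: "k \<le> length u" "t = eval_word G (take k u) y" "k = 0 \<longrightarrow> hd u = (i, \<not> b')"
          using fox_terms_prefix[OF yG ur t[unfolded ts_def]] by blast
        have "u \<noteq> []" using t by (auto simp: ts_def)
        \<comment> \<open>An empty prefix would make \<open>u\<close> start with the inverse of the
          first letter of \<open>w\<close>, contrary to reducedness.\<close>
        then have "k \<noteq> 0" using k(3) nw(2) wu by (cases u) auto
        then have v: "take k u \<in> V" using k(1) by (auto simp: V_def)
        then show ?thesis using y k(2) eval_word_closed[OF yG Vr[OF v]] by (auto simp: Y_def F_def)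
      qed
      have "length ts \<le> length u" unfolding ts_def by (rule length_fox_terms)
      then have "\<exists>n\<in>N. \<forall>\<kappa>\<in>K. \<forall>n'\<in>N'. conj_prod ((\<one>, True) # ts) n \<noteq> \<kappa> \<otimes> n'"
        using ts by (rule N(6))
      then obtain n where n: "n \<in> N" "\<forall>\<kappa>\<in>K. \<forall>n'\<in>N'. conj_prod ((\<one>, True) # ts) n \<noteq> \<kappa> \<otimes> n'"
        by blast
      have nG: "n \<in> carrier G" using subgroup.mem_carrier[OF sN n(1)] .
      have yi: "y i \<in> carrier G" using yG i by blast
      \<comment> \<open>The letter should change by \<open>n\<close> on its right, while translation
        acts on the left of the generator. For an inverse letter \<open>inv n\<close> achieves this
        exactly. Otherwise one would conjugate by the value at \<open>y'\<close>, which is not yet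
        known; with \<open>y\<close> in its place the letter changes by some \<open>\<sigma>\<close>
        that differs from \<open>n\<close> by a commutator of elements of \<open>N\<close>, hence by
        an element of \<open>N'\<close>.\<close>
      define gi where "gi = (if b' then y i \<otimes> n \<otimes> inv (y i) else inv n)"
      have gi: "gi \<in> N"
        using normal.inv_op_closed2[OF nN yi n(1)] subgroup.m_inv_closed[OF sN n(1)] by (simp add: gi_def)
      have giG: "gi \<in> carrier G" using subgroup.mem_carrier[OF sN gi] .
      define g where "g = (\<lambda>j\<in>{..<r}. if j = i then gi else \<one>)"
      have "g \<in> {..<r} \<rightarrow>\<^sub>E N" using gi subgroup.one_closed[OF sN] by (auto simp: g_def)
      then obtain y' where y': "y' \<in> Y" "close r N y' y" "\<mu>.left_translate g y' \<in> Y"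
        using dense by blast
      define x' where "x' = \<mu>.left_translate g y'"
      note yG' = YG[OF y'(1)] and xG' = YG[OF y'(3), folded x'_def]
      have yi': "y' i \<in> carrier G" using yG' i by blast
      have x'j: "x' j = y' j" if "j < r" "j \<noteq> i" for j
        using that yG' by (simp add: x'_def \<mu>.left_translate_def g_def)
      have x'i: "x' i = gi \<otimes> y' i" using i by (simp add: x'_def \<mu>.left_translate_def g_def)
      define \<sigma> where "\<sigma> = (if b' then inv (y' i) \<otimes> gi \<otimes> y' i else n)"
      let ?z = "letter y' i b'"
      have zG: "?z \<in> carrier G" using letter_closed[of y' i b'] yi' by blast
      have letter: "letter x' i b' = ?z \<otimes> \<sigma>"
        using x'i yi' giG nG by (cases b') (simp_all add: letter_def \<sigma>_def gi_def group_norm yi)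
      have \<sigma>N: "\<sigma> \<in> N" using normal.inv_op_closed1[OF nN yi' gi] n(1) by (simp add: \<sigma>_def)
      have \<sigma>G: "\<sigma> \<in> carrier G" using subgroup.mem_carrier[OF sN \<sigma>N] .
      have \<sigma>n: "\<sigma> \<otimes> inv n \<in> N'"
      proof (cases b')
        case True
        let ?c = "inv (y' i) \<otimes> y i"
        have "y' i \<otimes> inv (y i) \<in> N" using y'(2) i by blast
        from normal.inv_op_closed1[OF nN yi' this] have "inv (y i) \<otimes> y' i \<in> N"
          using yi yi' by (simp add: group_norm)
        from subgroup.m_inv_closed[OF sN this] have "?c \<in> N" using yi yi' by (simp add: inv_mult_group)
        from N(5)[OF this n(1)] show ?thesis
          using True yi yi' nG by (simp add: \<sigma>_def gi_def group_norm)
      next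
        case False
        then show ?thesis using subgroup.one_closed[OF sN'] nG by (simp add: \<sigma>_def)
      qed
      let ?C = "conj_prod ts n" and ?ex = "eval_word G u x'" and ?ey = "eval_word G u y'"
      have E: "?ex \<otimes> inv (?C \<otimes> ?ey) \<in> N'"
        unfolding ts_def
        by (rule eval_word_perturb[OF nN nN' N(4,5) yG yG', of i x' b' \<sigma> n])
           (use x'j y'(2) i xG' letter \<sigma>N \<sigma>n n(1) ur in auto)
      have CG: "?C \<in> carrier G" unfolding ts_def by (rule conj_prod_closed[OF nG fox_terms_closed[OF yG ur i]])
      have eG: "?ex \<in> carrier G" "?ey \<in> carrier G" using eval_word_closed[OF xG' ur] eval_word_closed[OF yG' ur] .
      have "eval_word G w x' \<in> K" "eval_word G w y' \<in> K" using y' by (auto simp: Y_def Z_def x'_def)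
      then have "eval_word G w x' \<otimes> inv (eval_word G w y') \<in> K"
        using subgroup.m_closed[OF normal_imp_subgroup[OF K_normal]] subgroup.m_inv_closed[OF normal_imp_subgroup[OF K_normal]]
        by simp
      \<comment> \<open>Both values of \<open>w\<close> start with \<open>?z\<close>, up to the
        perturbation \<open>\<sigma>\<close>. Normality of \<open>K\<close> removes
        \<open>?z\<close>, and the remaining \<open>\<sigma>\<close> becomes the term 1 of the
        derivative.\<close>
      from normal.inv_op_closed1[OF K_normal zG this]
      have \<kappa>: "\<sigma> \<otimes> ?ex \<otimes> inv ?ey \<in> K"
        using letter zG \<sigma>G eG by (simp add: wu group_norm)
      let ?\<kappa> = "\<sigma> \<otimes> ?ex \<otimes> inv ?ey"
      \<comment> \<open>Modulo \<open>N'\<close>, \<open>\<sigma>\<close> is \<open>n\<close> and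
        \<open>?ex\<close> is \<open>?C \<otimes> ?ey\<close>; so \<open>?\<kappa>\<close> agrees
        with \<open>n \<otimes> ?C\<close>, the product that was chosen to avoid \<open>K\<close>
        modulo \<open>N'\<close>.\<close>
      have "inv (\<sigma> \<otimes> inv n) \<in> N'" using subgroup.m_inv_closed[OF sN' \<sigma>n] .
      from normal.inv_op_closed1[OF nN' \<sigma>G this] have "inv \<sigma> \<otimes> n \<in> N'"
        using \<sigma>G nG by (simp add: group_norm)
      with subgroup.m_inv_closed[OF sN' E] have "inv (?ex \<otimes> inv (?C \<otimes> ?ey)) \<otimes> (inv \<sigma> \<otimes> n) \<in> N'"
        by (rule subgroup.m_closed[OF sN'])
      from normal.inv_op_closed1[OF nN' CG this] have "inv ?\<kappa> \<otimes> (n \<otimes> ?C) \<in> N'"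
        using \<sigma>G nG CG eG by (simp add: group_norm)
      moreover have "conj_prod ((\<one>, True) # ts) n = ?\<kappa> \<otimes> (inv ?\<kappa> \<otimes> (n \<otimes> ?C))"
        using \<sigma>G nG CG eG by (simp add: cancel_inv_right)
      ultimately show False using n(2) \<kappa> by blast
    qed
  qed
qed

theorem theoremC:
  fixes p :: nat and G :: "('a, 'b) monoid_scheme" and T :: "'a topology"
  assumes "virtually_free_pro_p p G T"
  shows "virtually_procyclic G T \<or> randomly_free G T"
proof -
  obtain H where pro_p: "pro_p_group p G T" and openH: "open_subgroup H G T"
    and "free_pro_p_group p (G\<lparr>carrier := H\<rparr>) (subtopology T H)"
    using assms unfolding virtually_free_pro_p_def by blast
  then obtain B where B: "free_pro_p_on p (G\<lparr>carrier := H\<rparr>) (subtopology T H) B"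
    unfolding free_pro_p_group_def by blast
  have "group G" "profinite_group G T"
    using pro_p by (auto simp: pro_p_group_def profinite_group_def topological_group_def)
  then interpret virtually_free G T p H B
    using pro_p openH B
    by (simp add: virtually_free_def virtually_free_axioms_def profinite_def profinite_axioms_def open_subgroup_def)
  interpret F: free_pro_p "G\<lparr>carrier := H\<rparr>" p "subtopology T H" B by (rule free_pro_p_H)
  show ?thesis
  proof (cases "\<exists>a b. a \<in> B \<and> b \<in> B \<and> a \<noteq> b")
    case True
    then show ?thesis using randomly_free_if_two_generators by blast
  next
    case False
    have "\<exists>c\<in>H. B \<subseteq> {c}"
    proof (cases "B = {}")
      case True
      then show ?thesis using subgroup.one_closed[of H G] openH by (auto simp: open_subgroup_def)
    next
      case False
      then show ?thesis using \<open>\<not> (\<exists>a b. a \<in> B \<and> b \<in> B \<and> a \<noteq> b)\<close> basis_H by blast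
    qed
    then obtain c where "c \<in> H" "B \<subseteq> {c}" by blast
    then have "procyclic (G\<lparr>carrier := H\<rparr>) (subtopology T H)"
      using F.procyclic_if_basis_singleton[of c] by simp
    then show ?thesis using openH unfolding virtually_procyclic_def by blast
  qed
qed

end
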